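(* Let $k$ be a field and let $\mathscr C$ be a skeletal finite EI category that is projective over $k$. Let $K:\mathscr C\to k\text{-mod}$ be the functor such that, for each object $x$, $K(x)$ is the $k$-vector space with basis $\bigsqcup_{w\neq x}\mathrm{Hom}_{\mathscr C}(w,x)$, and for each morphism $\alpha:x\to y$, $K(\alpha):K(x)\to K(y)$ is the $k$-linear map with $K(\alpha)(\gamma)=\alpha\circ\gamma$ for $\gamma\in\mathrm{Hom}_{\mathscr C}(w,x)$ with $w\neq x$. Then $K$, viewed as a left module over the category algebra $k\mathscr C$, is projective if and only if the category $\mathscr C$ is free.
   Context: A category is finite if it has only finitely many morphisms (hence finitely many objects). It is skeletal if any two distinct objects are non-isomorphic. A finite EI category is a finite category in which every endomorphism is an isomorphism; so $\mathrm{Hom}_{\mathscr C}(x,x)=\mathrm{Aut}_{\mathscr C}(x)$ is a finite group for each object $x$. A morphism $\alpha:x\to y$ is unfactorizable if it is a non-isomorphism and whenever $\alpha=\gamma\circ\beta$, either $\beta$ or $\gamma$ is an isomorphism. A (skeletal) finite EI category $\mathscr C$ is free if it satisfies the Unique Factorization Property: whenever a non-isomorphism $\alpha:x\to y$ has two decompositions into unfactorizable morphisms $x=x_0\xrightarrow{\alpha_1}x_1\to\cdots\xrightarrow{\alpha_m}x_m=y$ and $x=y_0\xrightarrow{\beta_1}y_1\to\cdots\xrightarrow{\beta_n}y_n=y$, then $m=n$, $x_i=y_i$ for all $i$, and there are $h_i\in\mathrm{Aut}_{\mathscr C}(x_i)$, $1\le i\le n-1$, with $\beta_1=h_1\circ\alpha_1$,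 $\beta_i=h_i\circ\alpha_i\circ h_{i-1}^{-1}$ for $2\le i\le n-1$, and $\beta_n=\alpha_n\circ h_{n-1}^{-1}$. $\mathscr C$ is projective over $k$ if for all objects $x,y$ the $k\mathrm{Aut}_{\mathscr C}(y)$-$k\mathrm{Aut}_{\mathscr C}(x)$-bimodule $k\mathrm{Hom}_{\mathscr C}(x,y)$ is projective as a left module and projective as a right module. The category algebra $k\mathscr C$ has as $k$-basis the morphisms of $\mathscr C$, with product $\alpha*\beta=\alpha\circ\beta$ if composable and $0$ otherwise. $k$-mod is the category of finite dimensional $k$-vector spaces; covariant functors $\mathscr C\to k$-mod are identified with finite dimensional left $k\mathscr C$-modules via the standard equivalence $F\mapsto\bigoplus_x F(x)$. *)

theory Defs
  imports "HOL-Algebra.Algebra"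
begin

section \<open>Finite EI categories\<close>

text \<open>\<open>Comp C \<gamma> \<beta>\<close> is \<open>\<gamma> \<circ> \<beta>\<close> (first \<open>\<beta>\<close>, then \<open>\<gamma>\<close>); it is meaningful only if
  \<open>Cod C \<beta> = Dom C \<gamma>\<close>.\<close>

record ('o, 'm) category =
  Ob :: "'o set"
  Mor :: "'m set"
  Dom :: "'m \<Rightarrow> 'o"
  Cod :: "'m \<Rightarrow> 'o"
  Comp :: "'m \<Rightarrow> 'm \<Rightarrow> 'm"
  Ident :: "'o \<Rightarrow> 'm"

definition Hom :: "('o, 'm) category \<Rightarrow> 'o \<Rightarrow> 'o \<Rightarrow> 'm set" where
  "Hom C x y = {\<alpha> \<in> Mor C. Dom C \<alpha> = x \<and> Cod C \<alpha> = y}"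

locale category =
  fixes C :: "('o, 'm) category"
  assumes Dom_closed: "\<alpha> \<in> Mor C \<Longrightarrow> Dom C \<alpha> \<in> Ob C"
    and Cod_closed: "\<alpha> \<in> Mor C \<Longrightarrow> Cod C \<alpha> \<in> Ob C"
    and Ident_Hom: "x \<in> Ob C \<Longrightarrow> Ident C x \<in> Hom C x x"
    and Comp_Hom: "\<lbrakk>\<beta> \<in> Hom C x y; \<gamma> \<in> Hom C y z\<rbrakk> \<Longrightarrow> Comp C \<gamma> \<beta> \<in> Hom C x z"
    and Ident_right: "\<alpha> \<in> Hom C x y \<Longrightarrow> Comp C \<alpha> (Ident C x) = \<alpha>"
    and Ident_left: "\<alpha> \<in> Hom C x y \<Longrightarrow> Comp C (Ident C y) \<alpha> = \<alpha>"
    and Comp_assoc: "\<lbrakk>\<alpha> \<in> Hom C w x; \<beta> \<in> Hom C x y; \<gamma> \<in> Hom C y z\<rbrakk>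
      \<Longrightarrow> Comp C (Comp C \<gamma> \<beta>) \<alpha> = Comp C \<gamma> (Comp C \<beta> \<alpha>)"

definition iso_mor :: "('o, 'm) category \<Rightarrow> 'm \<Rightarrow> bool" where
  "iso_mor C \<alpha> \<longleftrightarrow> \<alpha> \<in> Mor C \<and>
    (\<exists>\<beta> \<in> Hom C (Cod C \<alpha>) (Dom C \<alpha>).
      Comp C \<beta> \<alpha> = Ident C (Dom C \<alpha>) \<and> Comp C \<alpha> \<beta> = Ident C (Cod C \<alpha>))"

definition isomorphic_objects :: "('o, 'm) category \<Rightarrow> 'o \<Rightarrow> 'o \<Rightarrow> bool" where
  "isomorphic_objects C x y \<longleftrightarrow> (\<exists>\<alpha> \<in> Hom C x y. iso_mor C \<alpha>)"

definition skeletal :: "('o, 'm) category \<Rightarrow> bool" where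
  "skeletal C \<longleftrightarrow> (\<forall>x \<in> Ob C. \<forall>y \<in> Ob C. x \<noteq> y \<longrightarrow> \<not> isomorphic_objects C x y)"

definition Aut :: "('o, 'm) category \<Rightarrow> 'o \<Rightarrow> 'm monoid" where
  "Aut C x = \<lparr>carrier = {\<alpha> \<in> Hom C x x. iso_mor C \<alpha>}, monoid.mult = Comp C, monoid.one = Ident C x\<rparr>"

locale finite_EI_category = category +
  assumes finite_Mor: "finite (Mor C)"
    and EI: "\<lbrakk>x \<in> Ob C; \<alpha> \<in> Hom C x x\<rbrakk> \<Longrightarrow> iso_mor C \<alpha>"


section \<open>Free EI categories\<close>

definition unfactorizable :: "('o, 'm) category \<Rightarrow> 'm \<Rightarrow> bool" where
  "unfactorizable C \<alpha> \<longleftrightarrow> \<alpha> \<in> Mor C \<and> \<not> iso_mor C \<alpha> \<and>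
    (\<forall>\<beta> \<in> Mor C. \<forall>\<gamma> \<in> Mor C. Cod C \<beta> = Dom C \<gamma> \<and> \<alpha> = Comp C \<gamma> \<beta> \<longrightarrow>
      iso_mor C \<beta> \<or> iso_mor C \<gamma>)"

text \<open>A chain \<open>x\<^sub>0 \<rightarrow> x\<^sub>1 \<rightarrow> \<dots> \<rightarrow> x\<^sub>m\<close> of morphisms \<open>\<alpha>\<^sub>1, \<dots>, \<alpha>\<^sub>m\<close> with \<open>m \<ge> 1\<close> is the list
  \<open>[\<alpha>\<^sub>1, \<dots>, \<alpha>\<^sub>m]\<close>, so that \<open>\<alpha>\<^sub>i\<close> is the list element with index \<open>i - 1\<close>;
  \<open>chain_object C as i\<close> is \<open>x\<^sub>i\<close>.\<close>

fun chain_composite :: "('o, 'm) category \<Rightarrow> 'm list \<Rightarrow> 'm" where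
  "chain_composite C [] = undefined"
| "chain_composite C [\<alpha>] = \<alpha>"
| "chain_composite C (\<alpha> # \<beta> # as) = Comp C (chain_composite C (\<beta> # as)) \<alpha>"

definition chain_object :: "('o, 'm) category \<Rightarrow> 'm list \<Rightarrow> nat \<Rightarrow> 'o" where
  "chain_object C as i = (if i = 0 then Dom C (as ! 0) else Cod C (as ! (i - 1)))"

definition unfactorizable_decomposition ::
  "('o, 'm) category \<Rightarrow> 'm \<Rightarrow> 'm list \<Rightarrow> bool" where
  "unfactorizable_decomposition C \<alpha> as \<longleftrightarrow>
    as \<noteq> [] \<and>
    (\<forall>i < length as. unfactorizable C (as ! i)) \<and>
    (\<forall>i. Suc i < length as \<longrightarrow> Cod C (as ! i) = Dom C (as ! Suc i)) \<and>
    chain_composite C as = \<alpha>"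

text \<open>The Unique Factorization Property. The end points \<open>h\<^sub>0\<close> and \<open>h\<^sub>n\<close> are set to identities, so
  that \<open>\<beta>\<^sub>i = h\<^sub>i \<circ> \<alpha>\<^sub>i \<circ> h\<^sub>i\<^sub>-\<^sub>1\<inverse>\<close> for \<open>1 \<le> i \<le> n\<close> also comprises \<open>\<beta>\<^sub>1 = h\<^sub>1 \<circ> \<alpha>\<^sub>1\<close> and
  \<open>\<beta>\<^sub>n = \<alpha>\<^sub>n \<circ> h\<^sub>n\<^sub>-\<^sub>1\<inverse>\<close>, and reads \<open>\<beta>\<^sub>1 = \<alpha>\<^sub>1\<close> for \<open>n = 1\<close>.\<close>

definition free_EI :: "('o, 'm) category \<Rightarrow> bool" where
  "free_EI C \<longleftrightarrow>
    (\<forall>\<alpha> as bs. \<alpha> \<in> Mor C \<and> \<not> iso_mor C \<alpha> \<and>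
        unfactorizable_decomposition C \<alpha> as \<and> unfactorizable_decomposition C \<alpha> bs \<longrightarrow>
      length as = length bs \<and>
      (\<forall>i \<le> length as. chain_object C as i = chain_object C bs i) \<and>
      (\<exists>h :: nat \<Rightarrow> 'm.
        h 0 = Ident C (Dom C \<alpha>) \<and> h (length as) = Ident C (Cod C \<alpha>) \<and>
        (\<forall>i. 1 \<le> i \<and> i \<le> length as - 1 \<longrightarrow> h i \<in> carrier (Aut C (chain_object C as i))) \<and>
        (\<forall>i. 1 \<le> i \<and> i \<le> length as \<longrightarrow>
          bs ! (i - 1) =
            Comp C (h i) (Comp C (as ! (i - 1))
              (inv\<^bsub>Aut C (chain_object C as (i - 1))\<^esub> (h (i - 1)))))))"


section \<open>Modules over rings that need not be commutative\<close>

text \<open>The locale \<open>module\<close> of HOL-Algebra requires a commutative ring. As there, the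
  fields \<open>mult\<close> and \<open>one\<close> of the record that represents a module are irrelevant.\<close>

locale left_module = R?: ring R + M?: abelian_group M
  for R :: "('r, 's) ring_scheme" (structure) and M :: "('r, 'p, 't) module_scheme" (structure) +
  assumes smult_closed:
      "\<lbrakk>a \<in> carrier R; x \<in> carrier M\<rbrakk> \<Longrightarrow> a \<odot>\<^bsub>M\<^esub> x \<in> carrier M"
    and smult_l_distr:
      "\<lbrakk>a \<in> carrier R; b \<in> carrier R; x \<in> carrier M\<rbrakk> \<Longrightarrow>
        (a \<oplus>\<^bsub>R\<^esub> b) \<odot>\<^bsub>M\<^esub> x = a \<odot>\<^bsub>M\<^esub> x \<oplus>\<^bsub>M\<^esub> b \<odot>\<^bsub>M\<^esub> x"
    and smult_r_distr:
      "\<lbrakk>a \<in> carrier R; x \<in> carrier M; y \<in> carrier M\<rbrakk> \<Longrightarrow>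
        a \<odot>\<^bsub>M\<^esub> (x \<oplus>\<^bsub>M\<^esub> y) = a \<odot>\<^bsub>M\<^esub> x \<oplus>\<^bsub>M\<^esub> a \<odot>\<^bsub>M\<^esub> y"
    and smult_assoc:
      "\<lbrakk>a \<in> carrier R; b \<in> carrier R; x \<in> carrier M\<rbrakk> \<Longrightarrow>
        (a \<otimes>\<^bsub>R\<^esub> b) \<odot>\<^bsub>M\<^esub> x = a \<odot>\<^bsub>M\<^esub> (b \<odot>\<^bsub>M\<^esub> x)"
    and smult_one:
      "x \<in> carrier M \<Longrightarrow> \<one>\<^bsub>R\<^esub> \<odot>\<^bsub>M\<^esub> x = x"

definition module_homs ::
  "('r, 's) ring_scheme \<Rightarrow> ('r, 'p, 't) module_scheme \<Rightarrow> ('r, 'q, 'u) module_scheme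
    \<Rightarrow> ('p \<Rightarrow> 'q) set" where
  "module_homs R M N = {f \<in> carrier M \<rightarrow> carrier N.
    (\<forall>x \<in> carrier M. \<forall>y \<in> carrier M. f (x \<oplus>\<^bsub>M\<^esub> y) = f x \<oplus>\<^bsub>N\<^esub> f y) \<and>
    (\<forall>a \<in> carrier R. \<forall>x \<in> carrier M. f (a \<odot>\<^bsub>M\<^esub> x) = a \<odot>\<^bsub>N\<^esub> f x)}"

text \<open>The free left module \<open>R\<^sup>(\<^sup>B\<^sup>)\<close> of finitely supported functions from \<open>B\<close> to \<open>R\<close>, extended by
  zero outside \<open>B\<close>. Over a field it is the vector space with basis \<open>B\<close>.\<close>

definition free_module :: "('r, 's) ring_scheme \<Rightarrow> 'b set \<Rightarrow> ('r, 'b \<Rightarrow> 'r) module" where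
  "free_module R B = \<lparr>
    carrier = {f. (\<forall>b. f b \<in> carrier R) \<and> {b. f b \<noteq> \<zero>\<^bsub>R\<^esub>} \<subseteq> B \<and> finite {b. f b \<noteq> \<zero>\<^bsub>R\<^esub>}},
    monoid.mult = undefined, monoid.one = undefined,
    ring.zero = (\<lambda>b. \<zero>\<^bsub>R\<^esub>), ring.add = (\<lambda>f g b. f b \<oplus>\<^bsub>R\<^esub> g b),
    smult = (\<lambda>a f b. a \<otimes>\<^bsub>R\<^esub> f b)\<rparr>"

text \<open>A module is projective if it is a direct summand of a free module, i.e. the identity of \<open>P\<close>
  factors through a free module. A basis \<open>B\<close> inside the type of elements of \<open>P\<close> is
  enough: if \<open>P\<close> is a direct summand of any free module, then the canonical epimorphism from
  the free module with basis \<open>carrier P\<close> onto \<open>P\<close> splits.\<close>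

definition projective_left_module ::
  "('r, 's) ring_scheme \<Rightarrow> ('r, 'p, 't) module_scheme \<Rightarrow> bool" where
  "projective_left_module R P \<longleftrightarrow> left_module R P \<and>
    (\<exists>(B :: 'p set) i p.
      i \<in> module_homs R P (free_module R B) \<and>
      p \<in> module_homs R (free_module R B) P \<and>
      (\<forall>x \<in> carrier P. p (i x) = x))"

text \<open>A right \<open>R\<close>-module is a left module over the opposite ring, with \<open>x \<cdot> a\<close> written
  \<open>a \<odot> x\<close>.\<close>

definition opposite_ring :: "('r, 's) ring_scheme \<Rightarrow> ('r, 's) ring_scheme" where
  "opposite_ring R = R\<lparr>monoid.mult := (\<lambda>a b. b \<otimes>\<^bsub>R\<^esub> a)\<rparr>"

definition projective_right_module ::
  "('r, 's) ring_scheme \<Rightarrow> ('r, 'p, 't) module_scheme \<Rightarrow> bool" where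
  "projective_right_module R P \<longleftrightarrow> projective_left_module (opposite_ring R) P"


section \<open>Category algebras and group algebras\<close>

text \<open>The \<open>k\<close>-bilinear extension, to finite formal linear combinations of basis elements, of a
  product \<open>m\<close> of basis elements that is \<open>m x y\<close> for \<open>(x, y) \<in> P\<close> and \<open>0\<close> otherwise.\<close>

definition bilinear_extension ::
  "('a, 'q) ring_scheme \<Rightarrow> ('b \<times> 'c) set \<Rightarrow> ('b \<Rightarrow> 'c \<Rightarrow> 'd)
    \<Rightarrow> ('b \<Rightarrow> 'a) \<Rightarrow> ('c \<Rightarrow> 'a) \<Rightarrow> 'd \<Rightarrow> 'a" where
  "bilinear_extension k P m a b z =
    finsum k (\<lambda>(x, y). a x \<otimes>\<^bsub>k\<^esub> b y) {(x, y) \<in> P. m x y = z}"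

definition category_algebra ::
  "('a, 'q) ring_scheme \<Rightarrow> ('o, 'm) category \<Rightarrow> ('m \<Rightarrow> 'a) ring" where
  "category_algebra k C = \<lparr>
    carrier = carrier (free_module k (Mor C)),
    monoid.mult = bilinear_extension k
      {(\<alpha>, \<beta>). \<alpha> \<in> Mor C \<and> \<beta> \<in> Mor C \<and> Cod C \<beta> = Dom C \<alpha>} (Comp C),
    monoid.one = (\<lambda>\<alpha>. if \<alpha> \<in> Ident C ` Ob C then \<one>\<^bsub>k\<^esub> else \<zero>\<^bsub>k\<^esub>),
    ring.zero = ring.zero (free_module k (Mor C)),
    ring.add = ring.add (free_module k (Mor C))\<rparr>"

definition group_algebra ::
  "('a, 'q) ring_scheme \<Rightarrow> ('g, 'h) monoid_scheme \<Rightarrow> ('g \<Rightarrow> 'a) ring" where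
  "group_algebra k G = \<lparr>
    carrier = carrier (free_module k (carrier G)),
    monoid.mult = bilinear_extension k (carrier G \<times> carrier G) (monoid.mult G),
    monoid.one = (\<lambda>g. if g = \<one>\<^bsub>G\<^esub> then \<one>\<^bsub>k\<^esub> else \<zero>\<^bsub>k\<^esub>),
    ring.zero = ring.zero (free_module k (carrier G)),
    ring.add = ring.add (free_module k (carrier G))\<rparr>"


section \<open>Projectivity of a category over a field\<close>

definition Hom_left_module ::
  "('a, 'q) ring_scheme \<Rightarrow> ('o, 'm) category \<Rightarrow> 'o \<Rightarrow> 'o \<Rightarrow> ('m \<Rightarrow> 'a, 'm \<Rightarrow> 'a) module" where
  "Hom_left_module k C x y = \<lparr>
    carrier = carrier (free_module k (Hom C x y)),
    monoid.mult = undefined, monoid.one = undefined,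
    ring.zero = ring.zero (free_module k (Hom C x y)),
    ring.add = ring.add (free_module k (Hom C x y)),
    smult = bilinear_extension k (carrier (Aut C y) \<times> Hom C x y) (Comp C)\<rparr>"

definition Hom_right_module ::
  "('a, 'q) ring_scheme \<Rightarrow> ('o, 'm) category \<Rightarrow> 'o \<Rightarrow> 'o \<Rightarrow> ('m \<Rightarrow> 'a, 'm \<Rightarrow> 'a) module" where
  "Hom_right_module k C x y = \<lparr>
    carrier = carrier (free_module k (Hom C x y)),
    monoid.mult = undefined, monoid.one = undefined,
    ring.zero = ring.zero (free_module k (Hom C x y)),
    ring.add = ring.add (free_module k (Hom C x y)),
    smult = (\<lambda>a f. bilinear_extension k (Hom C x y \<times> carrier (Aut C x)) (Comp C) f a)\<rparr>"

definition projective_over :: "('a, 'q) ring_scheme \<Rightarrow> ('o, 'm) category \<Rightarrow> bool" where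
  "projective_over k C \<longleftrightarrow> (\<forall>x \<in> Ob C. \<forall>y \<in> Ob C.
    projective_left_module (group_algebra k (Aut C y)) (Hom_left_module k C x y) \<and>
    projective_right_module (group_algebra k (Aut C x)) (Hom_right_module k C x y))"


section \<open>Functors to finite-dimensional vector spaces\<close>

record ('o, 'm, 'a, 'v) vector_functor =
  obj_map :: "'o \<Rightarrow> ('a, 'v) module"
  mor_map :: "'m \<Rightarrow> 'v \<Rightarrow> 'v"

definition finite_dimensional ::
  "('a, 'q) ring_scheme \<Rightarrow> ('a, 'v, 't) module_scheme \<Rightarrow> bool" where
  "finite_dimensional k V \<longleftrightarrow> (\<exists>S. finite S \<and> S \<subseteq> carrier V \<and>
    (\<forall>v \<in> carrier V. \<exists>c \<in> S \<rightarrow> carrier k. v = finsum V (\<lambda>s. c s \<odot>\<^bsub>V\<^esub> s) S))"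

locale functor_to_kmod = category C
  for k :: "('a, 'q) ring_scheme" and C :: "('o, 'm) category"
    and F :: "('o, 'm, 'a, 'v) vector_functor" +
  assumes obj_module: "x \<in> Ob C \<Longrightarrow> module k (obj_map F x)"
    and obj_finite_dimensional: "x \<in> Ob C \<Longrightarrow> finite_dimensional k (obj_map F x)"
    and mor_linear: "\<alpha> \<in> Hom C x y \<Longrightarrow>
      mor_map F \<alpha> \<in> module_homs k (obj_map F x) (obj_map F y)"
    and mor_Ident: "\<lbrakk>x \<in> Ob C; v \<in> carrier (obj_map F x)\<rbrakk> \<Longrightarrow> mor_map F (Ident C x) v = v"
    and mor_Comp: "\<lbrakk>\<beta> \<in> Hom C x y; \<gamma> \<in> Hom C y z; v \<in> carrier (obj_map F x)\<rbrakk> \<Longrightarrow>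
      mor_map F (Comp C \<gamma> \<beta>) v = mor_map F \<gamma> (mor_map F \<beta> v)"

text \<open>The left module \<open>\<Oplus>\<^sub>x F(x)\<close> over the category algebra: a morphism \<open>\<alpha> : x \<rightarrow> y\<close> sends the
  component at \<open>x\<close> to the component at \<open>y\<close> by \<open>F(\<alpha>)\<close> and annihilates the other
  components. There being only finitely many objects, the direct sum is a product.\<close>

definition functor_module ::
  "('o, 'm) category \<Rightarrow> ('o, 'm, 'a, 'v) vector_functor \<Rightarrow> ('m \<Rightarrow> 'a, 'o \<Rightarrow> 'v) module" where
  "functor_module C F = \<lparr>
    carrier = (\<Pi>\<^sub>E x \<in> Ob C. carrier (obj_map F x)),
    monoid.mult = undefined, monoid.one = undefined,
    ring.zero = (\<lambda>x \<in> Ob C. \<zero>\<^bsub>obj_map F x\<^esub>),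
    ring.add = (\<lambda>v w. \<lambda>x \<in> Ob C. v x \<oplus>\<^bsub>obj_map F x\<^esub> w x),
    smult = (\<lambda>a v. \<lambda>y \<in> Ob C.
      finsum (obj_map F y) (\<lambda>\<alpha>. a \<alpha> \<odot>\<^bsub>obj_map F y\<^esub> mor_map F \<alpha> (v (Dom C \<alpha>)))
        {\<alpha> \<in> Mor C. Cod C \<alpha> = y})\<rparr>"

text \<open>The basis \<open>\<Squnion>\<^sub>w\<^sub>\<noteq>\<^sub>x Hom(w, x)\<close> of \<open>K(x)\<close>; a morphism determines its domain, so the
  union is disjoint.\<close>

definition K_basis :: "('o, 'm) category \<Rightarrow> 'o \<Rightarrow> 'm set" where
  "K_basis C x = (\<Union>w \<in> Ob C - {x}. Hom C w x)"

text \<open>The coefficient of \<open>\<delta>\<close> in \<open>K(\<alpha>)(f)\<close>, where \<open>f = \<Sum>\<^sub>\<gamma> f(\<gamma>) \<gamma>\<close>, is the sum of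
  all \<open>f(\<gamma>)\<close> with \<open>\<alpha> \<circ> \<gamma> = \<delta>\<close>.\<close>

definition K_functor ::
  "('a, 'q) ring_scheme \<Rightarrow> ('o, 'm) category \<Rightarrow> ('o, 'm, 'a, 'm \<Rightarrow> 'a) vector_functor" where
  "K_functor k C = \<lparr>
    obj_map = (\<lambda>x. free_module k (K_basis C x)),
    mor_map = (\<lambda>\<alpha> f \<delta>. finsum k f {\<gamma> \<in> K_basis C (Dom C \<alpha>). Comp C \<alpha> \<gamma> = \<delta>})\<rparr>"


section \<open>The objects above are rings, modules and functors\<close>

text \<open>Nothing here is used in the definitions. Since \<open>projective_left_module\<close> includes
  \<open>left_module\<close>, these facts show that this conjunct always holds where it is applied.\<close>

lemma (in ring) free_module_abelian_group: "abelian_group (free_module R B)"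
proof (rule abelian_groupI)
  fix f g assume fg: "f \<in> carrier (free_module R B)" "g \<in> carrier (free_module R B)"
  have "{b. f b \<oplus> g b \<noteq> \<zero>} \<subseteq> {b. f b \<noteq> \<zero>} \<union> {b. g b \<noteq> \<zero>}" by auto
  then show "f \<oplus>\<^bsub>free_module R B\<^esub> g \<in> carrier (free_module R B)"
    using fg by (auto simp: free_module_def intro: finite_subset)
next
  fix f assume f: "f \<in> carrier (free_module R B)"
  have *: "{b. \<ominus> f b \<noteq> \<zero>} = {b. f b \<noteq> \<zero>}" using f by (auto simp: free_module_def)
  show "\<exists>g\<in>carrier (free_module R B). g \<oplus>\<^bsub>free_module R B\<^esub> f = \<zero>\<^bsub>free_module R B\<^esub>"
    by (rule bexI[of _ "\<lambda>b. \<ominus> f b"]) (use f * in \<open>auto simp: free_module_def l_neg\<close>)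
qed (auto simp: free_module_def a_ac)

lemma (in ring) free_module_left_module: "left_module R (free_module R B)"
proof -
  interpret M: abelian_group "free_module R B" by (rule free_module_abelian_group)
  show ?thesis
  proof
    fix a f assume af: "a \<in> carrier R" "f \<in> carrier (free_module R B)"
    have "{b. a \<otimes> f b \<noteq> \<zero>} \<subseteq> {b. f b \<noteq> \<zero>}" using af by auto
    then show "a \<odot>\<^bsub>free_module R B\<^esub> f \<in> carrier (free_module R B)"
      using af by (auto simp: free_module_def intro: finite_subset)
  qed (auto simp: free_module_def l_distr r_distr m_assoc)
qed

lemma (in ring) free_module_carrier_finite:
  "finite B \<Longrightarrow> f \<in> carrier (free_module R B) \<longleftrightarrow>
    (\<forall>b. f b \<in> carrier R) \<and> (\<forall>b. b \<notin> B \<longrightarrow> f b = \<zero>)"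
  by (auto simp: free_module_def intro: finite_subset)

lemma (in abelian_monoid) finsum_fibres:
  assumes "finite I" "\<And>i. i \<in> I \<Longrightarrow> finite (A i)" "\<And>i x. i \<in> I \<Longrightarrow> x \<in> A i \<Longrightarrow> f (i, x) \<in> carrier G"
  shows "(\<Oplus>i\<in>I. \<Oplus>x\<in>A i. f (i, x)) = (\<Oplus>p\<in>Sigma I A. f p)"
proof -
  have "(\<Oplus>p\<in>Sigma I A. f p) = (\<Oplus>p\<in>(\<Union>i\<in>I. Pair i ` A i). f p)"
    by (rule arg_cong[where f = "finsum G f"]) auto
  also have "\<dots> = (\<Oplus>i\<in>I. \<Oplus>p\<in>Pair i ` A i. f p)"
    by (rule add.finprod_UN_disjoint) (use assms in \<open>auto simp: pairwise_def disjnt_def\<close>)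
  also have "\<dots> = (\<Oplus>i\<in>I. \<Oplus>x\<in>A i. f (i, x))"
  proof (rule finsum_cong')
    fix i assume "i \<in> I"
    then show "(\<Oplus>p\<in>Pair i ` A i. f p) = (\<Oplus>x\<in>A i. f (i, x))"
      by (intro finsum_reindex) (use assms in \<open>auto simp: inj_on_def\<close>)
  qed (use assms in \<open>auto intro!: finsum_closed\<close>)
  finally show ?thesis by simp
qed

context ring begin

lemma bilinear_extension_closed:
  assumes "\<And>x. a x \<in> carrier R" "\<And>y. b y \<in> carrier R"
  shows "bilinear_extension R P m a b z \<in> carrier R"
  unfolding bilinear_extension_def using assms by (intro finsum_closed) auto

lemma bilinear_extension_free:
  assumes "finite D" "\<And>x y. (x, y) \<in> P \<Longrightarrow> m x y \<in> D"
    "\<And>x. a x \<in> carrier R" "\<And>y. b y \<in> carrier R"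
  shows "bilinear_extension R P m a b \<in> carrier (free_module R D)"
proof -
  have "bilinear_extension R P m a b z = \<zero>" if "z \<notin> D" for z
  proof -
    have "{(x, y) \<in> P. m x y = z} = {}" using assms(2) that by auto
    then show ?thesis by (simp only: bilinear_extension_def finsum_empty)
  qed
  moreover have "bilinear_extension R P m a b z \<in> carrier R" for z
    by (rule bilinear_extension_closed) (use assms in auto)
  ultimately show ?thesis using assms(1) by (simp add: free_module_carrier_finite)
qed

lemma bilinear_extension_add_l:
  assumes "\<And>x. a x \<in> carrier R" "\<And>x. a' x \<in> carrier R" "\<And>y. b y \<in> carrier R"
  shows "bilinear_extension R P m (\<lambda>x. a x \<oplus> a' x) b
    = (\<lambda>z. bilinear_extension R P m a b z \<oplus> bilinear_extension R P m a' b z)"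
proof
  fix z
  let ?A = "{(x, y) \<in> P. m x y = z}"
  have "(\<Oplus>p\<in>?A. (case p of (x, y) \<Rightarrow> (a x \<oplus> a' x) \<otimes> b y))
     = (\<Oplus>p\<in>?A. (case p of (x, y) \<Rightarrow> a x \<otimes> b y) \<oplus> (case p of (x, y) \<Rightarrow> a' x \<otimes> b y))"
    by (rule arg_cong[where f = "\<lambda>g. finsum R g ?A"]) (auto simp: fun_eq_iff assms l_distr)
  also have "\<dots> = (\<Oplus>p\<in>?A. (case p of (x, y) \<Rightarrow> a x \<otimes> b y)) \<oplus>
    (\<Oplus>p\<in>?A. (case p of (x, y) \<Rightarrow> a' x \<otimes> b y))"
    by (rule finsum_addf) (auto simp: assms)
  finally show "bilinear_extension R P m (\<lambda>x. a x \<oplus> a' x) b z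
    = bilinear_extension R P m a b z \<oplus> bilinear_extension R P m a' b z"
    by (simp add: bilinear_extension_def)
qed

lemma bilinear_extension_add_r:
  assumes "\<And>x. a x \<in> carrier R" "\<And>x. b' x \<in> carrier R" "\<And>y. b y \<in> carrier R"
  shows "bilinear_extension R P m a (\<lambda>x. b x \<oplus> b' x)
    = (\<lambda>z. bilinear_extension R P m a b z \<oplus> bilinear_extension R P m a b' z)"
proof
  fix z
  let ?A = "{(x, y) \<in> P. m x y = z}"
  have "(\<Oplus>p\<in>?A. (case p of (x, y) \<Rightarrow> a x \<otimes> (b y \<oplus> b' y)))
     = (\<Oplus>p\<in>?A. (case p of (x, y) \<Rightarrow> a x \<otimes> b y) \<oplus> (case p of (x, y) \<Rightarrow> a x \<otimes> b' y))"
    by (rule arg_cong[where f = "\<lambda>g. finsum R g ?A"]) (auto simp: fun_eq_iff assms r_distr)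
  also have "\<dots> = (\<Oplus>p\<in>?A. (case p of (x, y) \<Rightarrow> a x \<otimes> b y)) \<oplus>
    (\<Oplus>p\<in>?A. (case p of (x, y) \<Rightarrow> a x \<otimes> b' y))"
    by (rule finsum_addf) (auto simp: assms)
  finally show "bilinear_extension R P m a (\<lambda>x. b x \<oplus> b' x) z
    = bilinear_extension R P m a b z \<oplus> bilinear_extension R P m a b' z"
    by (simp add: bilinear_extension_def)
qed

lemma bilinear_extension_assoc:
  assumes fin: "finite P" "finite Q" "finite P'" "finite Q'"
    and eq: "\<And>x y w. (x, y) \<in> Q \<and> (m' x y, w) \<in> P \<longleftrightarrow> (y, w) \<in> Q' \<and> (x, n' y w) \<in> P'"
    and as: "\<And>x y w. (x, y) \<in> Q \<Longrightarrow> (m' x y, w) \<in> P \<Longrightarrow> m (m' x y) w = n x (n' y w)"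
    and c: "\<And>x. a x \<in> carrier R" "\<And>y. b y \<in> carrier R" "\<And>y. c y \<in> carrier R"
  shows "bilinear_extension R P m (bilinear_extension R Q m' a b) c
    = bilinear_extension R P' n a (bilinear_extension R Q' n' b c)"
proof
  fix z
  let ?A = "{(u, w). (u, w) \<in> P \<and> m u w = z}"
  let ?B = "\<lambda>(u, w). {(x, y). (x, y) \<in> Q \<and> m' x y = u}"
  let ?A' = "{(x, v). (x, v) \<in> P' \<and> n x v = z}"
  let ?B' = "\<lambda>(x, v). {(y, w). (y, w) \<in> Q' \<and> n' y w = v}"
  let ?f = "\<lambda>((u, w), (x, y)). a x \<otimes> b y \<otimes> c w"
  let ?f' = "\<lambda>((x, v), (y, w)). a x \<otimes> b y \<otimes> c w"
  have fA: "finite ?A" "finite ?A'" using fin by (auto intro: rev_finite_subset)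
  have fB: "finite (?B p)" "finite (?B' q)" for p q
    using fin by (auto intro: rev_finite_subset split: prod.split)
  have "bilinear_extension R P m (bilinear_extension R Q m' a b) c z
     = (\<Oplus>p\<in>?A. \<Oplus>q\<in>?B p. ?f (p, q))"
    unfolding bilinear_extension_def[of R P m]
  proof (rule finsum_cong')
    fix p assume "p \<in> ?A"
    obtain u w where p: "p = (u, w)" by force
    have "(\<Oplus>q\<in>{(x, y) \<in> Q. m' x y = u}. case q of (x, y) \<Rightarrow> a x \<otimes> b y) \<otimes> c w
      = (\<Oplus>q\<in>{(x, y) \<in> Q. m' x y = u}. (case q of (x, y) \<Rightarrow> a x \<otimes> b y) \<otimes> c w)"
      by (rule finsum_ldistr) (use c fB(1)[of p] p in auto)
    also have "\<dots> = (\<Oplus>q\<in>?B p. ?f (p, q))" using p by (simp add: case_prod_unfold)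
    finally show "(case p of (x, y) \<Rightarrow> bilinear_extension R Q m' a b x \<otimes> c y)
      = (\<Oplus>q\<in>?B p. ?f (p, q))" using p by (simp add: bilinear_extension_def)
  qed (use c in \<open>auto intro!: finsum_closed bilinear_extension_closed\<close>)
  also have "\<dots> = (\<Oplus>t\<in>Sigma ?A ?B. ?f t)"
    by (rule finsum_fibres) (use fA fB c in auto)
  also have "\<dots> = (\<Oplus>t\<in>Sigma ?A' ?B'. ?f' t)"
  proof -
    let ?h = "\<lambda>((x, v), (y, w)). ((m' x y, w), (x, y))"
    have im: "?h ` Sigma ?A' ?B' = Sigma ?A ?B"
    proof
      show "?h ` Sigma ?A' ?B' \<subseteq> Sigma ?A ?B"
        using eq as by fastforce
      show "Sigma ?A ?B \<subseteq> ?h ` Sigma ?A' ?B'"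
      proof
        fix t assume "t \<in> Sigma ?A ?B"
        then obtain x y w where "t = ((m' x y, w), (x, y))" "(m' x y, w) \<in> P" "(x, y) \<in> Q"
          "m (m' x y) w = z" by auto
        then show "t \<in> ?h ` Sigma ?A' ?B'"
          using eq[of x y w] as[of x y w] by (intro image_eqI[of _ _ "((x, n' y w), (y, w))"]) auto
      qed
    qed
    have "(\<Oplus>t\<in>?h ` Sigma ?A' ?B'. ?f t) = (\<Oplus>t\<in>Sigma ?A' ?B'. ?f (?h t))"
      by (rule finsum_reindex) (auto simp: inj_on_def c)
    also have "\<dots> = (\<Oplus>t\<in>Sigma ?A' ?B'. ?f' t)"
      by (rule arg_cong[where f = "\<lambda>g. finsum R g _"]) auto
    finally show ?thesis unfolding im .
  qed
  also have "\<dots> = (\<Oplus>p\<in>?A'. \<Oplus>q\<in>?B' p. ?f' (p, q))"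
    by (rule finsum_fibres[symmetric]) (use fA fB c in auto)
  also have "\<dots> = bilinear_extension R P' n a (bilinear_extension R Q' n' b c) z"
    unfolding bilinear_extension_def[of R P' n]
  proof (rule finsum_cong')
    fix p assume "p \<in> ?A'"
    obtain x v where p: "p = (x, v)" by force
    have "a x \<otimes> (\<Oplus>q\<in>{(y, w) \<in> Q'. n' y w = v}. case q of (y, w) \<Rightarrow> b y \<otimes> c w)
      = (\<Oplus>q\<in>{(y, w) \<in> Q'. n' y w = v}. a x \<otimes> (case q of (y, w) \<Rightarrow> b y \<otimes> c w))"
      by (rule finsum_rdistr) (use c fB(2)[of p] p in auto)
    also have "\<dots> = (\<Oplus>q\<in>?B' p. ?f' (p, q))" using p c by (simp add: case_prod_unfold m_assoc)
    finally show "(\<Oplus>q\<in>?B' p. ?f' (p, q)) = (case p of (x, y) \<Rightarrow> a x \<otimes> bilinear_extension R Q' n' b c y)"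
      using p by (simp add: bilinear_extension_def)
  qed (use c in \<open>auto intro!: finsum_closed bilinear_extension_closed\<close>)
  finally show "bilinear_extension R P m (bilinear_extension R Q m' a b) c z
    = bilinear_extension R P' n a (bilinear_extension R Q' n' b c) z" .
qed

lemma bilinear_extension_unit_l:
  assumes "finite P" "\<And>x y. (x, y) \<in> P \<Longrightarrow> x \<in> E \<Longrightarrow> m x y = y \<and> y \<in> D \<and> x = e y"
    "\<And>z. z \<in> D \<Longrightarrow> (e z, z) \<in> P \<and> e z \<in> E"
    "b \<in> carrier (free_module R D)"
  shows "bilinear_extension R P m (\<lambda>x. if x \<in> E then \<one> else \<zero>) b = b"
proof
  fix z
  have b: "b y \<in> carrier R" "y \<notin> D \<Longrightarrow> b y = \<zero>" for y using assms(4) by (auto simp: free_module_def)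
  let ?A = "{(x, y). (x, y) \<in> P \<and> m x y = z}"
  have fA: "finite ?A" using assms(1) by (auto intro: rev_finite_subset)
  show "bilinear_extension R P m (\<lambda>x. if x \<in> E then \<one> else \<zero>) b z = b z"
  proof (cases "z \<in> D")
    case True
    then have i: "(e z, z) \<in> ?A" using assms(2,3) by blast
    have "(\<Oplus>p\<in>?A. case p of (x, y) \<Rightarrow> (if x \<in> E then \<one> else \<zero>) \<otimes> b y)
      = (\<Oplus>p\<in>?A. if (e z, z) = p then b (snd p) else \<zero>)"
    proof (rule finsum_cong')
      fix p assume p: "p \<in> ?A"
      obtain x y where xy: "p = (x, y)" by force
      have P: "(x, y) \<in> P" "m x y = z" using p xy by auto
      show "(case p of (x, y) \<Rightarrow> (if x \<in> E then \<one> else \<zero>) \<otimes> b y) = (if (e z, z) = p then b (snd p) else \<zero>)"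
      proof (cases "x \<in> E")
        case True
        then have "y = z" "x = e z" using assms(2)[OF P(1)] P(2) by simp_all
        with True show ?thesis using xy b by simp
      next
        case False
        then have "(e z, z) \<noteq> p" using xy assms(3)[OF \<open>z \<in> D\<close>] by auto
        then show ?thesis using xy b False by auto
      qed
    qed (use b in auto)
    also have "\<dots> = b z" using add.finprod_singleton[OF i fA, of "\<lambda>p. b (snd p)"] b by auto
    finally show ?thesis by (simp add: bilinear_extension_def)
  next
    case False
    have "(\<Oplus>p\<in>?A. case p of (x, y) \<Rightarrow> (if x \<in> E then \<one> else \<zero>) \<otimes> b y) = (\<Oplus>p\<in>?A. \<zero>)"
    proof (rule finsum_cong')
      fix p assume p: "p \<in> ?A"
      obtain x y where xy: "p = (x, y)" by force
      have P: "(x, y) \<in> P" "m x y = z" using p xy by auto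
      have "x \<notin> E" using assms(2)[OF P(1)] P(2) False by auto
      then show "(case p of (x, y) \<Rightarrow> (if x \<in> E then \<one> else \<zero>) \<otimes> b y) = \<zero>" using xy b by simp
    qed (use b in auto)
    then show ?thesis using b False by (simp add: bilinear_extension_def)
  qed
qed

lemma bilinear_extension_unit_r:
  assumes "finite P" "\<And>x y. (y, x) \<in> P \<Longrightarrow> x \<in> E \<Longrightarrow> m y x = y \<and> y \<in> D \<and> x = e y"
    "\<And>z. z \<in> D \<Longrightarrow> (z, e z) \<in> P \<and> e z \<in> E"
    "b \<in> carrier (free_module R D)"
  shows "bilinear_extension R P m b (\<lambda>x. if x \<in> E then \<one> else \<zero>) = b"
proof
  fix z
  have b: "b y \<in> carrier R" "y \<notin> D \<Longrightarrow> b y = \<zero>" for y using assms(4) by (auto simp: free_module_def)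
  let ?A = "{(x, y). (x, y) \<in> P \<and> m x y = z}"
  have fA: "finite ?A" using assms(1) by (auto intro: rev_finite_subset)
  show "bilinear_extension R P m b (\<lambda>x. if x \<in> E then \<one> else \<zero>) z = b z"
  proof (cases "z \<in> D")
    case True
    then have i: "(z, e z) \<in> ?A" using assms(2,3) by blast
    have "(\<Oplus>p\<in>?A. case p of (y, x) \<Rightarrow> b y \<otimes> (if x \<in> E then \<one> else \<zero>))
      = (\<Oplus>p\<in>?A. if (z, e z) = p then b (fst p) else \<zero>)"
    proof (rule finsum_cong')
      fix p assume p: "p \<in> ?A"
      obtain x y where xy: "p = (x, y)" by force
      have P: "(x, y) \<in> P" "m x y = z" using p xy by auto
      show "(case p of (x, y) \<Rightarrow> b x \<otimes> (if y \<in> E then \<one> else \<zero>)) = (if (z, e z) = p then b (fst p) else \<zero>)"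
      proof (cases "y \<in> E")
        case True
        then have "x = z" "y = e z" using assms(2)[OF P(1)] P(2) by simp_all
        with True show ?thesis using xy b by simp
      next
        case False
        then have "(z, e z) \<noteq> p" using xy assms(3)[OF \<open>z \<in> D\<close>] by auto
        then show ?thesis using xy b False by auto
      qed
    qed (use b in auto)
    also have "\<dots> = b z" using add.finprod_singleton[OF i fA, of "\<lambda>p. b (fst p)"] b by auto
    finally show ?thesis by (simp add: bilinear_extension_def)
  next
    case False
    have "(\<Oplus>p\<in>?A. case p of (y, x) \<Rightarrow> b y \<otimes> (if x \<in> E then \<one> else \<zero>)) = (\<Oplus>p\<in>?A. \<zero>)"
    proof (rule finsum_cong')
      fix p assume p: "p \<in> ?A"
      obtain x y where xy: "p = (x, y)" by force
      have P: "(x, y) \<in> P" "m x y = z" using p xy by auto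
      have "y \<notin> E" using assms(2)[OF P(1)] P(2) False by auto
      then show "(case p of (x, y) \<Rightarrow> b x \<otimes> (if y \<in> E then \<one> else \<zero>)) = \<zero>" using xy b by simp
    qed (use b in auto)
    then show ?thesis using b False by (simp add: bilinear_extension_def)
  qed
qed

end

context category begin

lemma iso_mor_Comp:
  assumes "\<alpha> \<in> Hom C x y" "\<beta> \<in> Hom C y z" "iso_mor C \<alpha>" "iso_mor C \<beta>"
  shows "iso_mor C (Comp C \<beta> \<alpha>)"
proof -
  obtain a b where a: "a \<in> Hom C y x" "Comp C a \<alpha> = Ident C x" "Comp C \<alpha> a = Ident C y"
    and b: "b \<in> Hom C z y" "Comp C b \<beta> = Ident C y" "Comp C \<beta> b = Ident C z"
    using assms by (auto simp: iso_mor_def Hom_def)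
  have h: "Comp C \<beta> \<alpha> \<in> Hom C x z" "Comp C a b \<in> Hom C z x" using assms a b Comp_Hom by blast+
  have "Comp C (Comp C a b) (Comp C \<beta> \<alpha>) = Comp C a (Comp C (Comp C b \<beta>) \<alpha>)"
    using Comp_assoc[OF h(1) b(1) a(1)] Comp_assoc[OF assms(1,2) b(1)] by simp
  moreover have "Comp C (Comp C \<beta> \<alpha>) (Comp C a b) = Comp C \<beta> (Comp C (Comp C \<alpha> a) b)"
    using Comp_assoc[OF h(2) assms(1,2)] Comp_assoc[OF b(1) a(1) assms(1)] by simp
  ultimately have "Comp C (Comp C a b) (Comp C \<beta> \<alpha>) = Ident C x" "Comp C (Comp C \<beta> \<alpha>) (Comp C a b) = Ident C z"
    using a b assms Ident_left by auto
  with h have "Comp C \<beta> \<alpha> \<in> Mor C \<and> Comp C a b \<in> Hom C (Cod C (Comp C \<beta> \<alpha>)) (Dom C (Comp C \<beta> \<alpha>)) \<and>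
    Comp C (Comp C a b) (Comp C \<beta> \<alpha>) = Ident C (Dom C (Comp C \<beta> \<alpha>)) \<and>
    Comp C (Comp C \<beta> \<alpha>) (Comp C a b) = Ident C (Cod C (Comp C \<beta> \<alpha>))"
    by (simp add: Hom_def)
  then show ?thesis unfolding iso_mor_def by (intro conjI bexI[of _ "Comp C a b"]) simp_all
qed

lemma Aut_group: assumes "x \<in> Ob C" shows "group (Aut C x)"
proof (rule groupI)
  show "\<one>\<^bsub>Aut C x\<^esub> \<in> carrier (Aut C x)"
    using Ident_Hom[OF assms] Ident_left[OF Ident_Hom[OF assms]]
    by (auto simp: Aut_def iso_mor_def Hom_def)
next
  fix a assume "a \<in> carrier (Aut C x)"
  then obtain b where a: "a \<in> Hom C x x" and b: "b \<in> Hom C x x" "Comp C b a = Ident C x" "Comp C a b = Ident C x"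
    by (auto simp: Aut_def iso_mor_def Hom_def)
  then have "b \<in> carrier (Aut C x)" by (auto simp: Aut_def iso_mor_def Hom_def)
  with b show "\<exists>b\<in>carrier (Aut C x). b \<otimes>\<^bsub>Aut C x\<^esub> a = \<one>\<^bsub>Aut C x\<^esub>" by (auto simp: Aut_def)
qed (use iso_mor_Comp Comp_Hom Comp_assoc Ident_left in \<open>auto simp: Aut_def\<close>)

end

lemma (in ring) category_algebra_ring:
  assumes "category C" "finite (Mor C)" shows "ring (category_algebra R C)"
proof -
  interpret category C by fact
  let ?P = "{(\<alpha>, \<beta>). \<alpha> \<in> Mor C \<and> \<beta> \<in> Mor C \<and> Cod C \<beta> = Dom C \<alpha>}"
  have P: "finite ?P" by (rule finite_subset[of _ "Mor C \<times> Mor C"]) (use assms in auto)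
  have cl: "(x, y) \<in> ?P \<Longrightarrow> Comp C x y \<in> Mor C \<and> Dom C (Comp C x y) = Dom C y \<and> Cod C (Comp C x y) = Cod C x" for x y
    using Comp_Hom[of y "Dom C y" "Cod C y" x "Cod C x"] by (auto simp: Hom_def)
  have I: "x \<in> Ob C \<Longrightarrow> Ident C x \<in> Mor C \<and> Dom C (Ident C x) = x \<and> Cod C (Ident C x) = x" for x
    using Ident_Hom[of x] by (auto simp: Hom_def)
  have IL: "\<alpha> \<in> Mor C \<Longrightarrow> Comp C (Ident C (Cod C \<alpha>)) \<alpha> = \<alpha>" "\<alpha> \<in> Mor C \<Longrightarrow> Comp C \<alpha> (Ident C (Dom C \<alpha>)) = \<alpha>" for \<alpha>
    using Ident_left Ident_right by (auto simp: Hom_def)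
  interpret M: abelian_group "free_module R (Mor C)" by (rule free_module_abelian_group)
  have c: "f \<in> carrier (free_module R (Mor C)) \<Longrightarrow> f x \<in> carrier R" for f x by (auto simp: free_module_def)
  show ?thesis
  proof (rule ringI)
    show "abelian_group (category_algebra R C)"
      by (rule abelian_groupI)
        (use M.a_ac M.l_neg M.a_inv_closed in \<open>auto simp: category_algebra_def M.a_assoc[simplified]\<close>)
    show "monoid (category_algebra R C)"
    proof (rule monoidI)
      fix a b assume "a \<in> carrier (category_algebra R C)" "b \<in> carrier (category_algebra R C)"
      then show "a \<otimes>\<^bsub>category_algebra R C\<^esub> b \<in> carrier (category_algebra R C)"
        unfolding category_algebra_def using bilinear_extension_free[OF assms(2), of ?P "Comp C" a b] cl c by auto
    next
      show "\<one>\<^bsub>category_algebra R C\<^esub> \<in> carrier (category_algebra R C)"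
        using I by (auto simp: category_algebra_def free_module_carrier_finite[OF assms(2)])
    next
      fix a b d assume "a \<in> carrier (category_algebra R C)" "b \<in> carrier (category_algebra R C)" "d \<in> carrier (category_algebra R C)"
      then show "a \<otimes>\<^bsub>category_algebra R C\<^esub> b \<otimes>\<^bsub>category_algebra R C\<^esub> d = a \<otimes>\<^bsub>category_algebra R C\<^esub> (b \<otimes>\<^bsub>category_algebra R C\<^esub> d)"
        unfolding category_algebra_def using c
        apply simp
        apply (rule bilinear_extension_assoc[OF P P P P])
        using cl Comp_assoc by (auto simp: Hom_def)
    next
      fix a assume "a \<in> carrier (category_algebra R C)"
      then show "\<one>\<^bsub>category_algebra R C\<^esub> \<otimes>\<^bsub>category_algebra R C\<^esub> a = a"
        unfolding category_algebra_def apply simp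
        by (rule bilinear_extension_unit_l[OF P, where D = "Mor C" and e = "\<lambda>\<alpha>. Ident C (Cod C \<alpha>)"]) (use I IL Cod_closed in auto)
    next
      fix a assume "a \<in> carrier (category_algebra R C)"
      then show "a \<otimes>\<^bsub>category_algebra R C\<^esub> \<one>\<^bsub>category_algebra R C\<^esub> = a"
        unfolding category_algebra_def apply simp
        by (rule bilinear_extension_unit_r[OF P, where D = "Mor C" and e = "\<lambda>\<alpha>. Ident C (Dom C \<alpha>)"]) (use I IL Dom_closed in auto)
    qed
  next
    fix x y z assume "x \<in> carrier (category_algebra R C)" "y \<in> carrier (category_algebra R C)" "z \<in> carrier (category_algebra R C)"
    then have "\<And>m. x m \<in> carrier R" "\<And>m. y m \<in> carrier R" "\<And>m. z m \<in> carrier R"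
      using c by (auto simp: category_algebra_def)
    note b = bilinear_extension_add_l[OF this] bilinear_extension_add_r[OF this(3,2,1)]
    show "(x \<oplus>\<^bsub>category_algebra R C\<^esub> y) \<otimes>\<^bsub>category_algebra R C\<^esub> z =
       x \<otimes>\<^bsub>category_algebra R C\<^esub> z \<oplus>\<^bsub>category_algebra R C\<^esub> y \<otimes>\<^bsub>category_algebra R C\<^esub> z"
      "z \<otimes>\<^bsub>category_algebra R C\<^esub> (x \<oplus>\<^bsub>category_algebra R C\<^esub> y) =
       z \<otimes>\<^bsub>category_algebra R C\<^esub> x \<oplus>\<^bsub>category_algebra R C\<^esub> z \<otimes>\<^bsub>category_algebra R C\<^esub> y"
      by (simp_all add: category_algebra_def free_module_def b)
  qed
qed

lemma (in ring) group_algebra_ring: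
  assumes "group G" "finite (carrier G)" shows "ring (group_algebra R G)"
proof -
  interpret G: group G by fact
  let ?P = "carrier G \<times> carrier G"
  have P: "finite ?P" using assms by auto
  interpret M: abelian_group "free_module R (carrier G)" by (rule free_module_abelian_group)
  have c: "f \<in> carrier (free_module R (carrier G)) \<Longrightarrow> f x \<in> carrier R" for f x by (auto simp: free_module_def)
  show ?thesis
  proof (rule ringI)
    show "abelian_group (group_algebra R G)"
      by (rule abelian_groupI)
        (use M.a_ac M.l_neg M.a_inv_closed in \<open>auto simp: group_algebra_def M.a_assoc[simplified]\<close>)
    show "monoid (group_algebra R G)"
    proof (rule monoidI)
      fix a b assume "a \<in> carrier (group_algebra R G)" "b \<in> carrier (group_algebra R G)"
      then show "a \<otimes>\<^bsub>group_algebra R G\<^esub> b \<in> carrier (group_algebra R G)"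
        unfolding group_algebra_def using bilinear_extension_free[OF assms(2), of ?P "monoid.mult G" a b] c by auto
    next
      show "\<one>\<^bsub>group_algebra R G\<^esub> \<in> carrier (group_algebra R G)"
        by (auto simp: group_algebra_def free_module_carrier_finite[OF assms(2)])
    next
      fix a b d assume "a \<in> carrier (group_algebra R G)" "b \<in> carrier (group_algebra R G)" "d \<in> carrier (group_algebra R G)"
      then show "a \<otimes>\<^bsub>group_algebra R G\<^esub> b \<otimes>\<^bsub>group_algebra R G\<^esub> d = a \<otimes>\<^bsub>group_algebra R G\<^esub> (b \<otimes>\<^bsub>group_algebra R G\<^esub> d)"
        unfolding group_algebra_def using c
        apply simp
        apply (rule bilinear_extension_assoc[OF P P P P])
        by (auto simp: G.m_assoc)
    next
      fix a assume "a \<in> carrier (group_algebra R G)"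
      then show "\<one>\<^bsub>group_algebra R G\<^esub> \<otimes>\<^bsub>group_algebra R G\<^esub> a = a"
        unfolding group_algebra_def apply simp
        using bilinear_extension_unit_l[OF P, where D = "carrier G" and e = "\<lambda>\<alpha>. \<one>\<^bsub>G\<^esub>" and E = "{\<one>\<^bsub>G\<^esub>}" and m = "monoid.mult G" and b = a]
        by auto
    next
      fix a assume "a \<in> carrier (group_algebra R G)"
      then show "a \<otimes>\<^bsub>group_algebra R G\<^esub> \<one>\<^bsub>group_algebra R G\<^esub> = a"
        unfolding group_algebra_def apply simp
        using bilinear_extension_unit_r[OF P, where D = "carrier G" and e = "\<lambda>\<alpha>. \<one>\<^bsub>G\<^esub>" and E = "{\<one>\<^bsub>G\<^esub>}" and m = "monoid.mult G" and b = a]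
        by auto
    qed
  next
    fix x y z assume "x \<in> carrier (group_algebra R G)" "y \<in> carrier (group_algebra R G)" "z \<in> carrier (group_algebra R G)"
    then have "\<And>m. x m \<in> carrier R" "\<And>m. y m \<in> carrier R" "\<And>m. z m \<in> carrier R"
      using c by (auto simp: group_algebra_def)
    note b = bilinear_extension_add_l[OF this] bilinear_extension_add_r[OF this(3,2,1)]
    show "(x \<oplus>\<^bsub>group_algebra R G\<^esub> y) \<otimes>\<^bsub>group_algebra R G\<^esub> z =
       x \<otimes>\<^bsub>group_algebra R G\<^esub> z \<oplus>\<^bsub>group_algebra R G\<^esub> y \<otimes>\<^bsub>group_algebra R G\<^esub> z"
      "z \<otimes>\<^bsub>group_algebra R G\<^esub> (x \<oplus>\<^bsub>group_algebra R G\<^esub> y) =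
       z \<otimes>\<^bsub>group_algebra R G\<^esub> x \<oplus>\<^bsub>group_algebra R G\<^esub> z \<otimes>\<^bsub>group_algebra R G\<^esub> y"
      by (simp_all add: group_algebra_def free_module_def b)
  qed
qed

lemma opposite_ring_ring: assumes "ring R" shows "ring (opposite_ring R)"
proof -
  interpret ring R by fact
  show ?thesis
  proof (rule ringI)
    show "abelian_group (opposite_ring R)"
      by (rule abelian_groupI)
        (use a_ac l_neg a_inv_closed in \<open>auto simp: opposite_ring_def a_assoc[simplified]\<close>)
    show "monoid (opposite_ring R)"
      by (rule monoidI) (auto simp: opposite_ring_def m_assoc)
  qed (auto simp: opposite_ring_def l_distr r_distr)
qed

lemma (in ring) Hom_left_module_left_module:
  assumes "finite_EI_category C" "x \<in> Ob C" "y \<in> Ob C"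
  shows "left_module (group_algebra R (Aut C y)) (Hom_left_module R C x y)"
proof -
  interpret finite_EI_category C by fact
  have fin: "finite (Hom C u v)" "finite (carrier (Aut C y))" for u v
    using finite_Mor by (auto simp: Hom_def Aut_def)
  let ?P = "carrier (Aut C y) \<times> Hom C x y"
  have P: "finite ?P" using fin by auto
  have sub: "carrier (Aut C y) \<subseteq> Hom C y y" by (auto simp: Aut_def)
  have c: "f \<in> carrier (free_module R B) \<Longrightarrow> f x \<in> carrier R" for f x and B :: "'n set" by (auto simp: free_module_def)
  interpret S: ring "group_algebra R (Aut C y)" using group_algebra_ring Aut_group fin assms by blast
  interpret G: group "Aut C y" using Aut_group assms by blast
  interpret F: abelian_group "free_module R (Hom C x y)" by (rule free_module_abelian_group)
  interpret M: abelian_group "Hom_left_module R C x y"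
    by (rule abelian_groupI)
        (use F.a_ac F.l_neg F.a_inv_closed in \<open>auto simp: Hom_left_module_def F.a_assoc[simplified]\<close>)
  have one: "\<one>\<^bsub>Aut C y\<^esub> = Ident C y" and mult: "monoid.mult (Aut C y) = Comp C" by (auto simp: Aut_def)
  show ?thesis
  proof
    fix a f assume af: "a \<in> carrier (group_algebra R (Aut C y))" "f \<in> carrier (Hom_left_module R C x y)"
    show "a \<odot>\<^bsub>Hom_left_module R C x y\<^esub> f \<in> carrier (Hom_left_module R C x y)"
      using af unfolding Hom_left_module_def group_algebra_def
      by (auto intro!: bilinear_extension_free[OF fin(1)[of x y]] intro: c Comp_Hom[OF _ subsetD[OF sub]])
  next
    fix a b f assume af: "a \<in> carrier (group_algebra R (Aut C y))" "b \<in> carrier (group_algebra R (Aut C y))" "f \<in> carrier (Hom_left_module R C x y)"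
    then have cc: "\<And>m. a m \<in> carrier R" "\<And>m. b m \<in> carrier R" "\<And>m. f m \<in> carrier R"
      using c by (auto simp: Hom_left_module_def group_algebra_def)
    show "(a \<oplus>\<^bsub>group_algebra R (Aut C y)\<^esub> b) \<odot>\<^bsub>Hom_left_module R C x y\<^esub> f =
      a \<odot>\<^bsub>Hom_left_module R C x y\<^esub> f \<oplus>\<^bsub>Hom_left_module R C x y\<^esub> b \<odot>\<^bsub>Hom_left_module R C x y\<^esub> f"
      using bilinear_extension_add_l[OF cc] by (simp add: Hom_left_module_def group_algebra_def free_module_def)
    show "(a \<otimes>\<^bsub>group_algebra R (Aut C y)\<^esub> b) \<odot>\<^bsub>Hom_left_module R C x y\<^esub> f =
      a \<odot>\<^bsub>Hom_left_module R C x y\<^esub> (b \<odot>\<^bsub>Hom_left_module R C x y\<^esub> f)"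
      unfolding Hom_left_module_def group_algebra_def mult apply simp
      apply (rule bilinear_extension_assoc[OF P _ P P])
      using cc fin sub Comp_Hom[of _ x y _ y] Comp_assoc[of _ x y _ y _ y] G.m_closed mult by (auto simp: subset_iff)
  next
    fix a f g assume af: "a \<in> carrier (group_algebra R (Aut C y))" "f \<in> carrier (Hom_left_module R C x y)" "g \<in> carrier (Hom_left_module R C x y)"
    then have cc: "\<And>m. a m \<in> carrier R" "\<And>m. f m \<in> carrier R" "\<And>m. g m \<in> carrier R"
      using c by (auto simp: Hom_left_module_def group_algebra_def)
    show "a \<odot>\<^bsub>Hom_left_module R C x y\<^esub> (f \<oplus>\<^bsub>Hom_left_module R C x y\<^esub> g) =
      a \<odot>\<^bsub>Hom_left_module R C x y\<^esub> f \<oplus>\<^bsub>Hom_left_module R C x y\<^esub> a \<odot>\<^bsub>Hom_left_module R C x y\<^esub> g"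
      using bilinear_extension_add_r[OF cc(1,3,2)] by (simp add: Hom_left_module_def group_algebra_def free_module_def)
  next
    fix f assume "f \<in> carrier (Hom_left_module R C x y)"
    then show "\<one>\<^bsub>group_algebra R (Aut C y)\<^esub> \<odot>\<^bsub>Hom_left_module R C x y\<^esub> f = f"
      using bilinear_extension_unit_l[OF P, where D = "Hom C x y" and e = "\<lambda>\<alpha>. Ident C y" and E = "{Ident C y}" and m = "Comp C" and b = f]
        Ident_left G.one_closed one
      by (auto simp: Hom_left_module_def group_algebra_def)
  qed
qed

lemma (in ring) Hom_right_module_left_module:
  assumes "finite_EI_category C" "x \<in> Ob C" "y \<in> Ob C"
  shows "left_module (opposite_ring (group_algebra R (Aut C x))) (Hom_right_module R C x y)"
proof -
  interpret finite_EI_category C by fact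
  have fin: "finite (Hom C u v)" "finite (carrier (Aut C x))" for u v
    using finite_Mor by (auto simp: Hom_def Aut_def)
  let ?P = "Hom C x y \<times> carrier (Aut C x)"
  have P: "finite ?P" using fin by auto
  have sub: "carrier (Aut C x) \<subseteq> Hom C x x" by (auto simp: Aut_def)
  have c: "f \<in> carrier (free_module R B) \<Longrightarrow> f x \<in> carrier R" for f x and B :: "'n set" by (auto simp: free_module_def)
  interpret S0: ring "group_algebra R (Aut C x)" using group_algebra_ring Aut_group fin assms by blast
  interpret S: ring "opposite_ring (group_algebra R (Aut C x))" by (rule opposite_ring_ring) (rule S0.ring_axioms)
  interpret G: group "Aut C x" using Aut_group assms by blast
  interpret F: abelian_group "free_module R (Hom C x y)" by (rule free_module_abelian_group)
  interpret M: abelian_group "Hom_right_module R C x y"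
    by (rule abelian_groupI)
        (use F.a_ac F.l_neg F.a_inv_closed in \<open>auto simp: Hom_right_module_def F.a_assoc[simplified]\<close>)
  have one: "\<one>\<^bsub>Aut C x\<^esub> = Ident C x" and mult: "monoid.mult (Aut C x) = Comp C" by (auto simp: Aut_def)
  show ?thesis
  proof
    fix a f assume af: "a \<in> carrier (opposite_ring (group_algebra R (Aut C x)))" "f \<in> carrier (Hom_right_module R C x y)"
    show "a \<odot>\<^bsub>Hom_right_module R C x y\<^esub> f \<in> carrier (Hom_right_module R C x y)"
      using af unfolding Hom_right_module_def group_algebra_def opposite_ring_def
      by (auto intro!: bilinear_extension_free[OF fin(1)[of x y]] intro: c Comp_Hom[OF subsetD[OF sub]])
  next
    fix a b f assume af: "a \<in> carrier (opposite_ring (group_algebra R (Aut C x)))" "b \<in> carrier (opposite_ring (group_algebra R (Aut C x)))" "f \<in> carrier (Hom_right_module R C x y)"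
    then have cc: "\<And>m. a m \<in> carrier R" "\<And>m. b m \<in> carrier R" "\<And>m. f m \<in> carrier R"
      using c by (auto simp: Hom_right_module_def group_algebra_def opposite_ring_def)
    show "(a \<oplus>\<^bsub>opposite_ring (group_algebra R (Aut C x))\<^esub> b) \<odot>\<^bsub>Hom_right_module R C x y\<^esub> f =
      a \<odot>\<^bsub>Hom_right_module R C x y\<^esub> f \<oplus>\<^bsub>Hom_right_module R C x y\<^esub> b \<odot>\<^bsub>Hom_right_module R C x y\<^esub> f"
      using bilinear_extension_add_r[OF cc(3,2,1)] by (simp add: Hom_right_module_def group_algebra_def free_module_def opposite_ring_def)
    have "bilinear_extension R ?P (Comp C) (bilinear_extension R ?P (Comp C) f b) a
      = bilinear_extension R ?P (Comp C) f (bilinear_extension R (carrier (Aut C x) \<times> carrier (Aut C x)) (Comp C) b a)"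
      apply (rule bilinear_extension_assoc[OF P P P])
      using cc fin sub Comp_Hom[of _ x x _ y] Comp_assoc[of _ x x _ x _ y] G.m_closed mult by (auto simp: subset_iff)
    then show "(a \<otimes>\<^bsub>opposite_ring (group_algebra R (Aut C x))\<^esub> b) \<odot>\<^bsub>Hom_right_module R C x y\<^esub> f =
      a \<odot>\<^bsub>Hom_right_module R C x y\<^esub> (b \<odot>\<^bsub>Hom_right_module R C x y\<^esub> f)"
      unfolding Hom_right_module_def group_algebra_def mult opposite_ring_def by simp
  next
    fix a f g assume af: "a \<in> carrier (opposite_ring (group_algebra R (Aut C x)))" "f \<in> carrier (Hom_right_module R C x y)" "g \<in> carrier (Hom_right_module R C x y)"
    then have cc: "\<And>m. a m \<in> carrier R" "\<And>m. f m \<in> carrier R" "\<And>m. g m \<in> carrier R"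
      using c by (auto simp: Hom_right_module_def group_algebra_def opposite_ring_def)
    show "a \<odot>\<^bsub>Hom_right_module R C x y\<^esub> (f \<oplus>\<^bsub>Hom_right_module R C x y\<^esub> g) =
      a \<odot>\<^bsub>Hom_right_module R C x y\<^esub> f \<oplus>\<^bsub>Hom_right_module R C x y\<^esub> a \<odot>\<^bsub>Hom_right_module R C x y\<^esub> g"
      using bilinear_extension_add_l[OF cc(2,3,1)] by (simp add: Hom_right_module_def group_algebra_def free_module_def)
  next
    fix f assume "f \<in> carrier (Hom_right_module R C x y)"
    then show "\<one>\<^bsub>opposite_ring (group_algebra R (Aut C x))\<^esub> \<odot>\<^bsub>Hom_right_module R C x y\<^esub> f = f"
      using bilinear_extension_unit_r[OF P, where D = "Hom C x y" and e = "\<lambda>\<alpha>. Ident C x" and E = "{Ident C x}" and m = "Comp C" and b = f]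
        Ident_right G.one_closed one
      by (auto simp: Hom_right_module_def group_algebra_def opposite_ring_def)
  qed
qed

lemma (in ring) finsum_free_module:
  assumes "\<And>s. s \<in> A \<Longrightarrow> g s \<in> carrier (free_module R B)" "finite A"
  shows "finsum (free_module R B) g A = (\<lambda>b. \<Oplus>s\<in>A. g s b)"
proof -
  interpret M: abelian_group "free_module R B" by (rule free_module_abelian_group)
  have c: "f \<in> carrier (free_module R B) \<Longrightarrow> f x \<in> carrier R" for f x by (auto simp: free_module_def)
  show ?thesis using assms(2,1)
  proof (induction A rule: finite_induct)
    case empty
    have "finsum (free_module R B) g {} = \<zero>\<^bsub>free_module R B\<^esub>" by simp
    then show ?case by (simp add: free_module_def[of R B])
  next
    case (insert s A)
    then have "finsum (free_module R B) g (insert s A) = g s \<oplus>\<^bsub>free_module R B\<^esub> (\<lambda>b. \<Oplus>s\<in>A. g s b)"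
      by (subst M.finsum_insert) auto
    also have "\<dots> = (\<lambda>b. g s b \<oplus> (\<Oplus>s\<in>A. g s b))" by (simp add: free_module_def)
    also have "\<dots> = (\<lambda>b. \<Oplus>s\<in>insert s A. g s b)"
      using insert c by (subst finsum_insert) auto
    finally show ?case .
  qed
qed

lemma (in ring) free_module_finite_dimensional:
  assumes "finite B" shows "finite_dimensional R (free_module R B)"
proof -
  let ?e = "\<lambda>b b'. if b' = b then \<one> else \<zero>"
  show ?thesis
  proof (cases "\<one> = \<zero>")
    case True
    then have "carrier R = {\<zero>}" using one_zeroD by simp
    then have "v = \<zero>\<^bsub>free_module R B\<^esub>" if "v \<in> carrier (free_module R B)" for v
      using that by (auto simp: free_module_def)
    then show ?thesis unfolding finite_dimensional_def by (intro exI[of _ "{}"]) (auto simp: finsum_def finprod_def intro: exI)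
  next
    case False
    have inj: "inj_on ?e A" for A using False by (auto simp: inj_on_def fun_eq_iff)
    have e: "?e ` B \<subseteq> carrier (free_module R B)" using assms by (auto simp: free_module_carrier_finite)
    have "\<exists>c\<in>?e ` B \<rightarrow> carrier R. v = finsum (free_module R B) (\<lambda>s. c s \<odot>\<^bsub>free_module R B\<^esub> s) (?e ` B)"
      if v: "v \<in> carrier (free_module R B)" for v
    proof (rule bexI)
      interpret L: left_module R "free_module R B" by (rule free_module_left_module)
      let ?c = "\<lambda>s. v (the_inv_into B ?e s)"
      have vc: "v b \<in> carrier R" for b using v by (auto simp: free_module_def)
      then show "?c \<in> ?e ` B \<rightarrow> carrier R" by auto
      have "finsum (free_module R B) (\<lambda>s. ?c s \<odot>\<^bsub>free_module R B\<^esub> s) (?e ` B) =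
        finsum (free_module R B) (\<lambda>b. ?c (?e b) \<odot>\<^bsub>free_module R B\<^esub> ?e b) B"
        by (rule L.M.finsum_reindex[OF _ inj]) (use e vc in \<open>auto intro!: L.smult_closed\<close>)
      also have "\<dots> = finsum (free_module R B) (\<lambda>b. v b \<odot>\<^bsub>free_module R B\<^esub> ?e b) B"
      proof (rule L.M.finsum_cong')
        fix b assume "b \<in> B"
        then have "?c (?e b) = v b" by (rule arg_cong[OF the_inv_into_f_f[OF inj]])
        then show "?c (?e b) \<odot>\<^bsub>free_module R B\<^esub> ?e b = v b \<odot>\<^bsub>free_module R B\<^esub> ?e b" by simp
      qed (use e vc in \<open>auto intro!: L.smult_closed\<close>)
      also have "\<dots> = (\<lambda>z. \<Oplus>b\<in>B. (v b \<odot>\<^bsub>free_module R B\<^esub> ?e b) z)"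
        by (rule finsum_free_module[OF _ assms]) (use e vc in \<open>auto intro!: L.smult_closed\<close>)
      also have "\<dots> = v"
      proof
        fix z
        have "(\<Oplus>b\<in>B. (v b \<odot>\<^bsub>free_module R B\<^esub> ?e b) z) = (\<Oplus>b\<in>B. if z = b then v b else \<zero>)"
          by (rule finsum_cong') (use vc in \<open>auto simp: free_module_def\<close>)
        also have "\<dots> = v z"
        proof (cases "z \<in> B")
          case True
          then show ?thesis using add.finprod_singleton[OF True assms, of v] vc by auto
        next
          case False
          then have "(\<Oplus>b\<in>B. if z = b then v b else \<zero>) = (\<Oplus>b\<in>B. \<zero>)"
            by (intro finsum_cong') auto
          then show ?thesis using v False assms by (simp add: free_module_carrier_finite)
        qed
        finally show "(\<Oplus>b\<in>B. (v b \<odot>\<^bsub>free_module R B\<^esub> ?e b) z) = v z" .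
      qed
      finally show "v = finsum (free_module R B) (\<lambda>s. ?c s \<odot>\<^bsub>free_module R B\<^esub> s) (?e ` B)" ..
    qed
    then show ?thesis unfolding finite_dimensional_def using e assms by (intro exI[of _ "?e ` B"]) auto
  qed
qed

lemma (in finite_EI_category) K_basis_Comp:
  assumes "skeletal C" "\<alpha> \<in> Hom C x y" "\<gamma> \<in> K_basis C x"
  shows "Comp C \<alpha> \<gamma> \<in> K_basis C y"
proof -
  obtain w where w: "w \<in> Ob C" "w \<noteq> x" "\<gamma> \<in> Hom C w x" using assms by (auto simp: K_basis_def)
  have xy: "x \<in> Ob C" "y \<in> Ob C" using assms(2) Dom_closed Cod_closed by (auto simp: Hom_def)
  have ag: "Comp C \<alpha> \<gamma> \<in> Hom C w y" using Comp_Hom w assms by blast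
  have "w \<noteq> y"
  proof
    assume wy: "w = y"
    have ga: "Comp C \<gamma> \<alpha> \<in> Hom C x x" using Comp_Hom w assms wy by blast
    obtain b where b: "b \<in> Hom C y y" "Comp C b (Comp C \<alpha> \<gamma>) = Ident C y" "Comp C (Comp C \<alpha> \<gamma>) b = Ident C y"
      using EI[OF xy(2), of "Comp C \<alpha> \<gamma>"] ag wy by (auto simp: iso_mor_def Hom_def)
    obtain d where d: "d \<in> Hom C x x" "Comp C d (Comp C \<gamma> \<alpha>) = Ident C x"
      using EI[OF xy(1) ga] ga by (auto simp: iso_mor_def Hom_def)
    have g: "\<gamma> \<in> Hom C y x" using w wy by simp
    let ?r = "Comp C \<gamma> b" and ?l = "Comp C d \<gamma>"
    have r: "?r \<in> Hom C y x" "Comp C \<alpha> ?r = Ident C y"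
      using Comp_Hom[OF b(1) g] Comp_assoc[OF b(1) g assms(2)] b by auto
    have l: "?l \<in> Hom C y x" "Comp C ?l \<alpha> = Ident C x"
      using Comp_Hom[OF g d(1)] Comp_assoc[OF assms(2) g d(1)] d by auto
    have "?l = Comp C ?l (Comp C \<alpha> ?r)" using r l Ident_right by simp
    also have "\<dots> = ?r" using Comp_assoc[OF r(1) assms(2) l(1)] l r Ident_left by simp
    finally have "iso_mor C \<alpha>" unfolding iso_mor_def using l r assms(2)
      by (intro conjI bexI[of _ ?l]) (auto simp: Hom_def)
    then have "x = y" using assms xy by (auto simp: skeletal_def isomorphic_objects_def)
    then show False using w wy by simp
  qed
  then show ?thesis using w ag by (auto simp: K_basis_def)
qed

lemma (in cring) K_functor_functor:
  assumes "finite_EI_category C" "skeletal C"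
  shows "functor_to_kmod R C (K_functor R C)"
proof -
  interpret finite_EI_category C by fact
  have fin: "finite (K_basis C x)" for x
    by (rule finite_subset[OF _ finite_Mor]) (auto simp: K_basis_def Hom_def)
  have c: "f \<in> carrier (free_module R B) \<Longrightarrow> f x \<in> carrier R" for f x and B :: "'n set" by (auto simp: free_module_def)
  have KH: "\<gamma> \<in> K_basis C x \<Longrightarrow> \<gamma> \<in> Hom C (Dom C \<gamma>) x" for \<gamma> x by (auto simp: K_basis_def Hom_def)
  show ?thesis
  proof (intro functor_to_kmod.intro functor_to_kmod_axioms.intro category_axioms)
    fix x
    interpret L: left_module R "free_module R (K_basis C x)" by (rule free_module_left_module)
    show "module R (obj_map (K_functor R C) x)" unfolding K_functor_def
      using L.smult_closed L.smult_l_distr L.smult_r_distr L.smult_assoc L.smult_one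
      by (simp, intro moduleI) (auto intro: cring_axioms L.M.abelian_group_axioms)
    show "finite_dimensional R (obj_map (K_functor R C) x)"
      using free_module_finite_dimensional[OF fin] by (simp add: K_functor_def)
    fix v assume x: "x \<in> Ob C" and v: "v \<in> carrier (obj_map (K_functor R C) x)"
    then have v: "v \<in> carrier (free_module R (K_basis C x))" by (simp add: K_functor_def)
    have "finsum R v {\<gamma> \<in> K_basis C x. Comp C (Ident C x) \<gamma> = \<delta>} = v \<delta>" for \<delta>
    proof -
      have *: "{\<gamma> \<in> K_basis C x. Comp C (Ident C x) \<gamma> = \<delta>} = (if \<delta> \<in> K_basis C x then {\<delta>} else {})"
        using Ident_left[OF KH] by auto
      show ?thesis unfolding * using v c[OF v] fin by (auto simp: free_module_carrier_finite)
    qed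
    then show "mor_map (K_functor R C) (Ident C x) v = v"
      using Ident_Hom[OF x] by (auto simp: K_functor_def Hom_def)
  next
    fix \<alpha> x y assume a: "\<alpha> \<in> Hom C x y"
    then have D: "Dom C \<alpha> = x" by (simp add: Hom_def)
    let ?A = "\<lambda>\<delta>. {\<gamma> \<in> K_basis C x. Comp C \<alpha> \<gamma> = \<delta>}"
    have cl: "finsum R f (?A \<delta>) \<in> carrier R" if "f \<in> carrier (free_module R (K_basis C x))" for f \<delta>
      using c[OF that] by (intro finsum_closed) auto
    have z: "?A \<delta> = {}" if "\<delta> \<notin> K_basis C y" for \<delta> using K_basis_Comp[OF assms(2) a] that by auto
    show "mor_map (K_functor R C) \<alpha> \<in> module_homs R (obj_map (K_functor R C) x) (obj_map (K_functor R C) y)"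
      unfolding module_homs_def
    proof (intro CollectI conjI ballI)
      show "mor_map (K_functor R C) \<alpha> \<in> carrier (obj_map (K_functor R C) x) \<rightarrow> carrier (obj_map (K_functor R C) y)"
        using cl z by (auto simp: K_functor_def D free_module_carrier_finite[OF fin[of y]] simp del: Collect_empty_eq)
    next
      fix f g assume "f \<in> carrier (obj_map (K_functor R C) x)" "g \<in> carrier (obj_map (K_functor R C) x)"
      then have "f \<in> carrier (free_module R (K_basis C x))" "g \<in> carrier (free_module R (K_basis C x))"
        by (auto simp: K_functor_def)
      note cc = c[OF this(1)] c[OF this(2)]
      show "mor_map (K_functor R C) \<alpha> (f \<oplus>\<^bsub>obj_map (K_functor R C) x\<^esub> g) =
        mor_map (K_functor R C) \<alpha> f \<oplus>\<^bsub>obj_map (K_functor R C) y\<^esub> mor_map (K_functor R C) \<alpha> g"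
        using cc by (auto simp: K_functor_def D free_module_def intro!: ext finsum_addf)
    next
      fix a f assume a: "a \<in> carrier R" and "f \<in> carrier (obj_map (K_functor R C) x)"
      then have "f \<in> carrier (free_module R (K_basis C x))" by (auto simp: K_functor_def)
      note cc = c[OF this]
      show "mor_map (K_functor R C) \<alpha> (a \<odot>\<^bsub>obj_map (K_functor R C) x\<^esub> f) =
        a \<odot>\<^bsub>obj_map (K_functor R C) y\<^esub> mor_map (K_functor R C) \<alpha> f"
        using cc a fin by (auto simp: K_functor_def D free_module_def intro!: ext finsum_rdistr[symmetric])
    qed
  next
    fix \<beta> \<gamma> x y z v assume bg: "\<beta> \<in> Hom C x y" "\<gamma> \<in> Hom C y z" and v: "v \<in> carrier (obj_map (K_functor R C) x)"
    then have v: "v u \<in> carrier R" for u using c by (auto simp: K_functor_def)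
    have D: "Dom C \<beta> = x" "Dom C \<gamma> = y" "Dom C (Comp C \<gamma> \<beta>) = x"
      using bg Comp_Hom[OF bg] by (auto simp: Hom_def)
    have "finsum R v {\<alpha> \<in> K_basis C x. Comp C (Comp C \<gamma> \<beta>) \<alpha> = \<delta>} =
      (\<Oplus>e\<in>{e \<in> K_basis C y. Comp C \<gamma> e = \<delta>}. finsum R v {\<alpha> \<in> K_basis C x. Comp C \<beta> \<alpha> = e})" for \<delta>
    proof -
      let ?S = "Sigma {e \<in> K_basis C y. Comp C \<gamma> e = \<delta>} (\<lambda>e. {\<alpha> \<in> K_basis C x. Comp C \<beta> \<alpha> = e})"
      have "(\<Oplus>e\<in>{e \<in> K_basis C y. Comp C \<gamma> e = \<delta>}. \<Oplus>\<alpha>\<in>{\<alpha> \<in> K_basis C x. Comp C \<beta> \<alpha> = e}. v (snd (e, \<alpha>))) = (\<Oplus>p\<in>?S. v (snd p))"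
        by (rule finsum_fibres) (use fin v in auto)
      also have "\<dots> = finsum R v (snd ` ?S)"
        by (rule finsum_reindex[symmetric]) (use v in \<open>auto simp: inj_on_def\<close>)
      also have "snd ` ?S = {\<alpha> \<in> K_basis C x. Comp C (Comp C \<gamma> \<beta>) \<alpha> = \<delta>}"
        using K_basis_Comp[OF assms(2) bg(1)] Comp_assoc[OF KH bg] by (force simp: image_iff)
      finally show ?thesis by simp
    qed
    then show "mor_map (K_functor R C) (Comp C \<gamma> \<beta>) v = mor_map (K_functor R C) \<gamma> (mor_map (K_functor R C) \<beta> v)"
      by (simp add: K_functor_def D)
  qed
qed

lemma (in module) finsum_smult_left:
  assumes "finite A" "x \<in> carrier M" "f \<in> A \<rightarrow> carrier R"
  shows "(\<Oplus>i\<in>A. f i) \<odot>\<^bsub>M\<^esub> x = (\<Oplus>\<^bsub>M\<^esub>i\<in>A. f i \<odot>\<^bsub>M\<^esub> x)"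
  using assms(1,3)
proof (induction A rule: finite_induct)
  case (insert i A)
  then have "(\<Oplus>i\<in>insert i A. f i) \<odot>\<^bsub>M\<^esub> x = (f i \<oplus> (\<Oplus>i\<in>A. f i)) \<odot>\<^bsub>M\<^esub> x"
    by (subst R.finsum_insert) auto
  also have "\<dots> = f i \<odot>\<^bsub>M\<^esub> x \<oplus>\<^bsub>M\<^esub> (\<Oplus>i\<in>A. f i) \<odot>\<^bsub>M\<^esub> x"
    using insert assms(2) by (intro smult_l_distr finsum_closed) auto
  also have "\<dots> = (\<Oplus>\<^bsub>M\<^esub>i\<in>insert i A. f i \<odot>\<^bsub>M\<^esub> x)"
    using insert assms(2) by (subst M.finsum_insert) auto
  finally show ?case .
qed (use assms in auto)

lemma module_hom_finsum:
  assumes "module R V" "module R W" "f \<in> module_homs R V W" "finite A" "g \<in> A \<rightarrow> carrier V"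
  shows "f (finsum V g A) = finsum W (\<lambda>x. f (g x)) A"
proof -
  interpret V: module R V by fact
  interpret W: module R W by fact
  have cl: "x \<in> carrier V \<Longrightarrow> f x \<in> carrier W" for x using assms(3) by (auto simp: module_homs_def)
  have add: "x \<in> carrier V \<Longrightarrow> y \<in> carrier V \<Longrightarrow> f (x \<oplus>\<^bsub>V\<^esub> y) = f x \<oplus>\<^bsub>W\<^esub> f y" for x y
    using assms(3) unfolding module_homs_def by blast
  have "f \<zero>\<^bsub>V\<^esub> \<oplus>\<^bsub>W\<^esub> f \<zero>\<^bsub>V\<^esub> = f (\<zero>\<^bsub>V\<^esub> \<oplus>\<^bsub>V\<^esub> \<zero>\<^bsub>V\<^esub>)"
    by (rule add[symmetric]) simp_all
  then have "f \<zero>\<^bsub>V\<^esub> \<oplus>\<^bsub>W\<^esub> f \<zero>\<^bsub>V\<^esub> = f \<zero>\<^bsub>V\<^esub>" by simp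
  then have z: "f \<zero>\<^bsub>V\<^esub> = \<zero>\<^bsub>W\<^esub>" using cl[OF V.M.zero_closed] W.M.add.r_cancel_one by blast
  show ?thesis using assms(4,5)
  proof (induction A rule: finite_induct)
    case (insert x A)
    then have gc: "finsum V g A \<in> carrier V" by (intro V.M.finsum_closed) auto
    have "f (finsum V g (insert x A)) = f (g x \<oplus>\<^bsub>V\<^esub> finsum V g A)"
      using insert by (subst V.M.finsum_insert) auto
    also have "\<dots> = f (g x) \<oplus>\<^bsub>W\<^esub> f (finsum V g A)"
      using assms(3) gc insert.prems by (auto simp: module_homs_def)
    also have "\<dots> = finsum W (\<lambda>x. f (g x)) (insert x A)"
      using insert cl by (subst W.M.finsum_insert) auto
    finally show ?case .
  qed (simp add: z)
qed

lemma (in functor_to_kmod) functor_module_left_module: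
  assumes "cring k" "finite (Mor C)"
  shows "left_module (category_algebra k C) (functor_module C F)"
proof -
  interpret k: cring k by fact
  interpret S: ring "category_algebra k C"
    by (rule k.category_algebra_ring) (use assms category_axioms in auto)
  let ?M = "functor_module C F"
  let ?F = "obj_map F"
  have V: "x \<in> Ob C \<Longrightarrow> module k (?F x)" for x by (rule obj_module)
  have Vg: "x \<in> Ob C \<Longrightarrow> abelian_group (?F x)" for x using V by (rule module.axioms(2))
  interpret M: abelian_group ?M
  proof (rule abelian_groupI)
    fix v w u assume "v \<in> carrier ?M" "w \<in> carrier ?M" "u \<in> carrier ?M"
    then show "v \<oplus>\<^bsub>?M\<^esub> w \<oplus>\<^bsub>?M\<^esub> u = v \<oplus>\<^bsub>?M\<^esub> (w \<oplus>\<^bsub>?M\<^esub> u)"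
      using Vg by (auto simp: functor_module_def PiE_iff fun_eq_iff abelian_monoid.a_assoc abelian_group.axioms)
  next
    fix v w assume "v \<in> carrier ?M" "w \<in> carrier ?M"
    then show "v \<oplus>\<^bsub>?M\<^esub> w = w \<oplus>\<^bsub>?M\<^esub> v" "v \<oplus>\<^bsub>?M\<^esub> w \<in> carrier ?M"
      using Vg by (auto simp: functor_module_def PiE_iff fun_eq_iff abelian_monoid.a_comm abelian_monoid.a_closed abelian_group.axioms)
  next
    fix v assume v: "v \<in> carrier ?M"
    show "\<zero>\<^bsub>?M\<^esub> \<oplus>\<^bsub>?M\<^esub> v = v"
      using Vg v by (auto simp: functor_module_def PiE_iff extensional_def fun_eq_iff abelian_monoid.l_zero abelian_group.axioms)
    show "\<exists>w\<in>carrier ?M. w \<oplus>\<^bsub>?M\<^esub> v = \<zero>\<^bsub>?M\<^esub>"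
      by (rule bexI[of _ "\<lambda>x\<in>Ob C. \<ominus>\<^bsub>?F x\<^esub> v x"])
        (use Vg v in \<open>auto simp: functor_module_def PiE_iff fun_eq_iff abelian_group.l_neg abelian_group.a_inv_closed\<close>)
  qed (use Vg in \<open>auto simp: functor_module_def abelian_monoid.zero_closed abelian_group.axioms\<close>)
  have c: "a \<in> carrier (category_algebra k C) \<Longrightarrow> a \<alpha> \<in> carrier k" for a \<alpha>
    by (auto simp: category_algebra_def free_module_def)
  let ?A = "\<lambda>y. {\<alpha> \<in> Mor C. Cod C \<alpha> = y}"
  have fA: "finite (?A y)" for y using assms by auto
  have m: "mor_map F \<alpha> \<in> module_homs k (?F (Dom C \<alpha>)) (?F (Cod C \<alpha>))" if "\<alpha> \<in> Mor C" for \<alpha>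
    using mor_linear that by (auto simp: Hom_def)
  have mc: "mor_map F \<alpha> (v (Dom C \<alpha>)) \<in> carrier (?F (Cod C \<alpha>))" if "\<alpha> \<in> Mor C" "v \<in> carrier ?M" for \<alpha> v
    using m[OF that(1)] that Dom_closed by (auto simp: functor_module_def module_homs_def)
  have cl: "a \<alpha> \<odot>\<^bsub>?F y\<^esub> mor_map F \<alpha> (v (Dom C \<alpha>)) \<in> carrier (?F y)"
    if "\<alpha> \<in> ?A y" "v \<in> carrier ?M" "a \<in> carrier (category_algebra k C)" for a \<alpha> v y
    using that mc[of \<alpha> v] c[of a \<alpha>] V[of y] Cod_closed by (auto intro: module.smult_closed)
  have sm: "(a \<odot>\<^bsub>?M\<^esub> v) y = finsum (?F y) (\<lambda>\<alpha>. a \<alpha> \<odot>\<^bsub>?F y\<^esub> mor_map F \<alpha> (v (Dom C \<alpha>))) (?A y)" if "y \<in> Ob C" for a v y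
    using that by (simp add: functor_module_def)
  have smc: "a \<odot>\<^bsub>?M\<^esub> v \<in> carrier ?M" if "v \<in> carrier ?M" "a \<in> carrier (category_algebra k C)" for a v
  proof -
    have "(a \<odot>\<^bsub>?M\<^esub> v) y \<in> carrier (?F y)" if y: "y \<in> Ob C" for y
      unfolding sm[OF y] using cl[OF _ \<open>v \<in> carrier ?M\<close> \<open>a \<in> _\<close>] Vg[OF y]
      by (intro abelian_monoid.finsum_closed) (auto intro: abelian_group.axioms)
    then show ?thesis by (auto simp: functor_module_def)
  qed
  have ext: "v = w" if "v \<in> carrier ?M" "w \<in> carrier ?M" "\<And>y. y \<in> Ob C \<Longrightarrow> v y = w y" for v w
    using that by (auto simp: functor_module_def intro: PiE_ext)
  have ad: "(v \<oplus>\<^bsub>?M\<^esub> w) y = v y \<oplus>\<^bsub>?F y\<^esub> w y" if "y \<in> Ob C" for v w y using that by (simp add: functor_module_def)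
  have vcl: "v y \<in> carrier (?F y)" if "v \<in> carrier ?M" "y \<in> Ob C" for v y using that by (auto simp: functor_module_def)
  show ?thesis
  proof
    fix a v assume "a \<in> carrier (category_algebra k C)" "v \<in> carrier ?M"
    then show "a \<odot>\<^bsub>?M\<^esub> v \<in> carrier ?M" by (rule smc[rotated])
  next
    fix a b v assume abv: "a \<in> carrier (category_algebra k C)" "b \<in> carrier (category_algebra k C)" "v \<in> carrier ?M"
    show "(a \<oplus>\<^bsub>category_algebra k C\<^esub> b) \<odot>\<^bsub>?M\<^esub> v = a \<odot>\<^bsub>?M\<^esub> v \<oplus>\<^bsub>?M\<^esub> b \<odot>\<^bsub>?M\<^esub> v"
    proof (rule ext)
      fix y assume y: "y \<in> Ob C"
      interpret Y: module k "?F y" by (rule V[OF y])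
      have "((a \<oplus>\<^bsub>category_algebra k C\<^esub> b) \<odot>\<^bsub>?M\<^esub> v) y =
        finsum (?F y) (\<lambda>\<alpha>. a \<alpha> \<odot>\<^bsub>?F y\<^esub> mor_map F \<alpha> (v (Dom C \<alpha>)) \<oplus>\<^bsub>?F y\<^esub> b \<alpha> \<odot>\<^bsub>?F y\<^esub> mor_map F \<alpha> (v (Dom C \<alpha>))) (?A y)"
        unfolding sm[OF y]
      proof (rule Y.M.finsum_cong'[OF refl])
        fix \<alpha> assume "\<alpha> \<in> ?A y"
        then have "mor_map F \<alpha> (v (Dom C \<alpha>)) \<in> carrier (?F y)" using mc abv by auto
        then show "(a \<oplus>\<^bsub>category_algebra k C\<^esub> b) \<alpha> \<odot>\<^bsub>?F y\<^esub> mor_map F \<alpha> (v (Dom C \<alpha>)) =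
          a \<alpha> \<odot>\<^bsub>?F y\<^esub> mor_map F \<alpha> (v (Dom C \<alpha>)) \<oplus>\<^bsub>?F y\<^esub> b \<alpha> \<odot>\<^bsub>?F y\<^esub> mor_map F \<alpha> (v (Dom C \<alpha>))"
          using c abv Y.smult_l_distr by (simp add: category_algebra_def free_module_def)
      qed (rule Pi_I, intro Y.M.a_closed cl, use abv in simp_all)
      also have "\<dots> = (a \<odot>\<^bsub>?M\<^esub> v) y \<oplus>\<^bsub>?F y\<^esub> (b \<odot>\<^bsub>?M\<^esub> v) y"
        unfolding sm[OF y] by (rule Y.M.finsum_addf; rule Pi_I; intro cl) (use abv in simp_all)
      finally show "((a \<oplus>\<^bsub>category_algebra k C\<^esub> b) \<odot>\<^bsub>?M\<^esub> v) y = (a \<odot>\<^bsub>?M\<^esub> v \<oplus>\<^bsub>?M\<^esub> b \<odot>\<^bsub>?M\<^esub> v) y"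
        unfolding ad[OF y] .
    qed (use abv smc in auto)
    show "(a \<otimes>\<^bsub>category_algebra k C\<^esub> b) \<odot>\<^bsub>?M\<^esub> v = a \<odot>\<^bsub>?M\<^esub> (b \<odot>\<^bsub>?M\<^esub> v)"
    proof (rule ext)
      fix y assume y: "y \<in> Ob C"
      interpret Y: module k "?F y" by (rule V[OF y])
      let ?P = "{(\<alpha>, \<beta>). \<alpha> \<in> Mor C \<and> \<beta> \<in> Mor C \<and> Cod C \<beta> = Dom C \<alpha>}"
      have fP: "finite ?P" by (rule finite_subset[of _ "Mor C \<times> Mor C"]) (use assms in auto)
      let ?B = "\<lambda>\<delta>. {(\<alpha>, \<beta>). (\<alpha>, \<beta>) \<in> ?P \<and> Comp C \<alpha> \<beta> = \<delta>}"
      have fB: "finite (?B \<delta>)" for \<delta> by (rule finite_subset[OF _ fP]) auto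
      let ?g = "\<lambda>(\<alpha>, \<beta>). (a \<alpha> \<otimes>\<^bsub>k\<^esub> b \<beta>) \<odot>\<^bsub>?F y\<^esub> mor_map F (Comp C \<alpha> \<beta>) (v (Dom C \<beta>))"
      have cmp: "Comp C \<alpha> \<beta> \<in> Mor C" "Dom C (Comp C \<alpha> \<beta>) = Dom C \<beta>" "Cod C (Comp C \<alpha> \<beta>) = Cod C \<alpha>"
        if "(\<alpha>, \<beta>) \<in> ?P" for \<alpha> \<beta>
        using Comp_Hom[of \<beta> "Dom C \<beta>" "Cod C \<beta>" \<alpha> "Cod C \<alpha>"] that by (auto simp: Hom_def)
      have gcl: "?g p \<in> carrier (?F y)" if "p \<in> ?P" "Cod C (fst p) = y" for p
      proof -
        obtain \<alpha> \<beta> where p: "p = (\<alpha>, \<beta>)" by force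
        have P: "(\<alpha>, \<beta>) \<in> ?P" using that p by simp
        have "mor_map F (Comp C \<alpha> \<beta>) (v (Dom C \<beta>)) \<in> carrier (?F y)"
          using mc[OF cmp(1)[OF P] abv(3)] cmp[OF P] that p by simp
        then show ?thesis using p c abv by auto
      qed
      have "((a \<otimes>\<^bsub>category_algebra k C\<^esub> b) \<odot>\<^bsub>?M\<^esub> v) y = finsum (?F y) (\<lambda>\<delta>. finsum (?F y) (\<lambda>p. ?g (snd (\<delta>, p))) (?B \<delta>)) (?A y)"
        unfolding sm[OF y]
      proof (rule Y.M.finsum_cong')
        fix \<delta> assume d: "\<delta> \<in> ?A y"
        have X: "mor_map F \<delta> (v (Dom C \<delta>)) \<in> carrier (?F y)" using mc d abv by auto
        have "(a \<otimes>\<^bsub>category_algebra k C\<^esub> b) \<delta> = (\<Oplus>\<^bsub>k\<^esub>p\<in>?B \<delta>. a (fst p) \<otimes>\<^bsub>k\<^esub> b (snd p))"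
          by (simp add: category_algebra_def bilinear_extension_def case_prod_unfold)
        then have "(a \<otimes>\<^bsub>category_algebra k C\<^esub> b) \<delta> \<odot>\<^bsub>?F y\<^esub> mor_map F \<delta> (v (Dom C \<delta>)) =
          finsum (?F y) (\<lambda>p. (a (fst p) \<otimes>\<^bsub>k\<^esub> b (snd p)) \<odot>\<^bsub>?F y\<^esub> mor_map F \<delta> (v (Dom C \<delta>))) (?B \<delta>)"
          using Y.finsum_smult_left[OF fB X, of "\<lambda>p. a (fst p) \<otimes>\<^bsub>k\<^esub> b (snd p)" \<delta>] c abv by auto
        also have "\<dots> = finsum (?F y) (\<lambda>p. ?g (snd (\<delta>, p))) (?B \<delta>)"
        proof (rule Y.M.finsum_cong')
          fix p assume p: "p \<in> ?B \<delta>"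
          then have "fst p \<in> Mor C" "Comp C (fst p) (snd p) = \<delta>" "Dom C \<delta> = Dom C (snd p)" using cmp by auto
          then show "(a (fst p) \<otimes>\<^bsub>k\<^esub> b (snd p)) \<odot>\<^bsub>?F y\<^esub> mor_map F \<delta> (v (Dom C \<delta>)) = ?g (snd (\<delta>, p))"
            by (simp add: case_prod_unfold)
        next
          show "(\<lambda>p. ?g (snd (\<delta>, p))) \<in> ?B \<delta> \<rightarrow> carrier (?F y)"
          proof
            fix p assume p: "p \<in> ?B \<delta>"
            then have "Cod C (fst p) = y" using d cmp by auto
            with p show "?g (snd (\<delta>, p)) \<in> carrier (?F y)" using gcl[of p] by auto
          qed
        qed simp
        finally show "(a \<otimes>\<^bsub>category_algebra k C\<^esub> b) \<delta> \<odot>\<^bsub>?F y\<^esub> mor_map F \<delta> (v (Dom C \<delta>)) = finsum (?F y) (\<lambda>p. ?g (snd (\<delta>, p))) (?B \<delta>)" .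
      next
        show "(\<lambda>\<delta>. finsum (?F y) (\<lambda>p. ?g (snd (\<delta>, p))) (?B \<delta>)) \<in> ?A y \<rightarrow> carrier (?F y)"
        proof
          fix \<delta> assume d: "\<delta> \<in> ?A y"
          have "?g p \<in> carrier (?F y)" if "p \<in> ?B \<delta>" for p using gcl[of p] that d cmp by auto
          then show "finsum (?F y) (\<lambda>p. ?g (snd (\<delta>, p))) (?B \<delta>) \<in> carrier (?F y)"
            by (intro Y.M.finsum_closed) auto
        qed
      qed simp
      also have "\<dots> = finsum (?F y) (\<lambda>t. ?g (snd t)) (Sigma (?A y) ?B)"
      proof (rule Y.M.finsum_fibres[OF fA fB])
        fix \<delta> p assume "\<delta> \<in> ?A y" "p \<in> ?B \<delta>"
        then show "?g (snd (\<delta>, p)) \<in> carrier (?F y)" using gcl[of p] cmp by auto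
      qed
      also have "\<dots> = finsum (?F y) ?g (snd ` Sigma (?A y) ?B)"
      proof (rule Y.M.finsum_reindex[symmetric])
        show "inj_on snd (Sigma (?A y) ?B)" by (auto simp: inj_on_def)
        show "?g \<in> snd ` Sigma (?A y) ?B \<rightarrow> carrier (?F y)"
        proof
          fix p assume "p \<in> snd ` Sigma (?A y) ?B"
          then have "p \<in> ?P" "Cod C (fst p) = y" using cmp by auto
          then show "?g p \<in> carrier (?F y)" by (rule gcl)
        qed
      qed
      also have "snd ` Sigma (?A y) ?B = Sigma (?A y) (\<lambda>\<alpha>. ?A (Dom C \<alpha>))"
        using cmp by (force simp: image_iff)
      also have "finsum (?F y) ?g (Sigma (?A y) (\<lambda>\<alpha>. ?A (Dom C \<alpha>))) =
        finsum (?F y) (\<lambda>\<alpha>. finsum (?F y) (\<lambda>\<beta>. ?g (\<alpha>, \<beta>)) (?A (Dom C \<alpha>))) (?A y)"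
      proof (rule Y.M.finsum_fibres[OF fA fA, symmetric])
        fix \<alpha> \<beta> assume "\<alpha> \<in> ?A y" "\<beta> \<in> ?A (Dom C \<alpha>)"
        then show "?g (\<alpha>, \<beta>) \<in> carrier (?F y)" by (intro gcl) auto
      qed
      also have "\<dots> = (a \<odot>\<^bsub>?M\<^esub> (b \<odot>\<^bsub>?M\<^esub> v)) y"
        unfolding sm[OF y]
      proof (rule Y.M.finsum_cong'[OF refl])
        show "(\<lambda>\<alpha>. a \<alpha> \<odot>\<^bsub>?F y\<^esub> mor_map F \<alpha> ((b \<odot>\<^bsub>?M\<^esub> v) (Dom C \<alpha>))) \<in> ?A y \<rightarrow> carrier (?F y)"
          by (rule Pi_I, rule cl[OF _ smc[OF abv(3,2)] abv(1)]) simp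
        fix \<alpha> assume al: "\<alpha> \<in> ?A y"
        then have x: "Dom C \<alpha> \<in> Ob C" "\<alpha> \<in> Hom C (Dom C \<alpha>) y" using Dom_closed by (auto simp: Hom_def)
        interpret X: module k "?F (Dom C \<alpha>)" by (rule V[OF x(1)])
        have lin: "mor_map F \<alpha> \<in> module_homs k (?F (Dom C \<alpha>)) (?F y)" using m al by auto
        have "mor_map F \<alpha> ((b \<odot>\<^bsub>?M\<^esub> v) (Dom C \<alpha>)) =
          finsum (?F y) (\<lambda>\<beta>. mor_map F \<alpha> (b \<beta> \<odot>\<^bsub>?F (Dom C \<alpha>)\<^esub> mor_map F \<beta> (v (Dom C \<beta>)))) (?A (Dom C \<alpha>))"
          unfolding sm[OF x(1)]
          by (rule module_hom_finsum[OF V[OF x(1)] V[OF y] lin fA], rule Pi_I, rule cl) (use abv in simp_all)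
        also have "\<dots> = finsum (?F y) (\<lambda>\<beta>. b \<beta> \<odot>\<^bsub>?F y\<^esub> mor_map F (Comp C \<alpha> \<beta>) (v (Dom C \<beta>))) (?A (Dom C \<alpha>))"
        proof (rule Y.M.finsum_cong'[OF refl])
          fix \<beta> assume be: "\<beta> \<in> ?A (Dom C \<alpha>)"
          then have bh: "\<beta> \<in> Hom C (Dom C \<beta>) (Dom C \<alpha>)" by (auto simp: Hom_def)
          have "mor_map F \<alpha> (b \<beta> \<odot>\<^bsub>?F (Dom C \<alpha>)\<^esub> mor_map F \<beta> (v (Dom C \<beta>))) = b \<beta> \<odot>\<^bsub>?F y\<^esub> mor_map F \<alpha> (mor_map F \<beta> (v (Dom C \<beta>)))"
            using lin c[OF abv(2)] mc[of \<beta> v] abv be by (auto simp: module_homs_def)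
          also have "\<dots> = b \<beta> \<odot>\<^bsub>?F y\<^esub> mor_map F (Comp C \<alpha> \<beta>) (v (Dom C \<beta>))"
            using mor_Comp[OF bh x(2) vcl[OF abv(3)]] be Dom_closed by auto
          finally show "mor_map F \<alpha> (b \<beta> \<odot>\<^bsub>?F (Dom C \<alpha>)\<^esub> mor_map F \<beta> (v (Dom C \<beta>))) = b \<beta> \<odot>\<^bsub>?F y\<^esub> mor_map F (Comp C \<alpha> \<beta>) (v (Dom C \<beta>))" .
        next
          show "(\<lambda>\<beta>. b \<beta> \<odot>\<^bsub>?F y\<^esub> mor_map F (Comp C \<alpha> \<beta>) (v (Dom C \<beta>))) \<in> ?A (Dom C \<alpha>) \<rightarrow> carrier (?F y)"
          proof
            fix \<beta> assume be: "\<beta> \<in> ?A (Dom C \<alpha>)"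
            then have P: "(\<alpha>, \<beta>) \<in> ?P" using al by auto
            have "mor_map F (Comp C \<alpha> \<beta>) (v (Dom C \<beta>)) \<in> carrier (?F y)"
              using mc[OF cmp(1)[OF P] abv(3)] cmp[OF P] al by simp
            then show "b \<beta> \<odot>\<^bsub>?F y\<^esub> mor_map F (Comp C \<alpha> \<beta>) (v (Dom C \<beta>)) \<in> carrier (?F y)" using c abv by auto
          qed
        qed
        finally have 1: "mor_map F \<alpha> ((b \<odot>\<^bsub>?M\<^esub> v) (Dom C \<alpha>)) =
          finsum (?F y) (\<lambda>\<beta>. b \<beta> \<odot>\<^bsub>?F y\<^esub> mor_map F (Comp C \<alpha> \<beta>) (v (Dom C \<beta>))) (?A (Dom C \<alpha>))" .
        have q: "mor_map F (Comp C \<alpha> \<beta>) (v (Dom C \<beta>)) \<in> carrier (?F y)" if be: "\<beta> \<in> ?A (Dom C \<alpha>)" for \<beta>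
        proof -
          have P: "(\<alpha>, \<beta>) \<in> ?P" using al be by auto
          show ?thesis using mc[OF cmp(1)[OF P] abv(3)] cmp[OF P] al by simp
        qed
        have ac: "a \<alpha> \<in> carrier k" using c abv by blast
        have qb: "b \<beta> \<odot>\<^bsub>?F y\<^esub> mor_map F (Comp C \<alpha> \<beta>) (v (Dom C \<beta>)) \<in> carrier (?F y)" if "\<beta> \<in> ?A (Dom C \<alpha>)" for \<beta>
          using q[OF that] c[OF abv(2)] by simp
        have "a \<alpha> \<odot>\<^bsub>?F y\<^esub> mor_map F \<alpha> ((b \<odot>\<^bsub>?M\<^esub> v) (Dom C \<alpha>)) =
          finsum (?F y) (\<lambda>\<beta>. a \<alpha> \<odot>\<^bsub>?F y\<^esub> (b \<beta> \<odot>\<^bsub>?F y\<^esub> mor_map F (Comp C \<alpha> \<beta>) (v (Dom C \<beta>)))) (?A (Dom C \<alpha>))"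
          unfolding 1 by (rule Y.finsum_smult_ldistr[OF fA ac]) (rule Pi_I, rule qb)
        also have "\<dots> = finsum (?F y) (\<lambda>\<beta>. ?g (\<alpha>, \<beta>)) (?A (Dom C \<alpha>))"
        proof (rule Y.M.finsum_cong'[OF refl])
          show "(\<lambda>\<beta>. ?g (\<alpha>, \<beta>)) \<in> ?A (Dom C \<alpha>) \<rightarrow> carrier (?F y)"
          proof (rule Pi_I)
            fix \<beta> assume "\<beta> \<in> ?A (Dom C \<alpha>)"
            then show "?g (\<alpha>, \<beta>) \<in> carrier (?F y)" by (intro gcl) (use al in auto)
          qed
          fix \<beta> assume "\<beta> \<in> ?A (Dom C \<alpha>)"
          then show "a \<alpha> \<odot>\<^bsub>?F y\<^esub> (b \<beta> \<odot>\<^bsub>?F y\<^esub> mor_map F (Comp C \<alpha> \<beta>) (v (Dom C \<beta>))) = ?g (\<alpha>, \<beta>)"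
            using Y.smult_assoc1[OF ac c[OF abv(2)] q] by simp
        qed
        finally show "finsum (?F y) (\<lambda>\<beta>. ?g (\<alpha>, \<beta>)) (?A (Dom C \<alpha>)) = a \<alpha> \<odot>\<^bsub>?F y\<^esub> mor_map F \<alpha> ((b \<odot>\<^bsub>?M\<^esub> v) (Dom C \<alpha>))" ..
      qed
      finally show "((a \<otimes>\<^bsub>category_algebra k C\<^esub> b) \<odot>\<^bsub>?M\<^esub> v) y = (a \<odot>\<^bsub>?M\<^esub> (b \<odot>\<^bsub>?M\<^esub> v)) y" .
    qed (use abv smc in auto)
  next
    fix a v w assume avw: "a \<in> carrier (category_algebra k C)" "v \<in> carrier ?M" "w \<in> carrier ?M"
    show "a \<odot>\<^bsub>?M\<^esub> (v \<oplus>\<^bsub>?M\<^esub> w) = a \<odot>\<^bsub>?M\<^esub> v \<oplus>\<^bsub>?M\<^esub> a \<odot>\<^bsub>?M\<^esub> w"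
    proof (rule ext)
      fix y assume y: "y \<in> Ob C"
      interpret Y: module k "?F y" by (rule V[OF y])
      have "(a \<odot>\<^bsub>?M\<^esub> (v \<oplus>\<^bsub>?M\<^esub> w)) y =
        finsum (?F y) (\<lambda>\<alpha>. a \<alpha> \<odot>\<^bsub>?F y\<^esub> mor_map F \<alpha> (v (Dom C \<alpha>)) \<oplus>\<^bsub>?F y\<^esub> a \<alpha> \<odot>\<^bsub>?F y\<^esub> mor_map F \<alpha> (w (Dom C \<alpha>))) (?A y)"
        unfolding sm[OF y]
      proof (rule Y.M.finsum_cong'[OF refl])
        fix \<alpha> assume al: "\<alpha> \<in> ?A y"
        then have "mor_map F \<alpha> ((v \<oplus>\<^bsub>?M\<^esub> w) (Dom C \<alpha>)) = mor_map F \<alpha> (v (Dom C \<alpha>)) \<oplus>\<^bsub>?F y\<^esub> mor_map F \<alpha> (w (Dom C \<alpha>))"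
          using m[of \<alpha>] ad Dom_closed vcl avw by (auto simp: module_homs_def)
        then show "a \<alpha> \<odot>\<^bsub>?F y\<^esub> mor_map F \<alpha> ((v \<oplus>\<^bsub>?M\<^esub> w) (Dom C \<alpha>)) =
          a \<alpha> \<odot>\<^bsub>?F y\<^esub> mor_map F \<alpha> (v (Dom C \<alpha>)) \<oplus>\<^bsub>?F y\<^esub> a \<alpha> \<odot>\<^bsub>?F y\<^esub> mor_map F \<alpha> (w (Dom C \<alpha>))"
          using c avw mc al Y.smult_r_distr by auto
      qed (rule Pi_I, intro Y.M.a_closed cl, use avw in simp_all)
      also have "\<dots> = (a \<odot>\<^bsub>?M\<^esub> v) y \<oplus>\<^bsub>?F y\<^esub> (a \<odot>\<^bsub>?M\<^esub> w) y"
        unfolding sm[OF y] by (rule Y.M.finsum_addf; rule Pi_I; intro cl) (use avw in simp_all)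
      finally show "(a \<odot>\<^bsub>?M\<^esub> (v \<oplus>\<^bsub>?M\<^esub> w)) y = (a \<odot>\<^bsub>?M\<^esub> v \<oplus>\<^bsub>?M\<^esub> a \<odot>\<^bsub>?M\<^esub> w) y"
        unfolding ad[OF y] .
    qed (use avw smc in auto)
  next
    fix v assume v: "v \<in> carrier ?M"
    show "\<one>\<^bsub>category_algebra k C\<^esub> \<odot>\<^bsub>?M\<^esub> v = v"
    proof (rule ext)
      fix y assume y: "y \<in> Ob C"
      interpret Y: module k "?F y" by (rule V[OF y])
      let ?i = "Ident C y"
      have i: "?i \<in> ?A y" "Dom C ?i = y" using Ident_Hom[OF y] by (auto simp: Hom_def)
      have vi: "mor_map F ?i (v y) = v y" using mor_Ident[OF y vcl[OF v y]] .
      have "(\<one>\<^bsub>category_algebra k C\<^esub> \<odot>\<^bsub>?M\<^esub> v) y = finsum (?F y) (\<lambda>\<alpha>. if ?i = \<alpha> then v y else \<zero>\<^bsub>?F y\<^esub>) (?A y)"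
        unfolding sm[OF y]
      proof (rule Y.M.finsum_cong'[OF refl])
        fix \<alpha> assume al: "\<alpha> \<in> ?A y"
        have mm: "mor_map F \<alpha> (v (Dom C \<alpha>)) \<in> carrier (?F y)" using mc al v by auto
        have iff: "\<alpha> \<in> Ident C ` Ob C \<longleftrightarrow> ?i = \<alpha>"
        proof
          assume "\<alpha> \<in> Ident C ` Ob C"
          then show "?i = \<alpha>" using al Ident_Hom by (auto simp: Hom_def)
        qed (use y in blast)
        show "\<one>\<^bsub>category_algebra k C\<^esub> \<alpha> \<odot>\<^bsub>?F y\<^esub> mor_map F \<alpha> (v (Dom C \<alpha>)) = (if ?i = \<alpha> then v y else \<zero>\<^bsub>?F y\<^esub>)"
        proof (cases "?i = \<alpha>")
          case True
          then have "mor_map F \<alpha> (v (Dom C \<alpha>)) = v y" using i vi by simp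
          then show ?thesis using True iff vcl[OF v y] by (simp add: category_algebra_def)
        next
          case False
          then show ?thesis using iff mm by (simp add: category_algebra_def)
        qed
      qed (use vcl[OF v y] in auto)
      also have "\<dots> = v y" using Y.M.add.finprod_singleton[OF i(1) fA, of "\<lambda>_. v y"] vcl[OF v y] by auto
      finally show "(\<one>\<^bsub>category_algebra k C\<^esub> \<odot>\<^bsub>?M\<^esub> v) y = v y" .
    qed (use v smc in auto)
  qed
qed

lemma K_functor_left_module:
  assumes "field k" "finite_EI_category C" "skeletal C"
  shows "left_module (category_algebra k C) (functor_module C (K_functor k C))"
proof -
  interpret field k by fact
  interpret finite_EI_category C by fact
  interpret functor_to_kmod k C "K_functor k C" by (rule K_functor_functor) fact+
  show ?thesis by (rule functor_module_left_module) (use finite_Mor cring_axioms in auto)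
qed

end

theory Submission
  imports Defs
begin

text \<open>Write \<open>\<gamma>u\<close> for the composite \<open>\<gamma> \<circ> u\<close>. Every non-isomorphism \<open>\<alpha>\<close> of a skeletal finite EI
  category is a composite \<open>\<alpha> = \<gamma>u\<close> with \<open>u\<close> unfactorizable. Two such factorizations are
  equivalent if they are \<open>\<gamma>h, u\<close> and \<open>\<gamma>, hu\<close> for an automorphism \<open>h\<close>. Splitting off the first
  morphisms of two chains one after the other shows that the category is free if and only if all
  factorizations \<open>\<alpha> = \<gamma>u\<close> of the same \<open>\<alpha>\<close> are equivalent
  (\<open>free_EI_iff_unique_initial_factorization\<close>).

  A left module over the category algebra \<open>kC\<close> that comes from a functor is projective if and only
  if it is a direct summand of the free functor on its underlying vector spaces. For the functor
  \<open>K\<close> that free functor has at the object \<open>y\<close> the basis of all pairs \<open>(\<eta>, z)\<close>, where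
  \<open>\<eta>\<close> is a morphism to \<open>y\<close> and \<open>z\<close> is a non-isomorphism to the domain of \<open>\<eta>\<close>, and it is mapped
  onto \<open>K\<close> by \<open>(\<eta>, z) \<mapsto> \<eta>z\<close>. A section of this map assigns to every non-isomorphism \<open>\<alpha>\<close> to \<open>y\<close>
  coefficients \<open>V \<alpha> (\<eta>, z)\<close> in \<open>k\<close>. This matrix \<open>V\<close> (\<open>splitting\<close>) is what links projectivity with
  combinatorics: \<open>K\<close> is projective if and only if it exists (\<open>splitting_if_projective\<close>,
  \<open>projective_if_splitting\<close>).

  A splitting forces the factorizations of \<open>\<alpha>\<close> to be equivalent
  (\<open>unique_initial_factorization_if_splitting\<close>). Regard \<open>V \<alpha>\<close> as a \<open>k\<close>-valued measure on pairs. If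
  \<open>\<alpha> = \<gamma>u\<close> with \<open>\<gamma>\<close> not an isomorphism, then \<open>V \<alpha>\<close> is the image under \<open>\<gamma>\<close> of the measure \<open>V u\<close>. By
  induction the factorizations of morphisms to the domain of \<open>\<gamma>\<close> are unique up to equivalence, so the
  class of the factorization belonging to a pair \<open>(\<eta>, z)\<close> there is a function of \<open>\<eta>z\<close>; and the
  image of \<open>V u\<close> under \<open>(\<eta>, z) \<mapsto> \<eta>z\<close> is the point mass at \<open>u\<close>. Hence \<open>V \<alpha>\<close> gives mass \<open>1\<close> to the
  class of \<open>\<gamma>, u\<close> and mass \<open>0\<close> to the other classes. As \<open>V \<alpha>\<close> does not depend on the
  factorization, all factorizations of \<open>\<alpha>\<close> are in the same class.

  Conversely, let \<open>k Hom(w, x)\<close> be projective over \<open>k Aut(x)\<close>. The same argument as for \<open>K\<close> gives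
  coefficients \<open>W u (g, u')\<close> for \<open>u, u' : w \<rightarrow> x\<close> and automorphisms \<open>g\<close> of \<open>x\<close> (\<open>Hom_splitting\<close>). For
  \<open>\<alpha> = \<gamma>u\<close> let \<open>V \<alpha>\<close> be the image of the measure \<open>W u\<close> under \<open>(g, u') \<mapsto> (\<gamma>g, u')\<close>.
  Equivariance of \<open>W\<close> says that equivalent factorizations give the same \<open>V \<alpha>\<close>, so if they are all
  equivalent, then \<open>V\<close> is well defined, and it is a splitting
  (\<open>splitting_if_unique_initial_factorization\<close>).\<close>

section \<open>Finite sums\<close>

lemma (in abelian_monoid) finsum_group_by:
  assumes "finite A" "finite Y" "g \<in> A \<rightarrow> Y" "\<And>x. x \<in> A \<Longrightarrow> f x \<in> carrier G"
  shows "(\<Oplus>y\<in>Y. \<Oplus>x\<in>{x \<in> A. g x = y}. f x) = (\<Oplus>x\<in>A. f x)"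
proof -
  let ?S = "SIGMA y:Y. {x \<in> A. g x = y}"
  have "(\<Oplus>y\<in>Y. \<Oplus>x\<in>{x \<in> A. g x = y}. f x) = (\<Oplus>p\<in>?S. f (snd p))"
    using finsum_fibres[of Y "\<lambda>y. {x \<in> A. g x = y}" "\<lambda>p. f (snd p)"] assms by simp
  also have "\<dots> = (\<Oplus>x\<in>snd ` ?S. f x)"
    by (rule finsum_reindex[symmetric]) (use assms in \<open>auto simp: inj_on_def\<close>)
  also have "snd ` ?S = A" using assms(3) by (auto simp: image_iff)
  finally show ?thesis .
qed

lemma (in abelian_monoid) finsum_swap:
  assumes "finite A" "finite B" "\<And>x y. x \<in> A \<Longrightarrow> y \<in> B \<Longrightarrow> f x y \<in> carrier G"
  shows "(\<Oplus>x\<in>A. \<Oplus>y\<in>B. f x y) = (\<Oplus>y\<in>B. \<Oplus>x\<in>A. f x y)"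
  using assms(1,3)
proof (induction A rule: finite_induct)
  case (insert a A)
  have cl: "f x y \<in> carrier G" if "x \<in> insert a A" "y \<in> B" for x y using insert.prems that by blast
  have "(\<Oplus>x\<in>insert a A. \<Oplus>y\<in>B. f x y) = (\<Oplus>y\<in>B. f a y) \<oplus> (\<Oplus>x\<in>A. \<Oplus>y\<in>B. f x y)"
    using insert.hyps cl by (intro finsum_insert) (auto intro!: finsum_closed)
  also have "(\<Oplus>x\<in>A. \<Oplus>y\<in>B. f x y) = (\<Oplus>y\<in>B. \<Oplus>x\<in>A. f x y)"
    using insert.IH cl by blast
  also have "(\<Oplus>y\<in>B. f a y) \<oplus> \<dots> = (\<Oplus>y\<in>B. f a y \<oplus> (\<Oplus>x\<in>A. f x y))"
    by (rule finsum_addf[symmetric]) (use cl in \<open>auto intro!: finsum_closed\<close>)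
  also have "\<dots> = (\<Oplus>y\<in>B. \<Oplus>x\<in>insert a A. f x y)"
  proof (rule finsum_cong'[OF refl])
    fix y assume "y \<in> B"
    then show "f a y \<oplus> (\<Oplus>x\<in>A. f x y) = (\<Oplus>x\<in>insert a A. f x y)"
      using insert.hyps cl by (intro finsum_insert[symmetric]) auto
  qed (use insert.hyps cl in \<open>auto intro!: finsum_closed\<close>)
  finally show ?case .
qed (simp add: finsum_zero)

lemma (in abelian_monoid) finsum_fibre_fst:
  assumes "\<And>q. q \<in> Q \<Longrightarrow> f q \<in> carrier G"
  shows "(\<Oplus>n\<in>{n. (n, z) \<in> Q \<and> g n = n'}. f (n, z)) = (\<Oplus>q\<in>{q \<in> Q. (g (fst q), snd q) = (n', z)}. f q)"
proof -
  have "{q \<in> Q. (g (fst q), snd q) = (n', z)} = (\<lambda>n. (n, z)) ` {n. (n, z) \<in> Q \<and> g n = n'}" by auto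
  then show ?thesis using assms by (simp only:) (rule finsum_reindex[symmetric], auto simp: inj_on_def)
qed

lemma finsum_additive:
  assumes "abelian_monoid G" "abelian_monoid H" "h \<in> carrier G \<rightarrow> carrier H" "h \<zero>\<^bsub>G\<^esub> = \<zero>\<^bsub>H\<^esub>"
    and "\<And>x y. x \<in> carrier G \<Longrightarrow> y \<in> carrier G \<Longrightarrow> h (x \<oplus>\<^bsub>G\<^esub> y) = h x \<oplus>\<^bsub>H\<^esub> h y"
    and "finite A" "f \<in> A \<rightarrow> carrier G"
  shows "h (finsum G f A) = finsum H (\<lambda>x. h (f x)) A"
proof -
  interpret G: abelian_monoid G by fact
  interpret H: abelian_monoid H by fact
  show ?thesis using assms(6,7)
  proof (induction A rule: finite_induct)
    case (insert a A)
    then have "f \<in> A \<rightarrow> carrier G" "f a \<in> carrier G" by auto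
    then show ?case
      using insert assms(3,5) G.finsum_closed[of f A] by (simp add: Pi_def)
  qed (simp add: assms(4))
qed

lemma (in cring) finsum_indicator:
  assumes "finite Q" "\<And>q. q \<in> Q \<Longrightarrow> f q \<in> carrier R"
  shows "(\<Oplus>q\<in>Q. f q \<otimes> (if P q then \<one> else \<zero>)) = (\<Oplus>q\<in>{q \<in> Q. P q}. f q)"
  by (rule add.finprod_mono_neutral_cong_right) (use assms in auto)

text \<open>If the image of the measure \<open>\<mu>\<close> under \<open>act\<close> is the point mass at \<open>x\<close>, then functions that
  factor through \<open>act\<close> are integrated by evaluation at \<open>x\<close>.\<close>

lemma (in cring) finsum_expectation:
  assumes "finite Q" "finite Y" "act \<in> Q \<rightarrow> Y" "\<mu> \<in> Q \<rightarrow> carrier R" "F \<in> Y \<rightarrow> carrier R" "x \<in> Y"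
    and "\<And>z. z \<in> Y \<Longrightarrow> (\<Oplus>q\<in>{q \<in> Q. act q = z}. \<mu> q) = (if x = z then \<one> else \<zero>)"
  shows "(\<Oplus>q\<in>Q. \<mu> q \<otimes> F (act q)) = F x"
proof -
  have "(\<Oplus>q\<in>Q. \<mu> q \<otimes> F (act q)) = (\<Oplus>z\<in>Y. \<Oplus>q\<in>{q \<in> Q. act q = z}. \<mu> q \<otimes> F (act q))"
    by (rule finsum_group_by[symmetric]) (use assms in auto)
  also have "\<dots> = (\<Oplus>z\<in>Y. if x = z then F z else \<zero>)"
  proof (rule finsum_cong')
    fix z assume z: "z \<in> Y"
    have "(\<Oplus>q\<in>{q \<in> Q. act q = z}. \<mu> q \<otimes> F (act q)) = (\<Oplus>q\<in>{q \<in> Q. act q = z}. \<mu> q \<otimes> F z)"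
      by (rule finsum_cong') (use assms z in auto)
    also have "\<dots> = (\<Oplus>q\<in>{q \<in> Q. act q = z}. \<mu> q) \<otimes> F z"
      by (rule finsum_ldistr[symmetric]) (use assms z in auto)
    finally show "(\<Oplus>q\<in>{q \<in> Q. act q = z}. \<mu> q \<otimes> F (act q)) = (if x = z then F z else \<zero>)"
      using funcset_mem[OF assms(5) z] unfolding assms(7)[OF z] by simp
  qed (use assms in auto)
  also have "\<dots> = F x" using finsum_singleton[OF assms(6,2,5)] .
  finally show ?thesis .
qed

text \<open>The transformation formula for the image measure \<open>\<mu>'\<close> of \<open>\<mu>\<close> under \<open>g\<close>.\<close>

lemma (in cring) finsum_pushforward:
  assumes "finite Q" "finite Q'" "g \<in> Q \<rightarrow> Q'" "\<mu> \<in> Q \<rightarrow> carrier R" "F \<in> Q' \<rightarrow> carrier R"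
    and "\<And>q'. q' \<in> Q' \<Longrightarrow> \<mu>' q' = (\<Oplus>q\<in>{q \<in> Q. g q = q'}. \<mu> q)"
  shows "(\<Oplus>q'\<in>Q'. \<mu>' q' \<otimes> F q') = (\<Oplus>q\<in>Q. \<mu> q \<otimes> F (g q))"
proof -
  have "(\<Oplus>q\<in>Q. \<mu> q \<otimes> F (g q)) = (\<Oplus>q'\<in>Q'. \<Oplus>q\<in>{q \<in> Q. g q = q'}. \<mu> q \<otimes> F (g q))"
    by (rule finsum_group_by[symmetric]) (use assms in auto)
  also have "\<dots> = (\<Oplus>q'\<in>Q'. \<mu>' q' \<otimes> F q')"
  proof (rule finsum_cong')
    fix q' assume q': "q' \<in> Q'"
    have "(\<Oplus>q\<in>{q \<in> Q. g q = q'}. \<mu> q \<otimes> F (g q)) = (\<Oplus>q\<in>{q \<in> Q. g q = q'}. \<mu> q \<otimes> F q')"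
      by (rule finsum_cong') (use assms q' in auto)
    also have "\<dots> = (\<Oplus>q\<in>{q \<in> Q. g q = q'}. \<mu> q) \<otimes> F q'"
      by (rule finsum_ldistr[symmetric]) (use assms q' in auto)
    finally show "(\<Oplus>q\<in>{q \<in> Q. g q = q'}. \<mu> q \<otimes> F (g q)) = \<mu>' q' \<otimes> F q'"
      unfolding assms(6)[OF q'] .
  next
    show "(\<lambda>q'. \<mu>' q' \<otimes> F q') \<in> Q' \<rightarrow> carrier R"
    proof
      fix q' assume q': "q' \<in> Q'"
      have "(\<Oplus>q\<in>{q \<in> Q. g q = q'}. \<mu> q) \<in> carrier R" by (rule finsum_closed) (use assms(4) in auto)
      then show "\<mu>' q' \<otimes> F q' \<in> carrier R" unfolding assms(6)[OF q'] using assms(5) q' by auto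
    qed
  qed simp
  finally show ?thesis ..
qed

lemma (in cring) bilinear_extension_single:
  assumes "finite P" "\<And>y. b y \<in> carrier R"
  shows "bilinear_extension R P m (\<lambda>x. if x = s then \<one> else \<zero>) b z = (\<Oplus>y\<in>{y. (s, y) \<in> P \<and> m s y = z}. b y)"
proof -
  let ?A = "{(x, y). (x, y) \<in> P \<and> m x y = z}"
  let ?B = "{y. (s, y) \<in> P \<and> m s y = z}"
  have fin: "finite ?A" using assms(1) by (auto intro: rev_finite_subset)
  have "(\<Oplus>p\<in>?A. case p of (x, y) \<Rightarrow> (if x = s then \<one> else \<zero>) \<otimes> b y) = (\<Oplus>p\<in>Pair s ` ?B. b (snd p))"
    by (rule add.finprod_mono_neutral_cong_right) (use fin assms(2) in auto)
  also have "\<dots> = (\<Oplus>y\<in>?B. b y)"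
    by (subst finsum_reindex) (use assms(2) in \<open>auto simp: inj_on_def\<close>)
  finally show ?thesis by (simp add: bilinear_extension_def)
qed

section \<open>Coefficients of elements of projective modules\<close>

lemma module_homs_zero:
  assumes "f \<in> module_homs R M N" "abelian_group M" "abelian_group N"
  shows "f \<zero>\<^bsub>M\<^esub> = \<zero>\<^bsub>N\<^esub>"
proof -
  interpret M: abelian_group M by fact
  interpret N: abelian_group N by fact
  have "f \<zero>\<^bsub>M\<^esub> \<in> carrier N" "f (\<zero>\<^bsub>M\<^esub> \<oplus>\<^bsub>M\<^esub> \<zero>\<^bsub>M\<^esub>) = f \<zero>\<^bsub>M\<^esub> \<oplus>\<^bsub>N\<^esub> f \<zero>\<^bsub>M\<^esub>"
    using assms(1) M.zero_closed unfolding module_homs_def by blast+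
  then show ?thesis by simp
qed

lemma (in left_module) smult_finsum:
  assumes "a \<in> carrier R" "finite A" "f \<in> A \<rightarrow> carrier M"
  shows "a \<odot>\<^bsub>M\<^esub> finsum M f A = finsum M (\<lambda>x. a \<odot>\<^bsub>M\<^esub> f x) A"
proof (rule finsum_additive[where h = "smult M a"])
  show "a \<odot>\<^bsub>M\<^esub> \<zero>\<^bsub>M\<^esub> = \<zero>\<^bsub>M\<^esub>"
    using smult_r_distr[OF assms(1) M.zero_closed M.zero_closed] smult_closed[OF assms(1) M.zero_closed] by simp
qed (use assms smult_closed smult_r_distr M.abelian_monoid_axioms in auto)

lemma (in ring) free_module_expansion:
  assumes "f \<in> carrier (free_module R B)" "finite A" "{b. f b \<noteq> \<zero>} \<subseteq> A" "A \<subseteq> B"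
  shows "f = finsum (free_module R B) (\<lambda>b. f b \<odot>\<^bsub>free_module R B\<^esub> (\<lambda>b'. if b' = b then \<one> else \<zero>)) A"
proof -
  have c: "f b \<in> carrier R" for b using assms(1) by (simp add: free_module_def)
  have e: "(\<lambda>b'. f b \<otimes> (if b' = b then \<one> else \<zero>)) \<in> carrier (free_module R B)" if "b \<in> A" for b
    using that assms(4) c by (auto simp: free_module_def)
  have "finsum (free_module R B) (\<lambda>b. f b \<odot>\<^bsub>free_module R B\<^esub> (\<lambda>b'. if b' = b then \<one> else \<zero>)) A =
      (\<lambda>b'. \<Oplus>b\<in>A. f b \<otimes> (if b' = b then \<one> else \<zero>))"
    using finsum_free_module[of A "\<lambda>b b'. f b \<otimes> (if b' = b then \<one> else \<zero>)" B] e assms(2)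
    by (simp add: free_module_def)
  also have "\<dots> = f"
  proof
    fix b'
    have "(\<Oplus>b\<in>A. f b \<otimes> (if b' = b then \<one> else \<zero>)) = (\<Oplus>b\<in>A. if b' = b then f b else \<zero>)"
      by (rule finsum_cong') (use c in auto)
    also have "\<dots> = f b'"
    proof (cases "b' \<in> A")
      case True
      then show ?thesis using finsum_singleton[OF True assms(2), of f] c by auto
    next
      case False
      then have "(\<Oplus>b\<in>A. if b' = b then f b else \<zero>) = (\<Oplus>b\<in>A. \<zero>)" by (intro finsum_cong') auto
      moreover have "f b' = \<zero>" using False assms(3) by auto
      ultimately show ?thesis by (simp add: finsum_zero)
    qed
    finally show "(\<Oplus>b\<in>A. f b \<otimes> (if b' = b then \<one> else \<zero>)) = f b'" .
  qed
  finally show ?thesis ..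
qed

text \<open>The dual basis lemma: the maps \<open>i b\<close> are the coordinates of an embedding of \<open>P\<close> into a free
  module, and \<open>m b\<close> is the image in \<open>P\<close> of the basis vector \<open>b\<close>. Only finitely many \<open>b\<close> occur in the
  expansions of finitely many elements.\<close>

lemma projective_dual_basis:
  assumes proj: "projective_left_module R P" and S: "finite S" "S \<subseteq> carrier P"
  obtains B :: "'p set" and i :: "'p \<Rightarrow> 'p \<Rightarrow> 'r" and m :: "'p \<Rightarrow> 'p"
  where "finite B" "\<And>b v. v \<in> carrier P \<Longrightarrow> i b v \<in> carrier R"
    "\<And>b a v. a \<in> carrier R \<Longrightarrow> v \<in> carrier P \<Longrightarrow> i b (a \<odot>\<^bsub>P\<^esub> v) = a \<otimes>\<^bsub>R\<^esub> i b v"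
    "m \<in> B \<rightarrow> carrier P" "\<And>v. v \<in> S \<Longrightarrow> v = finsum P (\<lambda>b. i b v \<odot>\<^bsub>P\<^esub> m b) B"
proof -
  interpret left_module R P using proj by (simp add: projective_left_module_def)
  obtain B :: "'p set" and i p where i: "i \<in> module_homs R P (free_module R B)"
    and p: "p \<in> module_homs R (free_module R B) P" and pi: "\<forall>v \<in> carrier P. p (i v) = v"
    using proj unfolding projective_left_module_def by blast
  let ?F = "free_module R B"
  let ?e = "\<lambda>b b'. if b' = b then \<one>\<^bsub>R\<^esub> else \<zero>\<^bsub>R\<^esub>"
  interpret F: left_module R ?F by (rule free_module_left_module)
  define D where "D = (\<Union>v\<in>S. {b. i v b \<noteq> \<zero>\<^bsub>R\<^esub>})"
  have iF: "i v \<in> carrier ?F" if "v \<in> carrier P" for v using i that by (auto simp: module_homs_def)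
  have D: "finite D" "D \<subseteq> B" using S iF by (auto simp: D_def free_module_def)
  have e: "?e b \<in> carrier ?F" if "b \<in> B" for b using that by (auto simp: free_module_def)
  have cl: "i v b \<in> carrier R" if "v \<in> carrier P" for v b using iF[OF that] by (simp add: free_module_def)
  show thesis
  proof (rule that[of D "\<lambda>b v. i v b" "\<lambda>b. p (?e b)"])
    show "i v b \<in> carrier R" if "v \<in> carrier P" for b v by (rule cl[OF that])
    show "i (a \<odot>\<^bsub>P\<^esub> v) b = a \<otimes>\<^bsub>R\<^esub> i v b" if "a \<in> carrier R" "v \<in> carrier P" for b a v
      using i that by (simp add: module_homs_def free_module_def)
    show "(\<lambda>b. p (?e b)) \<in> D \<rightarrow> carrier P" using p e D by (auto simp: module_homs_def)
    fix v assume v: "v \<in> S"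
    then have vP: "v \<in> carrier P" using S by auto
    have "v = p (i v)" using pi vP by simp
    also have "i v = finsum ?F (\<lambda>b. i v b \<odot>\<^bsub>?F\<^esub> ?e b) D"
      by (rule free_module_expansion) (use iF[OF vP] D v in \<open>auto simp: D_def\<close>)
    also have "p \<dots> = finsum P (\<lambda>b. p (i v b \<odot>\<^bsub>?F\<^esub> ?e b)) D"
      by (rule finsum_additive[where h = p])
        (use p D e cl[OF vP] F.smult_closed module_homs_zero[OF p] F.abelian_group_axioms M.abelian_group_axioms
          F.M.abelian_monoid_axioms M.abelian_monoid_axioms in \<open>auto simp: module_homs_def\<close>)
    also have "\<dots> = finsum P (\<lambda>b. i v b \<odot>\<^bsub>P\<^esub> p (?e b)) D"
      by (rule M.finsum_cong') (use p D e cl[OF vP] in \<open>auto simp: module_homs_def intro!: smult_closed\<close>)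
    finally show "v = finsum P (\<lambda>b. i v b \<odot>\<^bsub>P\<^esub> p (?e b)) D" .
  qed (rule D)
qed

text \<open>The algebra \<open>A\<close> consists of functions on a set of operators, \<open>P\<close> has the \<open>k\<close>-basis \<open>e\<close> with
  coordinate functions \<open>coord\<close>, and operators move basis vectors by \<open>act\<close>. Expanding the elements
  \<open>i b (e x)\<close> of \<open>A\<close> and \<open>m b\<close> of \<open>P\<close> of a dual basis by these \<open>k\<close>-bases turns
  \<open>e x = \<Sum>\<^sub>b i b (e x) \<cdot> m b\<close> into an identity between coefficients
  \<open>W x (n, z) = \<Sum>\<^sub>b (i b (e x))(n) (m b)(z)\<close>. The last clause is \<open>A\<close>-linearity of \<open>i b\<close>, read off at the
  operator \<open>n\<close>: the operators \<open>N\<close> are those that multiplication by \<open>s\<close> takes to \<open>n\<close>. The lemma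
  applies to \<open>k Hom(w, x)\<close> over a group algebra and to \<open>K\<close> over the category algebra.\<close>

lemma (in cring) projective_coefficients:
  fixes A :: "('m \<Rightarrow> 'a, 's) ring_scheme" and P :: "('m \<Rightarrow> 'a, 'p, 't) module_scheme"
    and e :: "'x \<Rightarrow> 'p" and coord :: "'p \<Rightarrow> 'x \<Rightarrow> 'a" and act :: "'m \<times> 'x \<Rightarrow> 'x"
  assumes proj: "projective_left_module A P"
    and A: "\<And>a n. a \<in> carrier A \<Longrightarrow> a n \<in> carrier R"
    and Q: "finite Q"
    and Y: "finite Y" "e \<in> Y \<rightarrow> carrier P"
    and coord: "\<And>v x. v \<in> carrier P \<Longrightarrow> coord v x \<in> carrier R"
    and coord_zero: "\<And>x. x \<in> Y \<Longrightarrow> coord \<zero>\<^bsub>P\<^esub> x = \<zero>"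
    and coord_add: "\<And>v w x. v \<in> carrier P \<Longrightarrow> w \<in> carrier P \<Longrightarrow> x \<in> Y \<Longrightarrow>
      coord (v \<oplus>\<^bsub>P\<^esub> w) x = coord v x \<oplus> coord w x"
    and coord_smult: "\<And>a v x. a \<in> carrier A \<Longrightarrow> v \<in> carrier P \<Longrightarrow> x \<in> Y \<Longrightarrow>
      coord (a \<odot>\<^bsub>P\<^esub> v) x = (\<Oplus>q\<in>{q \<in> Q. act q = x}. a (fst q) \<otimes> coord v (snd q))"
    and coord_basis: "\<And>x z. x \<in> Y \<Longrightarrow> z \<in> Y \<Longrightarrow> coord (e x) z = (if x = z then \<one> else \<zero>)"
  obtains W :: "'x \<Rightarrow> 'm \<times> 'x \<Rightarrow> 'a"
  where "\<And>x q. x \<in> Y \<Longrightarrow> W x q \<in> carrier R"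
    "\<And>x z. x \<in> Y \<Longrightarrow> z \<in> Y \<Longrightarrow> (\<Oplus>q\<in>{q \<in> Q. act q = z}. W x q) = (if x = z then \<one> else \<zero>)"
    "\<And>s x x' n z N. s \<in> carrier A \<Longrightarrow> x \<in> Y \<Longrightarrow> x' \<in> Y \<Longrightarrow> e x' = s \<odot>\<^bsub>P\<^esub> e x \<Longrightarrow> finite N \<Longrightarrow>
      (\<And>a. a \<in> carrier A \<Longrightarrow> (s \<otimes>\<^bsub>A\<^esub> a) n = (\<Oplus>n'\<in>N. a n')) \<Longrightarrow>
      W x' (n, z) = (\<Oplus>n'\<in>N. W x (n', z))"
proof -
  interpret P: left_module A P using proj by (simp add: projective_left_module_def)
  have eX: "finite (e ` Y)" "e ` Y \<subseteq> carrier P" using Y by auto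
  obtain B :: "'p set" and i m where B: "finite B" and i: "\<And>b v. v \<in> carrier P \<Longrightarrow> i b v \<in> carrier A"
    and lin: "\<And>b a v. a \<in> carrier A \<Longrightarrow> v \<in> carrier P \<Longrightarrow> i b (a \<odot>\<^bsub>P\<^esub> v) = a \<otimes>\<^bsub>A\<^esub> i b v"
    and m: "m \<in> B \<rightarrow> carrier P" and sum: "\<And>v. v \<in> e ` Y \<Longrightarrow> v = finsum P (\<lambda>b. i b v \<odot>\<^bsub>P\<^esub> m b) B"
    by (rule projective_dual_basis[OF proj eX], rule that, assumption+)
  have ec: "e x \<in> carrier P" if "x \<in> Y" for x using Y that by auto
  have ic: "i b (e x) n \<in> carrier R" if "x \<in> Y" for b x n using A i ec that by blast
  have mc: "coord (m b) x \<in> carrier R" if "b \<in> B" for b x using coord m that by auto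
  define W where "W x q = (\<Oplus>b\<in>B. i b (e x) (fst q) \<otimes> coord (m b) (snd q))" for x q
  show thesis
  proof (rule that[of W])
    show "W x q \<in> carrier R" if "x \<in> Y" for x q
      unfolding W_def using that ic mc by auto
  next
    fix x z assume x: "x \<in> Y" and z: "z \<in> Y"
    have im: "i b (e x) \<odot>\<^bsub>P\<^esub> m b \<in> carrier P" if "b \<in> B" for b
      by (rule P.smult_closed[OF i[OF ec[OF x]] funcset_mem[OF m that]])
    have "(if x = z then \<one> else \<zero>) = coord (finsum P (\<lambda>b. i b (e x) \<odot>\<^bsub>P\<^esub> m b) B) z"
      using sum[of "e x"] x coord_basis[OF x z] by simp
    also have "\<dots> = (\<Oplus>b\<in>B. coord (i b (e x) \<odot>\<^bsub>P\<^esub> m b) z)"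
      by (rule finsum_additive[where h = "\<lambda>v. coord v z"])
        (use coord coord_zero coord_add z B im P.M.abelian_monoid_axioms abelian_monoid_axioms in auto)
    also have "\<dots> = (\<Oplus>b\<in>B. \<Oplus>q\<in>{q \<in> Q. act q = z}. i b (e x) (fst q) \<otimes> coord (m b) (snd q))"
      by (rule finsum_cong'[OF refl], use ic[OF x] mc in \<open>force intro!: finsum_closed\<close>)
        (rule coord_smult[OF i[OF ec[OF x]] funcset_mem[OF m] z])
    also have "\<dots> = (\<Oplus>q\<in>{q \<in> Q. act q = z}. W x q)"
      unfolding W_def by (rule finsum_swap) (use B Q ic[OF x] mc in auto)
    finally show "(\<Oplus>q\<in>{q \<in> Q. act q = z}. W x q) = (if x = z then \<one> else \<zero>)" ..
  next
    fix s x x' n z and N :: "'m set"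
    assume s: "s \<in> carrier A" and x: "x \<in> Y" "x' \<in> Y" and e: "e x' = s \<odot>\<^bsub>P\<^esub> e x" and N: "finite N"
      and conv: "\<And>a. a \<in> carrier A \<Longrightarrow> (s \<otimes>\<^bsub>A\<^esub> a) n = (\<Oplus>n'\<in>N. a n')"
    have "W x' (n, z) = (\<Oplus>b\<in>B. \<Oplus>n'\<in>N. i b (e x) n' \<otimes> coord (m b) z)"
      unfolding W_def
    proof (rule finsum_cong')
      fix b assume b: "b \<in> B"
      have "i b (e x') n = (\<Oplus>n'\<in>N. i b (e x) n')"
        unfolding e using lin[OF s ec[OF x(1)]] conv i ec[OF x(1)] by simp
      then show "i b (e x') (fst (n, z)) \<otimes> coord (m b) (snd (n, z)) = (\<Oplus>n'\<in>N. i b (e x) n' \<otimes> coord (m b) z)"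
        using finsum_ldistr[OF N mc[OF b]] ic[OF x(1)] by auto
    qed (use ic[OF x(1)] mc in \<open>auto intro!: finsum_closed\<close>)
    also have "\<dots> = (\<Oplus>n'\<in>N. W x (n', z))"
      unfolding W_def by (subst finsum_swap) (use B N ic[OF x(1)] mc in auto)
    finally show "W x' (n, z) = (\<Oplus>n'\<in>N. W x (n', z))" .
  qed
qed

section \<open>Skeletal finite EI categories\<close>

locale skeletal_EI_category = finite_EI_category +
  assumes skeletal: "skeletal C"
begin

abbreviation composite :: "'b \<Rightarrow> 'b \<Rightarrow> 'b" (infixr "\<bullet>" 70) where
  "\<gamma> \<bullet> \<beta> \<equiv> Comp C \<gamma> \<beta>"

lemma Comp_Mor:
  assumes "\<gamma> \<in> Mor C" "\<beta> \<in> Mor C" "Cod C \<beta> = Dom C \<gamma>"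
  shows "\<gamma> \<bullet> \<beta> \<in> Mor C" "Dom C (\<gamma> \<bullet> \<beta>) = Dom C \<beta>" "Cod C (\<gamma> \<bullet> \<beta>) = Cod C \<gamma>"
  using Comp_Hom[of \<beta> "Dom C \<beta>" "Dom C \<gamma>" \<gamma> "Cod C \<gamma>"] assms by (auto simp: Hom_def)

lemma Comp_Mor_assoc:
  assumes "\<gamma> \<in> Mor C" "\<beta> \<in> Mor C" "\<alpha> \<in> Mor C" "Cod C \<beta> = Dom C \<gamma>" "Cod C \<alpha> = Dom C \<beta>"
  shows "(\<gamma> \<bullet> \<beta>) \<bullet> \<alpha> = \<gamma> \<bullet> \<beta> \<bullet> \<alpha>"
  using Comp_assoc[of \<alpha> "Dom C \<alpha>" "Dom C \<beta>" \<beta> "Dom C \<gamma>" \<gamma> "Cod C \<gamma>"] assms by (auto simp: Hom_def)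

lemma Ident_Mor:
  assumes "x \<in> Ob C"
  shows "Ident C x \<in> Mor C" "Dom C (Ident C x) = x" "Cod C (Ident C x) = x"
  using Ident_Hom[OF assms] by (auto simp: Hom_def)

lemma Ident_Comp: "\<alpha> \<in> Mor C \<Longrightarrow> Ident C (Cod C \<alpha>) \<bullet> \<alpha> = \<alpha>"
  and Comp_Ident: "\<alpha> \<in> Mor C \<Longrightarrow> \<alpha> \<bullet> Ident C (Dom C \<alpha>) = \<alpha>"
  using Ident_left Ident_right by (auto simp: Hom_def)

lemma iso_mor_iff:
  assumes "\<alpha> \<in> Mor C"
  shows "iso_mor C \<alpha> \<longleftrightarrow> Dom C \<alpha> = Cod C \<alpha>"
proof
  note a = assms
  assume "iso_mor C \<alpha>"
  with a have "isomorphic_objects C (Dom C \<alpha>) (Cod C \<alpha>)"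
    unfolding isomorphic_objects_def by (intro bexI[of _ \<alpha>]) (auto simp: Hom_def)
  then show "Dom C \<alpha> = Cod C \<alpha>" using skeletal a Dom_closed Cod_closed unfolding skeletal_def by blast
next
  assume "Dom C \<alpha> = Cod C \<alpha>"
  then show "iso_mor C \<alpha>" using EI[of "Dom C \<alpha>" \<alpha>] Dom_closed[OF assms] assms by (simp add: Hom_def)
qed

definition Noniso :: "'b set" where
  "Noniso = {\<alpha> \<in> Mor C. Dom C \<alpha> \<noteq> Cod C \<alpha>}"

lemma NonisoD: "\<alpha> \<in> Noniso \<Longrightarrow> \<alpha> \<in> Mor C" "\<alpha> \<in> Noniso \<Longrightarrow> Dom C \<alpha> \<noteq> Cod C \<alpha>"
  by (auto simp: Noniso_def)

lemma finite_Noniso: "finite Noniso"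
  using finite_Mor by (simp add: Noniso_def)

lemma Noniso_iff: "\<alpha> \<in> Noniso \<longleftrightarrow> \<alpha> \<in> Mor C \<and> \<not> iso_mor C \<alpha>"
  using iso_mor_iff by (auto simp: Noniso_def)

lemma K_basis_eq: "K_basis C x = {\<alpha> \<in> Noniso. Cod C \<alpha> = x}"
  using Dom_closed by (auto simp: K_basis_def Noniso_def Hom_def)

lemma Comp_Noniso_right:
  assumes "\<gamma> \<in> Mor C" "\<beta> \<in> Noniso" "Cod C \<beta> = Dom C \<gamma>"
  shows "\<gamma> \<bullet> \<beta> \<in> Noniso"
proof -
  have "\<gamma> \<bullet> \<beta> \<in> K_basis C (Cod C \<gamma>)"
    by (rule K_basis_Comp[OF skeletal, of _ "Dom C \<gamma>"]) (use assms K_basis_eq in \<open>auto simp: Hom_def\<close>)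
  then show ?thesis by (simp add: K_basis_eq)
qed

lemma Comp_Noniso_left:
  assumes "\<gamma> \<in> Noniso" "\<beta> \<in> Mor C" "Cod C \<beta> = Dom C \<gamma>"
  shows "\<gamma> \<bullet> \<beta> \<in> Noniso"
proof (cases "\<beta> \<in> Noniso")
  case True
  then show ?thesis using Comp_Noniso_right assms by (auto simp: Noniso_def)
next
  case False
  then show ?thesis using assms Comp_Mor[of \<gamma> \<beta>] by (auto simp: Noniso_def)
qed

lemma inverse_Mor:
  assumes "\<alpha> \<in> Mor C" "Dom C \<alpha> = Cod C \<alpha>"
  obtains \<beta> where "\<beta> \<in> Mor C" "Dom C \<beta> = Cod C \<alpha>" "Cod C \<beta> = Dom C \<alpha>"
    "\<beta> \<bullet> \<alpha> = Ident C (Dom C \<alpha>)" "\<alpha> \<bullet> \<beta> = Ident C (Cod C \<alpha>)"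
  using assms iso_mor_iff[OF assms(1)] by (auto simp: iso_mor_def Hom_def)

lemma carrier_Aut: "x \<in> Ob C \<Longrightarrow> carrier (Aut C x) = Hom C x x"
  using EI by (auto simp: Aut_def)

text \<open>The existence of a morphism is a partial order on the objects, because a composite that
  involves a non-isomorphism is never an endomorphism. Its height function supports induction
  along non-isomorphisms.\<close>

definition height :: "'a \<Rightarrow> nat" where
  "height y = card {x \<in> Ob C. Hom C x y \<noteq> {}}"

lemma finite_Ob: "finite (Ob C)"
proof (rule inj_on_finite[of "Ident C" _ "Mor C"])
  show "inj_on (Ident C) (Ob C)" using Ident_Mor by (metis inj_onI)
qed (use Ident_Mor finite_Mor in auto)

lemma height_less:
  assumes "\<alpha> \<in> Noniso"
  shows "height (Dom C \<alpha>) < height (Cod C \<alpha>)"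
  unfolding height_def
proof (rule psubset_card_mono)
  have a: "\<alpha> \<in> Hom C (Dom C \<alpha>) (Cod C \<alpha>)" using assms by (auto simp: Noniso_def Hom_def)
  have "Cod C \<alpha> \<in> Ob C" using assms Cod_closed NonisoD by blast
  moreover have "Hom C (Cod C \<alpha>) (Dom C \<alpha>) = {}"
  proof (rule ccontr)
    assume "Hom C (Cod C \<alpha>) (Dom C \<alpha>) \<noteq> {}"
    then obtain \<beta> where b: "\<beta> \<in> Mor C" "Dom C \<beta> = Cod C \<alpha>" "Cod C \<beta> = Dom C \<alpha>"
      by (auto simp: Hom_def)
    then have "\<beta> \<bullet> \<alpha> \<in> Noniso" using Comp_Noniso_right assms by auto
    then show False using Comp_Mor[of \<beta> \<alpha>] b assms by (auto simp: Noniso_def)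
  qed
  moreover have "Hom C (Cod C \<alpha>) (Cod C \<alpha>) \<noteq> {}"
    using Ident_Hom \<open>Cod C \<alpha> \<in> Ob C\<close> by auto
  moreover have "Hom C x (Cod C \<alpha>) \<noteq> {}" if "Hom C x (Dom C \<alpha>) \<noteq> {}" for x
    using that Comp_Hom[OF _ a] by blast
  ultimately show "{x \<in> Ob C. Hom C x (Dom C \<alpha>) \<noteq> {}} \<subset> {x \<in> Ob C. Hom C x (Cod C \<alpha>) \<noteq> {}}"
    by blast
qed (use finite_Ob in simp)

section \<open>Factorizations with an unfactorizable first morphism\<close>

lemma unfactorizable_iff:
  "unfactorizable C \<alpha> \<longleftrightarrow> \<alpha> \<in> Noniso \<and>
    (\<forall>\<beta> \<in> Noniso. \<forall>\<gamma> \<in> Noniso. Cod C \<beta> = Dom C \<gamma> \<longrightarrow> \<alpha> \<noteq> \<gamma> \<bullet> \<beta>)"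
  unfolding unfactorizable_def Ball_def Noniso_iff by blast

lemma unfactorizable_Noniso: "unfactorizable C \<alpha> \<Longrightarrow> \<alpha> \<in> Noniso"
  by (simp add: unfactorizable_iff)

lemma unfactorizable_Comp_iso:
  assumes u: "unfactorizable C u" and h: "h \<in> Mor C" "Dom C h = Cod C h"
  shows "Cod C u = Dom C h \<Longrightarrow> unfactorizable C (h \<bullet> u)"
    and "Cod C h = Dom C u \<Longrightarrow> unfactorizable C (u \<bullet> h)"
proof -
  have uN: "u \<in> Noniso" "u \<in> Mor C" using u by (auto simp: unfactorizable_iff Noniso_def)
  obtain h' where h': "h' \<in> Mor C" "Dom C h' = Cod C h" "Cod C h' = Dom C h"
    "h' \<bullet> h = Ident C (Dom C h)" "h \<bullet> h' = Ident C (Cod C h)"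
    using inverse_Mor h by blast
  {
    assume c: "Cod C u = Dom C h"
    have hu: "h \<bullet> u \<in> Noniso" using Comp_Noniso_right h uN c by blast
    have "h \<bullet> u \<noteq> \<gamma> \<bullet> \<beta>" if bg: "\<beta> \<in> Noniso" "\<gamma> \<in> Noniso" "Cod C \<beta> = Dom C \<gamma>" for \<beta> \<gamma>
    proof
      assume eq: "h \<bullet> u = \<gamma> \<bullet> \<beta>"
      have M: "\<beta> \<in> Mor C" "\<gamma> \<in> Mor C" using bg by (auto simp: Noniso_def)
      have cod: "Cod C \<gamma> = Cod C h" using eq Comp_Mor[of \<gamma> \<beta>] Comp_Mor[of h u] M bg h uN c by simp
      have "u = h' \<bullet> h \<bullet> u"
        using Comp_Mor_assoc[of h' h u] Ident_Comp[OF uN(2)] h h' uN c by simp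
      also have "\<dots> = (h' \<bullet> \<gamma>) \<bullet> \<beta>"
        unfolding eq using Comp_Mor_assoc[of h' \<gamma> \<beta>] M bg h' cod by simp
      finally have "u = (h' \<bullet> \<gamma>) \<bullet> \<beta>" .
      moreover have "h' \<bullet> \<gamma> \<in> Noniso" using Comp_Noniso_right bg h' cod by simp
      moreover have "Cod C \<beta> = Dom C (h' \<bullet> \<gamma>)" using Comp_Mor[of h' \<gamma>] M h' cod bg by simp
      ultimately show False using u bg unfolding unfactorizable_iff by blast
    qed
    then show "unfactorizable C (h \<bullet> u)" using hu by (simp add: unfactorizable_iff)
  next
    assume c: "Cod C h = Dom C u"
    have uh: "u \<bullet> h \<in> Noniso" using Comp_Noniso_left h uN c by blast
    have "u \<bullet> h \<noteq> \<gamma> \<bullet> \<beta>" if bg: "\<beta> \<in> Noniso" "\<gamma> \<in> Noniso" "Cod C \<beta> = Dom C \<gamma>" for \<beta> \<gamma>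
    proof
      assume eq: "u \<bullet> h = \<gamma> \<bullet> \<beta>"
      have M: "\<beta> \<in> Mor C" "\<gamma> \<in> Mor C" using bg by (auto simp: Noniso_def)
      have dom: "Dom C \<beta> = Dom C h" using eq Comp_Mor[of \<gamma> \<beta>] Comp_Mor[of u h] M bg h uN c by simp
      have "u = (u \<bullet> h) \<bullet> h'"
        using Comp_Mor_assoc[of u h h'] Comp_Ident[OF uN(2)] h h' uN c by simp
      also have "\<dots> = \<gamma> \<bullet> \<beta> \<bullet> h'"
        unfolding eq using Comp_Mor_assoc[of \<gamma> \<beta> h'] M bg h' dom by simp
      finally have "u = \<gamma> \<bullet> \<beta> \<bullet> h'" .
      moreover have "\<beta> \<bullet> h' \<in> Noniso" using Comp_Noniso_left bg h' dom by simp
      moreover have "Cod C (\<beta> \<bullet> h') = Dom C \<gamma>" using Comp_Mor[of \<beta> h'] M h' dom bg by simp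
      ultimately show False using u bg unfolding unfactorizable_iff by blast
    qed
    then show "unfactorizable C (u \<bullet> h)" using uh by (simp add: unfactorizable_iff)
  }
qed

definition initial_factorization :: "'b \<Rightarrow> 'b \<Rightarrow> 'b \<Rightarrow> bool" where
  "initial_factorization \<alpha> \<gamma> u \<longleftrightarrow>
    \<gamma> \<in> Mor C \<and> unfactorizable C u \<and> Cod C u = Dom C \<gamma> \<and> \<gamma> \<bullet> u = \<alpha>"

lemma initial_factorizationD:
  assumes "initial_factorization \<alpha> \<gamma> u"
  shows "\<gamma> \<in> Mor C" "u \<in> Mor C" "u \<in> Noniso" "unfactorizable C u" "Cod C u = Dom C \<gamma>" "\<gamma> \<bullet> u = \<alpha>"
    "\<alpha> \<in> Noniso" "\<alpha> \<in> Mor C" "Dom C \<alpha> = Dom C u" "Cod C \<alpha> = Cod C \<gamma>"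
  using assms Comp_Mor[of \<gamma> u] Comp_Noniso_right[of \<gamma> u]
  by (auto simp: initial_factorization_def dest: unfactorizable_Noniso NonisoD)

lemma initial_factorization_unfactorizable:
  assumes "unfactorizable C u"
  shows "initial_factorization u (Ident C (Cod C u)) u"
  using assms NonisoD[OF unfactorizable_Noniso] Ident_Mor Cod_closed Ident_Comp
  by (auto simp: initial_factorization_def)

lemma initial_factorization_Comp:
  assumes "initial_factorization \<alpha> \<gamma> u" "\<beta> \<in> Mor C" "Cod C \<alpha> = Dom C \<beta>"
  shows "initial_factorization (\<beta> \<bullet> \<alpha>) (\<beta> \<bullet> \<gamma>) u"
  using initial_factorizationD[OF assms(1)] assms(2,3) Comp_Mor[of \<beta> \<gamma>] Comp_Mor_assoc[of \<beta> \<gamma> u]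
  by (auto simp: initial_factorization_def)

lemma initial_factorization_exists:
  assumes "\<alpha> \<in> Noniso"
  shows "\<exists>\<gamma> u. initial_factorization \<alpha> \<gamma> u"
  using assms
proof (induction "height (Cod C \<alpha>)" arbitrary: \<alpha> rule: less_induct)
  case less
  show ?case
  proof (cases "unfactorizable C \<alpha>")
    case True
    then show ?thesis using initial_factorization_unfactorizable by blast
  next
    case False
    then obtain \<beta> \<gamma> where bg: "\<beta> \<in> Noniso" "\<gamma> \<in> Noniso" "Cod C \<beta> = Dom C \<gamma>" "\<alpha> = \<gamma> \<bullet> \<beta>"
      using less.prems by (auto simp: unfactorizable_iff)
    then have "Cod C \<alpha> = Cod C \<gamma>" using Comp_Mor NonisoD by auto
    then have "height (Cod C \<beta>) < height (Cod C \<alpha>)" using height_less bg by simp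
    then obtain \<gamma>' u where "initial_factorization \<beta> \<gamma>' u" using less.hyps bg by blast
    then show ?thesis using initial_factorization_Comp bg NonisoD by blast
  qed
qed

text \<open>The relation between two factorizations that differ only by an isomorphism inserted between
  the two factors. For fixed objects \<open>w, x, y\<close> its classes form the set
  \<open>Hom(x, y) \<times>\<^bsub>Aut(x)\<^esub> U(w, x)\<close> of balanced pairs, where \<open>U(w, x)\<close> is the set of unfactorizable
  morphisms from \<open>w\<close> to \<open>x\<close>.\<close>

definition equivalent_factors :: "'b \<Rightarrow> 'b \<Rightarrow> 'b \<Rightarrow> 'b \<Rightarrow> bool" where
  "equivalent_factors \<gamma> u \<gamma>' u' \<longleftrightarrow>
    (\<exists>h \<in> Mor C. Dom C h = Cod C u \<and> Cod C h = Cod C u \<and> Dom C \<gamma>' = Cod C u \<and> u' = h \<bullet> u \<and> \<gamma> = \<gamma>' \<bullet> h)"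

lemma equivalent_factors_refl:
  assumes "initial_factorization \<alpha> \<gamma> u"
  shows "equivalent_factors \<gamma> u \<gamma> u"
  unfolding equivalent_factors_def
  using initial_factorizationD[OF assms] Ident_Mor[of "Cod C u"] Cod_closed[of u] Ident_Comp[of u] Comp_Ident[of \<gamma>]
  by (intro bexI[of _ "Ident C (Cod C u)"]) auto

lemma equivalent_factors_sym:
  assumes "initial_factorization \<alpha> \<gamma> u" "initial_factorization \<alpha>' \<gamma>' u'" "equivalent_factors \<gamma> u \<gamma>' u'"
  shows "equivalent_factors \<gamma>' u' \<gamma> u"
proof -
  obtain h where h: "h \<in> Mor C" "Dom C h = Cod C u" "Cod C h = Cod C u" "u' = h \<bullet> u" "\<gamma> = \<gamma>' \<bullet> h"
    using assms(3) by (auto simp: equivalent_factors_def)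
  then obtain h' where h': "h' \<in> Mor C" "Dom C h' = Cod C u" "Cod C h' = Cod C u"
    "h' \<bullet> h = Ident C (Cod C u)" "h \<bullet> h' = Ident C (Cod C u)"
    using inverse_Mor[of h] by auto
  note f = initial_factorizationD[OF assms(1)] initial_factorizationD[OF assms(2)]
  have c: "Cod C u' = Cod C u" using h f Comp_Mor[of h u] by simp
  have "u = h' \<bullet> u'" unfolding h(4) using Comp_Mor_assoc[of h' h u] h h' f Ident_Comp[of u] by simp
  moreover have "\<gamma>' = \<gamma> \<bullet> h'"
    unfolding h(5) using Comp_Mor_assoc[of \<gamma>' h h'] h h' f c Comp_Ident[of \<gamma>'] by simp
  ultimately show ?thesis unfolding equivalent_factors_def using h' f c by auto
qed

lemma equivalent_factors_trans:
  assumes "initial_factorization \<alpha> \<gamma> u" "initial_factorization \<alpha>'' \<gamma>'' u''"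
    "equivalent_factors \<gamma> u \<gamma>' u'" "equivalent_factors \<gamma>' u' \<gamma>'' u''"
  shows "equivalent_factors \<gamma> u \<gamma>'' u''"
proof -
  note f = initial_factorizationD[OF assms(1)] initial_factorizationD[OF assms(2)]
  obtain h where h: "h \<in> Mor C" "Dom C h = Cod C u" "Cod C h = Cod C u" "u' = h \<bullet> u" "\<gamma> = \<gamma>' \<bullet> h"
    using assms(3) by (auto simp: equivalent_factors_def)
  then have c: "Cod C u' = Cod C u" using f Comp_Mor[of h u] by simp
  obtain g where g: "g \<in> Mor C" "Dom C g = Cod C u" "Cod C g = Cod C u" "u'' = g \<bullet> u'" "\<gamma>' = \<gamma>'' \<bullet> g"
    "Dom C \<gamma>'' = Cod C u"
    using assms(4) unfolding equivalent_factors_def c by blast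
  have gh: "g \<bullet> h \<in> Mor C" "Dom C (g \<bullet> h) = Cod C u" "Cod C (g \<bullet> h) = Cod C u"
    using Comp_Mor[of g h] g(1-3) h(1-3) by simp_all
  have "u'' = (g \<bullet> h) \<bullet> u"
    by (simp only: g(4) h(4)) (rule Comp_Mor_assoc[symmetric], use g(1-3) h(1-3) f(2) in simp_all)
  moreover have "\<gamma> = \<gamma>'' \<bullet> g \<bullet> h"
    by (simp only: h(5) g(5)) (rule Comp_Mor_assoc, use g(1-3,6) h(1-3) f(11) in simp_all)
  ultimately show ?thesis unfolding equivalent_factors_def using gh g(6) by blast
qed

lemma equivalent_factors_Comp:
  assumes "initial_factorization \<alpha> \<gamma> u" "initial_factorization \<alpha>' \<gamma>' u'" "equivalent_factors \<gamma> u \<gamma>' u'"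
    "\<beta> \<in> Mor C" "Cod C \<alpha> = Dom C \<beta>"
  shows "equivalent_factors (\<beta> \<bullet> \<gamma>) u (\<beta> \<bullet> \<gamma>') u'"
proof -
  note f = initial_factorizationD[OF assms(1)] initial_factorizationD[OF assms(2)]
  obtain h where h: "h \<in> Mor C" "Dom C h = Cod C u" "Cod C h = Cod C u" "u' = h \<bullet> u" "\<gamma> = \<gamma>' \<bullet> h"
    "Dom C \<gamma>' = Cod C u"
    using assms(3) by (auto simp: equivalent_factors_def)
  have g'M: "\<gamma>' \<in> Mor C" by (rule f(11))
  have "Cod C \<gamma>' = Dom C \<beta>"
    using Comp_Mor(3)[OF g'M h(1)] h(3,6) assms(5) f(10) unfolding h(5) by simp
  then have "Dom C (\<beta> \<bullet> \<gamma>') = Cod C u" "\<beta> \<bullet> \<gamma> = (\<beta> \<bullet> \<gamma>') \<bullet> h"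
    using Comp_Mor(2)[OF assms(4) g'M] Comp_Mor_assoc[OF assms(4) g'M h(1)] h(3,6) unfolding h(5) by simp_all
  then show ?thesis unfolding equivalent_factors_def using h(1-4) by blast
qed

definition unique_initial_factorization :: bool where
  "unique_initial_factorization \<longleftrightarrow> (\<forall>\<alpha> \<gamma> u \<gamma>' u'.
    initial_factorization \<alpha> \<gamma> u \<and> initial_factorization \<alpha> \<gamma>' u' \<longrightarrow> equivalent_factors \<gamma> u \<gamma>' u')"

text \<open>If the second factor is an isomorphism, then the composite is itself unfactorizable, so every
  other factorization is of the same kind.\<close>

lemma initial_factorization_iso:
  assumes "initial_factorization \<alpha> \<gamma> u" "initial_factorization \<alpha> \<gamma>' u'" "\<gamma> \<notin> Noniso"
  shows "\<gamma>' \<notin> Noniso" "equivalent_factors \<gamma> u \<gamma>' u'"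
proof -
  note f = initial_factorizationD[OF assms(1)]
  note f' = initial_factorizationD[OF assms(2)]
  have g: "Dom C \<gamma> = Cod C \<gamma>" using assms f by (auto simp: Noniso_def)
  have "unfactorizable C \<alpha>" using unfactorizable_Comp_iso(1)[of u \<gamma>] f g by auto
  then show g'N: "\<gamma>' \<notin> Noniso" using f' unfolding unfactorizable_iff by metis
  then have g': "Dom C \<gamma>' = Cod C \<gamma>'" using f' by (auto simp: Noniso_def)
  then obtain d where d: "d \<in> Mor C" "Dom C d = Cod C \<gamma>'" "Cod C d = Cod C \<gamma>'"
    "d \<bullet> \<gamma>' = Ident C (Cod C \<gamma>')" "\<gamma>' \<bullet> d = Ident C (Cod C \<gamma>')"
    using inverse_Mor[of \<gamma>'] f' by metis
  have c: "Cod C \<gamma> = Cod C \<gamma>'" using f f' by simp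
  have "u' = d \<bullet> \<gamma>' \<bullet> u'" using Comp_Mor_assoc[of d \<gamma>' u'] d f' g' Ident_Comp[of u'] by simp
  also have "\<dots> = (d \<bullet> \<gamma>) \<bullet> u" using Comp_Mor_assoc[of d \<gamma> u] d f f' c by simp
  finally have 1: "u' = (d \<bullet> \<gamma>) \<bullet> u" .
  have 2: "\<gamma> = \<gamma>' \<bullet> d \<bullet> \<gamma>" using Comp_Mor_assoc[of \<gamma>' d \<gamma>] d f f' c g' Ident_Comp[of \<gamma>] by simp
  show "equivalent_factors \<gamma> u \<gamma>' u'"
    unfolding equivalent_factors_def
    by (rule bexI[of _ "d \<bullet> \<gamma>"]) (use 1 2 Comp_Mor[of d \<gamma>] d f f' c g g' in auto)
qed

section \<open>Chains of unfactorizable morphisms\<close>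

text \<open>A recursive form of decompositions into unfactorizable morphisms, suited to list
  induction.\<close>

fun unfactorizable_chain :: "'b list \<Rightarrow> bool" where
  "unfactorizable_chain [] \<longleftrightarrow> False"
| "unfactorizable_chain [u] \<longleftrightarrow> unfactorizable C u"
| "unfactorizable_chain (u # v # us) \<longleftrightarrow>
    unfactorizable C u \<and> Cod C u = Dom C v \<and> unfactorizable_chain (v # us)"

lemma unfactorizable_chain_iff:
  "unfactorizable_chain us \<longleftrightarrow> us \<noteq> [] \<and> (\<forall>i < length us. unfactorizable C (us ! i)) \<and>
    (\<forall>i. Suc i < length us \<longrightarrow> Cod C (us ! i) = Dom C (us ! Suc i))"
proof (induction us rule: unfactorizable_chain.induct)
  case (3 u v us)
  then show ?case by (auto simp: All_less_Suc2 nth_Cons split: nat.splits)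
qed auto

lemma unfactorizable_decomposition_iff:
  "unfactorizable_decomposition C \<alpha> us \<longleftrightarrow> unfactorizable_chain us \<and> chain_composite C us = \<alpha>"
  by (auto simp: unfactorizable_chain_iff unfactorizable_decomposition_def)

lemma unfactorizable_chain_composite:
  assumes "unfactorizable_chain us"
  shows "chain_composite C us \<in> Noniso" "Dom C (chain_composite C us) = Dom C (hd us)"
    "Cod C (chain_composite C us) = Cod C (last us)"
proof -
  have "chain_composite C us \<in> Noniso \<and> Dom C (chain_composite C us) = Dom C (hd us) \<and>
    Cod C (chain_composite C us) = Cod C (last us)"
    using assms
  proof (induction us rule: unfactorizable_chain.induct)
    case (3 u v us)
    then show ?case
      using Comp_Mor[of "chain_composite C (v # us)" u] NonisoD[OF unfactorizable_Noniso[of u]]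
        NonisoD[of "chain_composite C (v # us)"] Comp_Noniso_left[of "chain_composite C (v # us)" u]
      by auto
  qed (auto simp: unfactorizable_Noniso)
  then show "chain_composite C us \<in> Noniso" "Dom C (chain_composite C us) = Dom C (hd us)"
    "Cod C (chain_composite C us) = Cod C (last us)" by auto
qed

lemma unfactorizable_chain_Cons:
  assumes "unfactorizable_chain us" "unfactorizable C u" "Cod C u = Dom C (hd us)"
  shows "unfactorizable_chain (u # us)" "chain_composite C (u # us) = chain_composite C us \<bullet> u"
    "initial_factorization (chain_composite C (u # us)) (chain_composite C us) u"
  using assms unfactorizable_chain_composite[OF assms(1)] NonisoD[of "chain_composite C us"]
  by (cases us; auto simp: initial_factorization_def)+

lemma unfactorizable_chain_exists:
  assumes "\<alpha> \<in> Noniso"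
  shows "\<exists>us. unfactorizable_chain us \<and> chain_composite C us = \<alpha>"
  using assms
proof (induction "height (Cod C \<alpha>) - height (Dom C \<alpha>)" arbitrary: \<alpha> rule: less_induct)
  case less
  obtain \<gamma> u where f: "initial_factorization \<alpha> \<gamma> u" using initial_factorization_exists less.prems by blast
  note f = f initial_factorizationD[OF f]
  show ?case
  proof (cases "\<gamma> \<in> Noniso")
    case True
    then have "height (Cod C \<gamma>) - height (Dom C \<gamma>) < height (Cod C \<alpha>) - height (Dom C \<alpha>)"
      using height_less[of \<gamma>] height_less[of u] f by simp
    then obtain us where us: "unfactorizable_chain us" "chain_composite C us = \<gamma>" using less.hyps True by blast
    then have "unfactorizable_chain (u # us) \<and> chain_composite C (u # us) = \<alpha>"
      using unfactorizable_chain_Cons[of us u] unfactorizable_chain_composite(2)[of us] f by auto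
    then show ?thesis by blast
  next
    case False
    then have "unfactorizable C \<alpha>" using unfactorizable_Comp_iso(1)[of u \<gamma>] f by (auto simp: Noniso_def)
    then have "unfactorizable_chain [\<alpha>] \<and> chain_composite C [\<alpha>] = \<alpha>" by simp
    then show ?thesis by blast
  qed
qed

lemma inv_Aut_Comp:
  assumes "h \<in> carrier (Aut C x)" "x \<in> Ob C"
  shows "inv\<^bsub>Aut C x\<^esub> h \<in> Mor C" "Dom C (inv\<^bsub>Aut C x\<^esub> h) = x" "Cod C (inv\<^bsub>Aut C x\<^esub> h) = x"
    "inv\<^bsub>Aut C x\<^esub> h \<bullet> h = Ident C x" "h \<bullet> inv\<^bsub>Aut C x\<^esub> h = Ident C x"
proof -
  interpret group "Aut C x" using Aut_group assms by blast
  have "inv\<^bsub>Aut C x\<^esub> h \<in> Hom C x x" using inv_closed[OF assms(1)] carrier_Aut assms by blast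
  then show "inv\<^bsub>Aut C x\<^esub> h \<in> Mor C" "Dom C (inv\<^bsub>Aut C x\<^esub> h) = x" "Cod C (inv\<^bsub>Aut C x\<^esub> h) = x"
    by (auto simp: Hom_def)
  show "inv\<^bsub>Aut C x\<^esub> h \<bullet> h = Ident C x" "h \<bullet> inv\<^bsub>Aut C x\<^esub> h = Ident C x"
    using l_inv[OF assms(1)] r_inv[OF assms(1)] by (simp_all add: Aut_def)
qed

text \<open>The isomorphisms between two chains through the same objects, as a commutative ladder. Without
  inverses of the \<open>h i\<close>, ladders are easily composed and decomposed.\<close>

definition ladder :: "(nat \<Rightarrow> 'b) \<Rightarrow> 'b list \<Rightarrow> 'b list \<Rightarrow> bool" where
  "ladder h us vs \<longleftrightarrow> length us = length vs \<and>
    (\<forall>i \<le> length us. chain_object C us i = chain_object C vs i \<and>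
      h i \<in> Hom C (chain_object C us i) (chain_object C us i)) \<and>
    (\<forall>i < length us. vs ! i \<bullet> h i = h (Suc i) \<bullet> us ! i)"

lemma unfactorizable_chain_Mor:
  assumes "unfactorizable_chain us" "i < length us"
  shows "us ! i \<in> Mor C" "Dom C (us ! i) = chain_object C us i" "Cod C (us ! i) = chain_object C us (Suc i)"
  using assms unfactorizable_chain_iff[of us] NonisoD(1)[OF unfactorizable_Noniso]
  by (auto simp: chain_object_def gr0_conv_Suc)

lemma chain_object_Ob:
  assumes "unfactorizable_chain us" "i \<le> length us"
  shows "chain_object C us i \<in> Ob C"
proof (cases "i < length us")
  case True
  then show ?thesis using unfactorizable_chain_Mor[OF assms(1) True] Dom_closed by metis
next
  case False
  moreover have "us \<noteq> []" using assms unfactorizable_chain_iff by blast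
  ultimately obtain j where "i = Suc j" "j < length us" using assms by (cases i) auto
  then show ?thesis using unfactorizable_chain_Mor(1,3)[OF assms(1), of j] Cod_closed by metis
qed

lemma Comp_inv_eq_iff:
  assumes "h \<in> carrier (Aut C x)" "x \<in> Ob C" "\<alpha> \<in> Mor C" "Dom C \<alpha> = x" "\<beta> \<in> Mor C" "Dom C \<beta> = x"
    and "g \<in> Mor C" "Dom C g = Cod C \<alpha>"
  shows "\<beta> = g \<bullet> \<alpha> \<bullet> inv\<^bsub>Aut C x\<^esub> h \<longleftrightarrow> \<beta> \<bullet> h = g \<bullet> \<alpha>"
proof -
  let ?k = "inv\<^bsub>Aut C x\<^esub> h"
  note k = inv_Aut_Comp[OF assms(1,2)]
  have h: "h \<in> Mor C" "Dom C h = x" "Cod C h = x" using assms carrier_Aut by (auto simp: Hom_def)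
  have ga: "g \<bullet> \<alpha> \<in> Mor C" "Dom C (g \<bullet> \<alpha>) = x" using Comp_Mor[of g \<alpha>] assms by auto
  have e: "g \<bullet> \<alpha> \<bullet> ?k = (g \<bullet> \<alpha>) \<bullet> ?k" using Comp_Mor_assoc[of g \<alpha> ?k] k(1-3) assms by simp
  have 1: "((g \<bullet> \<alpha>) \<bullet> ?k) \<bullet> h = g \<bullet> \<alpha>"
    using Comp_Mor_assoc[OF ga(1) k(1) h(1)] k ga h Comp_Ident[OF ga(1)] by simp
  have 2: "(\<beta> \<bullet> h) \<bullet> ?k = \<beta>"
    using Comp_Mor_assoc[OF assms(5) h(1) k(1)] k h assms(6) Comp_Ident[OF assms(5)] by simp
  show ?thesis unfolding e using 1 2 by metis
qed

text \<open>In the Unique Factorization Property membership of \<open>h i\<close> in the automorphism group is demanded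
  only at the inner objects. At the two ends \<open>h\<close> is an identity, so a full ladder results; and
  \<open>h i\<close> is invertible because every endomorphism is.\<close>

lemma free_EI_iff:
  "free_EI C \<longleftrightarrow> (\<forall>us vs. unfactorizable_chain us \<and> unfactorizable_chain vs \<and>
      chain_composite C us = chain_composite C vs \<longrightarrow>
    (\<exists>h. h 0 = Ident C (chain_object C us 0) \<and> h (length us) = Ident C (chain_object C us (length us)) \<and>
      ladder h us vs))"
    (is "_ = (\<forall>us vs. ?prem us vs \<longrightarrow> (\<exists>h. ?L h us vs))")
proof -
  let ?U = "\<lambda>\<alpha> us vs. length us = length vs \<and>
      (\<forall>i \<le> length us. chain_object C us i = chain_object C vs i) \<and>
      (\<exists>h :: nat \<Rightarrow> 'b.
        h 0 = Ident C (Dom C \<alpha>) \<and> h (length us) = Ident C (Cod C \<alpha>) \<and>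
        (\<forall>i. 1 \<le> i \<and> i \<le> length us - 1 \<longrightarrow> h i \<in> carrier (Aut C (chain_object C us i))) \<and>
        (\<forall>i. 1 \<le> i \<and> i \<le> length us \<longrightarrow>
          vs ! (i - 1) = Comp C (h i) (Comp C (us ! (i - 1))
              (inv\<^bsub>Aut C (chain_object C us (i - 1))\<^esub> (h (i - 1))))))"
  have ends: "Dom C (chain_composite C us) = chain_object C us 0"
      "Cod C (chain_composite C us) = chain_object C us (length us)" if "unfactorizable_chain us" for us
    using unfactorizable_chain_composite[OF that] that
    by (cases us; auto simp: chain_object_def last_conv_nth)+
  have key: "?U (chain_composite C us) us vs \<longleftrightarrow> (\<exists>h. ?L h us vs)"
    if p: "?prem us vs" for us vs
  proof -
    have us: "unfactorizable_chain us" and vs: "unfactorizable_chain vs" using p by auto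
    have ob: "chain_object C us i \<in> Ob C" if "i \<le> length us" for i using chain_object_Ob[OF us that] .
    have step: "(\<forall>i. 1 \<le> i \<and> i \<le> length us \<longrightarrow>
          vs ! (i - 1) = Comp C (h i) (Comp C (us ! (i - 1))
              (inv\<^bsub>Aut C (chain_object C us (i - 1))\<^esub> (h (i - 1))))) \<longleftrightarrow>
        (\<forall>i < length us. vs ! i \<bullet> h i = h (Suc i) \<bullet> us ! i)"
      if len: "length us = length vs" and obj: "\<forall>i \<le> length us. chain_object C us i = chain_object C vs i"
        and h: "\<forall>i \<le> length us. h i \<in> Hom C (chain_object C us i) (chain_object C us i)" for h
    proof -
      have "(vs ! i = h (Suc i) \<bullet> us ! i \<bullet> inv\<^bsub>Aut C (chain_object C us i)\<^esub> (h i)) \<longleftrightarrow>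
          vs ! i \<bullet> h i = h (Suc i) \<bullet> us ! i" if i: "i < length us" for i
      proof (rule Comp_inv_eq_iff)
        have h': "h i \<in> Hom C (chain_object C us i) (chain_object C us i)"
          "h (Suc i) \<in> Hom C (chain_object C us (Suc i)) (chain_object C us (Suc i))"
          using h i by auto
        show "h i \<in> carrier (Aut C (chain_object C us i))" using h' carrier_Aut ob i by auto
        show "h (Suc i) \<in> Mor C" "Dom C (h (Suc i)) = Cod C (us ! i)"
          using h' unfactorizable_chain_Mor[OF us i] by (auto simp: Hom_def)
        show "vs ! i \<in> Mor C" "Dom C (vs ! i) = chain_object C us i"
          using unfactorizable_chain_Mor[OF vs, of i] len i obj by auto
      qed (use ob i unfactorizable_chain_Mor[OF us i] in auto)
      then show ?thesis
        by (auto simp: Suc_le_eq gr0_conv_Suc)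
    qed
    show ?thesis
    proof
      assume a: "?U (chain_composite C us) us vs"
      then obtain h where len: "length us = length vs" and obj: "\<forall>i \<le> length us. chain_object C us i = chain_object C vs i"
        and h: "h 0 = Ident C (Dom C (chain_composite C us))" "h (length us) = Ident C (Cod C (chain_composite C us))"
          "\<forall>i. 1 \<le> i \<and> i \<le> length us - 1 \<longrightarrow> h i \<in> carrier (Aut C (chain_object C us i))"
          "\<forall>i. 1 \<le> i \<and> i \<le> length us \<longrightarrow>
            vs ! (i - 1) = Comp C (h i) (Comp C (us ! (i - 1))
                (inv\<^bsub>Aut C (chain_object C us (i - 1))\<^esub> (h (i - 1))))" by blast
      have "h i \<in> Hom C (chain_object C us i) (chain_object C us i)" if i: "i \<le> length us" for i
      proof -
        consider "i = 0" | "i = length us" | "1 \<le> i" "i \<le> length us - 1" using i by linarith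
        then show ?thesis
        proof cases
          case 3
          then show ?thesis using h(3) carrier_Aut[OF ob[OF i]] by blast
        qed (use h(1,2) ends[OF us] Ident_Hom[OF ob[OF i]] in simp_all)
      qed
      then show "\<exists>h. ?L h us vs"
        using len obj h step[OF len obj, of h] ends[OF us] unfolding ladder_def by (intro exI[of _ h]) auto
    next
      assume "\<exists>h. ?L h us vs"
      then obtain h where h: "?L h us vs" by blast
      then have len: "length us = length vs" and obj: "\<forall>i \<le> length us. chain_object C us i = chain_object C vs i"
        and H: "\<forall>i \<le> length us. h i \<in> Hom C (chain_object C us i) (chain_object C us i)"
        by (auto simp: ladder_def)
      have "h i \<in> carrier (Aut C (chain_object C us i))" if "i \<le> length us" for i
        using H carrier_Aut[OF ob[OF that]] that by blast
      then show "?U (chain_composite C us) us vs"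
        using len obj h step[OF len obj H] ends[OF us] unfolding ladder_def
        by (intro conjI exI[of _ h]) auto
    qed
  qed
  show ?thesis
  proof
    assume free: "free_EI C"
    show "\<forall>us vs. ?prem us vs \<longrightarrow> (\<exists>h. ?L h us vs)"
    proof (intro allI impI)
      fix us vs
      assume p: "?prem us vs"
      let ?\<alpha> = "chain_composite C us"
      have "?\<alpha> \<in> Mor C \<and> \<not> iso_mor C ?\<alpha> \<and>
          unfactorizable_decomposition C ?\<alpha> us \<and> unfactorizable_decomposition C ?\<alpha> vs"
        using p unfactorizable_chain_composite(1)[of us] unfolding unfactorizable_decomposition_iff Noniso_iff by auto
      with free have "?U ?\<alpha> us vs" unfolding free_EI_def by (elim allE impE) assumption+
      then show "\<exists>h. ?L h us vs" unfolding key[OF p] .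
    qed
  next
    assume L: "\<forall>us vs. ?prem us vs \<longrightarrow> (\<exists>h. ?L h us vs)"
    show "free_EI C"
      unfolding free_EI_def
    proof (intro allI impI)
      fix \<alpha> us vs
      assume "\<alpha> \<in> Mor C \<and> \<not> iso_mor C \<alpha> \<and>
          unfactorizable_decomposition C \<alpha> us \<and> unfactorizable_decomposition C \<alpha> vs"
      then have p: "?prem us vs" and \<alpha>: "\<alpha> = chain_composite C us"
        unfolding unfactorizable_decomposition_iff by auto
      show "?U \<alpha> us vs" unfolding \<alpha> key[OF p] using L p by blast
    qed
  qed
qed

lemma ladder_Cons_iff:
  assumes "us \<noteq> []" "vs \<noteq> []" "Cod C u = Dom C (hd us)" "Cod C v = Dom C (hd vs)"
  shows "ladder h (u # us) (v # vs) \<longleftrightarrow> Dom C u = Dom C v \<and> h 0 \<in> Hom C (Dom C u) (Dom C u) \<and>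
    v \<bullet> h 0 = h 1 \<bullet> u \<and> ladder (\<lambda>i. h (Suc i)) us vs"
proof -
  have s: "chain_object C (u # us) (Suc i) = chain_object C us i" "chain_object C (v # vs) (Suc i) = chain_object C vs i" for i
    using assms by (auto simp: chain_object_def hd_conv_nth nth_Cons')
  have z: "chain_object C (u # us) 0 = Dom C u" "chain_object C (v # vs) 0 = Dom C v"
    by (simp_all add: chain_object_def)
  have all: "(\<forall>i \<le> Suc n. P i) \<longleftrightarrow> P 0 \<and> (\<forall>i \<le> n. P (Suc i))" for P n
    using All_less_Suc2[of "Suc n" P] by (simp add: less_Suc_eq_le)
  show ?thesis
    unfolding ladder_def list.size(4) add_0_right add_Suc_right all All_less_Suc2 s z by auto
qed

lemma ladder_composite:
  assumes "unfactorizable_chain us" "unfactorizable_chain vs" "ladder h us vs"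
  shows "chain_composite C vs \<bullet> h 0 = h (length us) \<bullet> chain_composite C us"
  using assms
proof (induction us arbitrary: vs h rule: unfactorizable_chain.induct)
  case (2 u)
  then have "length vs = Suc 0" by (simp add: ladder_def)
  then obtain v where "vs = [v]" by (auto simp: length_Suc_conv)
  then show ?case using 2 by (auto simp: ladder_def)
next
  case (3 u u' us)
  have "length vs = Suc (Suc (length us))" using 3(4) by (simp add: ladder_def)
  then obtain v v' vs' where vs: "vs = v # v' # vs'" by (auto simp: length_Suc_conv)
  let ?us = "u' # us" and ?vs = "v' # vs'"
  have chains: "unfactorizable_chain ?us" "unfactorizable_chain ?vs" "unfactorizable C u" "unfactorizable C v"
      "Cod C u = Dom C u'" "Cod C v = Dom C v'"
    using 3(2,3) vs by auto
  have L: "Dom C u = Dom C v" "h 0 \<in> Hom C (Dom C u) (Dom C u)" "v \<bullet> h 0 = h 1 \<bullet> u"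
      "ladder (\<lambda>i. h (Suc i)) ?us ?vs"
    using 3(4) ladder_Cons_iff[of ?us ?vs u v h] vs chains by auto
  have IH: "chain_composite C ?vs \<bullet> h 1 = h (Suc (length ?us)) \<bullet> chain_composite C ?us"
    using 3(1)[OF chains(1,2) L(4)] by simp
  have M: "u \<in> Mor C" "v \<in> Mor C" "h 0 \<in> Mor C" "Cod C (h 0) = Dom C v"
    using chains L NonisoD unfactorizable_Noniso by (auto simp: Hom_def)
  have cu: "chain_composite C ?us \<in> Mor C" "Dom C (chain_composite C ?us) = Cod C u"
    and cv: "chain_composite C ?vs \<in> Mor C" "Dom C (chain_composite C ?vs) = Cod C v"
    using unfactorizable_chain_composite[OF chains(1)] unfactorizable_chain_composite[OF chains(2)] chains NonisoD(1)
    by auto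
  have hom: "h (Suc i) \<in> Hom C (chain_object C ?us i) (chain_object C ?us i)" "chain_object C ?us i = chain_object C ?vs i"
    if "i \<le> length ?us" for i
    using L(4) that unfolding ladder_def by auto
  have h1: "h 1 \<in> Mor C" "Dom C (h 1) = Cod C u" "Cod C (h 1) = Cod C u" "Cod C u = Cod C v"
    using hom[of 0] chains by (auto simp: Hom_def chain_object_def)
  have hn: "h (Suc (length ?us)) \<in> Mor C" "Dom C (h (Suc (length ?us))) = Cod C (chain_composite C ?us)"
    using hom[of "length ?us"] unfactorizable_chain_composite(3)[OF chains(1)]
    by (auto simp: Hom_def chain_object_def last_conv_nth)
  have "chain_composite C vs \<bullet> h 0 = chain_composite C ?vs \<bullet> v \<bullet> h 0"
    unfolding vs using Comp_Mor_assoc[OF cv(1) M(2,3)] cv M by simp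
  also have "\<dots> = (chain_composite C ?vs \<bullet> h 1) \<bullet> u"
    unfolding L(3) by (rule Comp_Mor_assoc[symmetric]) (use cv h1 M in auto)
  also have "\<dots> = h (Suc (length ?us)) \<bullet> chain_composite C ?us \<bullet> u"
    unfolding IH by (rule Comp_Mor_assoc) (use hn cu M in auto)
  finally show ?case by simp
qed simp

text \<open>Moving an automorphism \<open>g\<close> from the first morphism \<open>v \<bullet> g\<close> of the lower chain into the first rung,
  where there was an identity.\<close>

lemma ladder_change_initial:
  assumes "ladder h (u # us) ((v \<bullet> g) # vs)" "h 0 = Ident C (Dom C u)" "v \<in> Mor C"
    "g \<in> Mor C" "Dom C g = Dom C u" "Cod C g = Dom C u" "Dom C v = Dom C u"
  shows "ladder (h(0 := g)) (u # us) (v # vs)"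
proof -
  have vg: "v \<bullet> g \<in> Mor C" "Dom C (v \<bullet> g) = Dom C u" "Cod C (v \<bullet> g) = Cod C v"
    using Comp_Mor[of v g] assms by auto
  then have obj: "chain_object C ((v \<bullet> g) # vs) i = chain_object C (v # vs) i" for i
    using assms(7) by (auto simp: chain_object_def nth_Cons')
  have "v \<bullet> g = h 1 \<bullet> u"
    using assms(1,2) Comp_Ident[OF vg(1)] vg by (auto simp: ladder_def)
  then show ?thesis
    using assms(1,4,5,6) unfolding ladder_def obj
    by (auto simp: nth_Cons' chain_object_def Hom_def)
qed

lemma unfactorizable_chain_single:
  assumes "unfactorizable_chain us" "unfactorizable C (chain_composite C us)"
  shows "us = [chain_composite C us]"
proof (cases us rule: unfactorizable_chain.cases)
  case (3 u v us')
  then have c: "unfactorizable_chain (v # us')" "unfactorizable C u" "Cod C u = Dom C (hd (v # us'))"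
    using assms by auto
  from unfactorizable_chain_Cons(3)[OF c] have f: "initial_factorization (chain_composite C us) (chain_composite C (v # us')) u"
    unfolding 3 .
  from assms(2) have "chain_composite C (v # us') \<notin> Noniso"
    using initial_factorizationD(3,5,6)[OF f] unfolding unfactorizable_iff by metis
  then show ?thesis using unfactorizable_chain_composite(1)[OF c(1)] by blast
qed (use assms in auto)

text \<open>The induction removes the first morphisms \<open>u\<close> and \<open>v\<close>. Uniqueness gives \<open>g\<close> with \<open>v = g \<bullet> u\<close>, but
  the remaining composites differ by \<open>g\<close>. Composing the second morphism of the lower chain with \<open>g\<close>
  makes them equal; the ladder that the induction hypothesis supplies is corrected afterwards.\<close>

lemma ladder_if_unique_initial_factorization:
  assumes unique: unique_initial_factorization
    and "unfactorizable_chain us" "unfactorizable_chain vs" "chain_composite C us = chain_composite C vs"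
  shows "\<exists>h. h 0 = Ident C (chain_object C us 0) \<and> h (length us) = Ident C (chain_object C us (length us)) \<and>
    ladder h us vs"
  using assms(2-)
proof (induction us arbitrary: vs rule: unfactorizable_chain.induct)
  case (2 u)
  then have "vs = [u]" using unfactorizable_chain_single[of vs] by auto
  moreover have "u \<in> Mor C" using 2 NonisoD unfactorizable_Noniso by auto
  ultimately show ?case
    using Ident_Hom Dom_closed Cod_closed Ident_Comp Comp_Ident
    by (intro exI[of _ "\<lambda>i. Ident C (chain_object C [u] i)"]) (auto simp: ladder_def chain_object_def)
next
  case (3 u u' us)
  let ?us = "u' # us"
  have chain: "unfactorizable_chain ?us" "unfactorizable C u" "Cod C u = Dom C (hd ?us)"
    using 3(2) by auto
  show ?case
  proof (cases vs rule: unfactorizable_chain.cases)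
    case (2 v)
    then have "unfactorizable C (chain_composite C (u # ?us))" using 3(3,4) by simp
    from unfactorizable_chain_single[OF 3(2) this] show ?thesis by simp
  next
    case v: (3 v v' vs')
    let ?vs = "v' # vs'"
    have chain': "unfactorizable_chain ?vs" "unfactorizable C v" "Cod C v = Dom C (hd ?vs)"
      using 3(3) v by auto
    let ?\<gamma> = "chain_composite C ?us" and ?\<gamma>' = "chain_composite C ?vs"
    have f: "initial_factorization (chain_composite C (u # ?us)) ?\<gamma> u"
      by (rule unfactorizable_chain_Cons(3)[OF chain])
    moreover have f': "initial_factorization (chain_composite C (u # ?us)) ?\<gamma>' v"
      unfolding 3(4) v by (rule unfactorizable_chain_Cons(3)[OF chain'])
    ultimately have "equivalent_factors ?\<gamma> u ?\<gamma>' v"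
      using unique unfolding unique_initial_factorization_def by blast
    then obtain g where g: "g \<in> Mor C" "Dom C g = Cod C u" "Cod C g = Cod C u" "Dom C ?\<gamma>' = Cod C u"
        "v = g \<bullet> u" "?\<gamma> = ?\<gamma>' \<bullet> g"
      unfolding equivalent_factors_def by blast
    have dom: "Dom C v' = Cod C u" using g(4) unfactorizable_chain_composite(2)[OF chain'(1)] by simp
    have v': "unfactorizable C v'" using chain'(1) by (cases vs') auto
    have v'M: "v' \<in> Mor C" using v' NonisoD unfactorizable_Noniso by blast
    have vg: "unfactorizable C (v' \<bullet> g)" using unfactorizable_Comp_iso(2)[OF v' g(1)] g dom by simp
    \<comment> \<open>The chain whose composite equals that of \<open>?us\<close>.\<close>
    let ?ws = "(v' \<bullet> g) # vs'"
    have ws: "unfactorizable_chain ?ws" "chain_composite C ?ws = ?\<gamma>' \<bullet> g"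
    proof -
      have "unfactorizable_chain ?ws \<and> chain_composite C ?ws = ?\<gamma>' \<bullet> g"
      proof (cases vs')
        case Nil
        then show ?thesis using vg by simp
      next
        case (Cons w ws)
        then have w: "unfactorizable_chain vs'" "Cod C v' = Dom C (hd vs')" using chain'(1) by auto
        have "chain_composite C vs' \<bullet> v' \<bullet> g = (chain_composite C vs' \<bullet> v') \<bullet> g"
          by (rule Comp_Mor_assoc[symmetric])
            (use unfactorizable_chain_composite[OF w(1)] NonisoD w v'M g dom in auto)
        then show ?thesis
          using unfactorizable_chain_Cons(1,2)[OF w(1) vg] unfactorizable_chain_Cons(2)[OF w(1) v' w(2)] w
            Comp_Mor(3)[OF v'M g(1)] g dom by simp
      qed
      then show "unfactorizable_chain ?ws" "chain_composite C ?ws = ?\<gamma>' \<bullet> g" by auto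
    qed
    obtain h where h: "h 0 = Ident C (chain_object C ?us 0)"
        "h (length ?us) = Ident C (chain_object C ?us (length ?us))" "ladder h ?us ?ws"
      using 3(1)[OF chain(1) ws(1)] ws(2) g(6) by auto
    have u: "u \<in> Mor C" "v \<in> Mor C" using chain(2) chain'(2) NonisoD unfactorizable_Noniso by blast+
    have L: "ladder (h(0 := g)) ?us ?vs"
      by (rule ladder_change_initial[OF h(3)])
        (use h(1) g(1-3) dom v'M chain(3) in \<open>auto simp: chain_object_def\<close>)
    define h' where "h' = (\<lambda>i. case i of 0 \<Rightarrow> Ident C (Dom C u) | Suc j \<Rightarrow> (h(0 := g)) j)"
    have uv: "Dom C u = Dom C v" using Comp_Mor(2)[of g u] g(1,2,5) u(1) by simp
    have "ladder h' (u # ?us) (v # ?vs)"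
      using L uv Ident_Hom Dom_closed[OF u(1)] Comp_Ident[OF u(2)] g(5) chain(3) chain'(3)
      by (subst ladder_Cons_iff) (auto simp: h'_def simp del: fun_upd_apply simp: fun_upd_same)
    moreover have "h' (length (u # ?us)) = Ident C (chain_object C (u # ?us) (length (u # ?us)))"
      using h(2) by (simp add: h'_def chain_object_def)
    ultimately show ?thesis
      unfolding v by (intro exI[of _ h']) (simp add: h'_def chain_object_def)
  qed (use 3(3) in auto)
qed simp

text \<open>For the direction from left to right the second factors \<open>\<gamma>\<close> and \<open>\<gamma>'\<close> are decomposed into
  chains. The first square of the resulting ladder relates \<open>u\<close> and \<open>u'\<close>, and the composite of
  the other squares relates \<open>\<gamma>\<close> and \<open>\<gamma>'\<close>.\<close>

lemma free_EI_iff_unique_initial_factorization: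
  "free_EI C \<longleftrightarrow> unique_initial_factorization"
proof
  assume unique_initial_factorization
  then show "free_EI C"
    using ladder_if_unique_initial_factorization unfolding free_EI_iff by blast
next
  assume free: "free_EI C"
  show unique_initial_factorization
    unfolding unique_initial_factorization_def
  proof (intro allI impI, elim conjE)
    fix \<alpha> \<gamma> u \<gamma>' u'
    assume f: "initial_factorization \<alpha> \<gamma> u" and f': "initial_factorization \<alpha> \<gamma>' u'"
    note D = initial_factorizationD[OF f] initial_factorizationD[OF f']
    consider "\<gamma> \<notin> Noniso" | "\<gamma>' \<notin> Noniso" | "\<gamma> \<in> Noniso" "\<gamma>' \<in> Noniso" by blast
    then show "equivalent_factors \<gamma> u \<gamma>' u'"
    proof cases
      case 1
      then show ?thesis using initial_factorization_iso[OF f f'] by blast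
    next
      case 2
      then show ?thesis using initial_factorization_iso[OF f' f] equivalent_factors_sym[OF f' f] by blast
    next
      case 3
      obtain us where us: "unfactorizable_chain us" "chain_composite C us = \<gamma>"
        using unfactorizable_chain_exists[OF 3(1)] by blast
      obtain vs where vs: "unfactorizable_chain vs" "chain_composite C vs = \<gamma>'"
        using unfactorizable_chain_exists[OF 3(2)] by blast
      have hd: "Cod C u = Dom C (hd us)" "Cod C u' = Dom C (hd vs)"
        using D us vs unfactorizable_chain_composite(2) by metis+
      have ne: "us \<noteq> []" "vs \<noteq> []" using us vs by auto
      have c: "unfactorizable_chain (u # us)" "unfactorizable_chain (u' # vs)"
        "chain_composite C (u # us) = \<gamma> \<bullet> u" "chain_composite C (u' # vs) = \<gamma>' \<bullet> u'"
        using unfactorizable_chain_Cons[OF us(1) D(4) hd(1)] unfactorizable_chain_Cons[OF vs(1) D(14) hd(2)] us vs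
        by auto
      moreover have "\<gamma> \<bullet> u = \<gamma>' \<bullet> u'" using D by simp
      ultimately obtain h where h: "h 0 = Ident C (chain_object C (u # us) 0)"
          "h (length (u # us)) = Ident C (chain_object C (u # us) (length (u # us)))" "ladder h (u # us) (u' # vs)"
        using free unfolding free_EI_iff by metis
      then have L: "Dom C u = Dom C u'" "u' \<bullet> h 0 = h 1 \<bullet> u" "ladder (\<lambda>i. h (Suc i)) us vs"
        using ladder_Cons_iff[OF ne hd] by auto
      have u': "u' = h 1 \<bullet> u" using L(2) h(1) L(1) Comp_Ident[OF D(12)] by (simp add: chain_object_def)
      have "\<gamma>' \<bullet> h 1 = h (length (u # us)) \<bullet> \<gamma>"
        using ladder_composite[OF us(1) vs(1) L(3)] us vs by simp
      moreover have "h (length (u # us)) = Ident C (Cod C \<gamma>)"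
        using h(2) unfactorizable_chain_composite(3)[OF us(1)] us ne by (simp add: chain_object_def last_conv_nth)
      ultimately have \<gamma>: "\<gamma> = \<gamma>' \<bullet> h 1" using Ident_Comp[OF D(1)] by simp
      have "h 1 \<in> Hom C (Cod C u) (Cod C u)" "Cod C u = Cod C u'"
        using h(3) by (auto simp: ladder_def chain_object_def)
      then show ?thesis unfolding equivalent_factors_def using u' \<gamma> D(15) by (auto simp: Hom_def)
    qed
  qed
qed

end

section \<open>Splittings and uniqueness of factorizations\<close>

locale skeletal_EI_category_over_field = skeletal_EI_category C + field k
  for C :: "('o, 'm) category" and k :: "('a, 'q) ring_scheme" (structure)
begin

text \<open>The basis at the object \<open>y\<close> of the free functor on the vector spaces \<open>K(x)\<close>.\<close>

definition noniso_pairs :: "'o \<Rightarrow> ('m \<times> 'm) set" where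
  "noniso_pairs y = {(\<eta>, z). \<eta> \<in> Mor C \<and> Cod C \<eta> = y \<and> z \<in> Noniso \<and> Cod C z = Dom C \<eta>}"

lemma finite_noniso_pairs: "finite (noniso_pairs y)"
  by (rule finite_subset[of _ "Mor C \<times> Noniso"]) (use finite_Mor finite_Noniso in \<open>auto simp: noniso_pairs_def\<close>)

lemma noniso_pairsD:
  assumes "q \<in> noniso_pairs y"
  shows "fst q \<in> Mor C" "Cod C (fst q) = y" "snd q \<in> Noniso" "snd q \<in> Mor C" "Cod C (snd q) = Dom C (fst q)"
    "fst q \<bullet> snd q \<in> Noniso" "fst q \<bullet> snd q \<in> Mor C" "Cod C (fst q \<bullet> snd q) = y"
  using assms Comp_Noniso_right[of "fst q" "snd q"] NonisoD(1) Comp_Mor[of "fst q" "snd q"]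
  by (auto simp: noniso_pairs_def)

lemma noniso_pairs_Comp:
  assumes "q \<in> noniso_pairs x" "\<beta> \<in> Mor C" "Dom C \<beta> = x"
  shows "(\<beta> \<bullet> fst q, snd q) \<in> noniso_pairs (Cod C \<beta>)"
    "(\<beta> \<bullet> fst q) \<bullet> snd q = \<beta> \<bullet> fst q \<bullet> snd q"
  using noniso_pairsD[OF assms(1)] assms(2,3) Comp_Mor[of \<beta> "fst q"] Comp_Mor_assoc[of \<beta> "fst q" "snd q"]
  by (auto simp: noniso_pairs_def)

text \<open>The coefficients of a section of the epimorphism \<open>(\<eta>, z) \<mapsto> \<eta> \<bullet> z\<close> from that free functor onto
  \<open>K\<close>. The second clause says that \<open>V\<close> defines a section, the third that it is natural. Both are
  expressed by integrals of test functions \<open>F\<close> against the measure \<open>V \<alpha>\<close>; this form is convenient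
  for passing to image measures.\<close>

definition splitting :: "('m \<Rightarrow> 'm \<times> 'm \<Rightarrow> 'a) \<Rightarrow> bool" where
  "splitting V \<longleftrightarrow>
    (\<forall>\<alpha> \<in> Noniso. \<forall>q. V \<alpha> q \<in> carrier k) \<and>
    (\<forall>\<alpha> \<in> Noniso. \<forall>F \<in> Noniso \<rightarrow> carrier k.
      (\<Oplus>q\<in>noniso_pairs (Cod C \<alpha>). V \<alpha> q \<otimes> F (fst q \<bullet> snd q)) = F \<alpha>) \<and>
    (\<forall>\<alpha> \<in> Noniso. \<forall>\<beta> \<in> Mor C. Dom C \<beta> = Cod C \<alpha> \<longrightarrow>
      (\<forall>F \<in> noniso_pairs (Cod C \<beta>) \<rightarrow> carrier k.
        (\<Oplus>q\<in>noniso_pairs (Cod C \<beta>). V (\<beta> \<bullet> \<alpha>) q \<otimes> F q) =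
        (\<Oplus>q\<in>noniso_pairs (Cod C \<alpha>). V \<alpha> q \<otimes> F (\<beta> \<bullet> fst q, snd q))))"

lemma splittingD:
  assumes "splitting V" "\<alpha> \<in> Noniso"
  shows "V \<alpha> q \<in> carrier k"
    "F \<in> Noniso \<rightarrow> carrier k \<Longrightarrow> (\<Oplus>q\<in>noniso_pairs (Cod C \<alpha>). V \<alpha> q \<otimes> F (fst q \<bullet> snd q)) = F \<alpha>"
    "\<beta> \<in> Mor C \<Longrightarrow> Dom C \<beta> = Cod C \<alpha> \<Longrightarrow> F' \<in> noniso_pairs (Cod C \<beta>) \<rightarrow> carrier k \<Longrightarrow>
      (\<Oplus>q\<in>noniso_pairs (Cod C \<beta>). V (\<beta> \<bullet> \<alpha>) q \<otimes> F' q) =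
      (\<Oplus>q\<in>noniso_pairs (Cod C \<alpha>). V \<alpha> q \<otimes> F' (\<beta> \<bullet> fst q, snd q))"
  using assms unfolding splitting_def by blast+

text \<open>The sum \<open>?weight\<close> is the mass that \<open>V \<alpha>\<close> gives to the class of \<open>\<gamma>, u\<close>, where the factorization
  that belongs to a pair \<open>(\<eta>, z)\<close> is \<open>\<eta> \<bullet> G z, U z\<close> for a fixed choice of factorizations
  \<open>z = G z \<bullet> U z\<close>.\<close>

lemma unique_initial_factorization_if_splitting:
  assumes V: "splitting V"
  shows unique_initial_factorization
proof -
  obtain G U where GU: "\<And>\<alpha>. \<alpha> \<in> Noniso \<Longrightarrow> initial_factorization \<alpha> (G \<alpha>) (U \<alpha>)"
    using initial_factorization_exists by metis
  have "equivalent_factors \<gamma> u \<gamma>' u'"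
    if "initial_factorization \<alpha> \<gamma> u" "initial_factorization \<alpha> \<gamma>' u'" for \<alpha> \<gamma> u \<gamma>' u'
    using that
  proof (induction "height (Cod C \<alpha>)" arbitrary: \<alpha> \<gamma> u \<gamma>' u' rule: less_induct)
    case less
    note f = less.prems(1) and f' = less.prems(2)
    note D = initial_factorizationD[OF f]
    consider "\<gamma> \<notin> Noniso" | "\<gamma>' \<notin> Noniso" | "\<gamma> \<in> Noniso" "\<gamma>' \<in> Noniso" by blast
    then show ?case
    proof cases
      case 1
      then show ?thesis using initial_factorization_iso[OF f f'] by blast
    next
      case 2
      then show ?thesis using initial_factorization_iso[OF f' f] equivalent_factors_sym[OF f' f] by blast
    next
      case 3
      let ?ind = "\<lambda>q. if equivalent_factors (fst q \<bullet> G (snd q)) (U (snd q)) \<gamma> u then \<one> else \<zero>"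
      let ?weight = "\<Oplus>q\<in>noniso_pairs (Cod C \<alpha>). V \<alpha> q \<otimes> ?ind q"
      have weight: "?weight = (if equivalent_factors \<delta> v \<gamma> u then \<one> else \<zero>)"
        if fd: "initial_factorization \<alpha> \<delta> v" and dN: "\<delta> \<in> Noniso" for \<delta> v
      proof -
        note E = initial_factorizationD[OF fd]
        let ?x = "Dom C \<delta>"
        have lt: "height ?x < height (Cod C \<alpha>)" using height_less[OF dN] E by simp
        let ?F = "\<lambda>\<epsilon>. if equivalent_factors (\<delta> \<bullet> G \<epsilon>) (U \<epsilon>) \<gamma> u then \<one> else \<zero>"
        \<comment> \<open>By the induction hypothesis the class of the image of a pair under \<open>\<delta>\<close> depends only on the
          composite of the pair.\<close>
        have same: "?ind (\<delta> \<bullet> fst q, snd q) = ?F (fst q \<bullet> snd q)" if q: "q \<in> noniso_pairs ?x" for q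
        proof -
          let ?\<epsilon> = "fst q \<bullet> snd q"
          note q' = noniso_pairsD[OF q]
          have e1: "initial_factorization ?\<epsilon> (fst q \<bullet> G (snd q)) (U (snd q))"
            using initial_factorization_Comp[OF GU[OF q'(3)] q'(1)] q' by simp
          have e2: "initial_factorization ?\<epsilon> (G ?\<epsilon>) (U ?\<epsilon>)" using GU q' by simp
          have eq: "equivalent_factors (fst q \<bullet> G (snd q)) (U (snd q)) (G ?\<epsilon>) (U ?\<epsilon>)"
            using less.hyps[OF _ e1 e2] lt q' by simp
          have c: "Cod C ?\<epsilon> = Dom C \<delta>" using q' by simp
          have d1: "initial_factorization (\<delta> \<bullet> ?\<epsilon>) (\<delta> \<bullet> fst q \<bullet> G (snd q)) (U (snd q))"
            and d2: "initial_factorization (\<delta> \<bullet> ?\<epsilon>) (\<delta> \<bullet> G ?\<epsilon>) (U ?\<epsilon>)"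
            using initial_factorization_Comp[OF e1 E(1) c] initial_factorization_Comp[OF e2 E(1) c] .
          have eq': "equivalent_factors (\<delta> \<bullet> fst q \<bullet> G (snd q)) (U (snd q)) (\<delta> \<bullet> G ?\<epsilon>) (U ?\<epsilon>)"
            by (rule equivalent_factors_Comp[OF e1 e2 eq E(1) c])
          have "(\<delta> \<bullet> fst q) \<bullet> G (snd q) = \<delta> \<bullet> fst q \<bullet> G (snd q)"
            by (rule Comp_Mor_assoc) (use E q' initial_factorizationD[OF GU[OF q'(3)]] in auto)
          then show ?thesis
            using equivalent_factors_trans[OF d1 f eq'] equivalent_factors_trans[OF d2 f]
              equivalent_factors_sym[OF d1 d2 eq'] by auto
        qed
        have "?weight = (\<Oplus>q\<in>noniso_pairs (Cod C \<delta>). V (\<delta> \<bullet> v) q \<otimes> ?ind q)" using E by simp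
        also have "\<dots> = (\<Oplus>q\<in>noniso_pairs (Cod C v). V v q \<otimes> ?ind (\<delta> \<bullet> fst q, snd q))"
          by (rule splittingD(3)[OF V E(3,1)]) (use E in auto)
        also have "\<dots> = (\<Oplus>q\<in>noniso_pairs (Cod C v). V v q \<otimes> ?F (fst q \<bullet> snd q))"
          by (rule finsum_cong'[OF refl]) (use splittingD(1)[OF V E(3)] same E in auto)
        also have "\<dots> = ?F v" by (rule splittingD(2)[OF V E(3)]) auto
        finally have w: "?weight = ?F v" .
        have i: "initial_factorization v (Ident C (Cod C v)) v"
          by (rule initial_factorization_unfactorizable[OF E(4)])
        have eq: "equivalent_factors (G v) (U v) (Ident C (Cod C v)) v"
          using less.hyps[OF _ GU[OF E(3)] i] lt E by simp
        have "equivalent_factors (\<delta> \<bullet> G v) (U v) (\<delta> \<bullet> Ident C (Cod C v)) v"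
          by (rule equivalent_factors_Comp[OF GU[OF E(3)] i eq E(1,5)])
        then have eq': "equivalent_factors (\<delta> \<bullet> G v) (U v) \<delta> v" using Comp_Ident[OF E(1)] E by simp
        have d: "initial_factorization \<alpha> (\<delta> \<bullet> G v) (U v)"
          using initial_factorization_Comp[OF GU[OF E(3)] E(1,5)] E by simp
        show ?thesis unfolding w
          using equivalent_factors_trans[OF d f eq'] equivalent_factors_trans[OF fd f]
            equivalent_factors_sym[OF d fd eq'] by auto
      qed
      \<comment> \<open>The same mass is computed from both factorizations.\<close>
      have "(if equivalent_factors \<gamma>' u' \<gamma> u then \<one> else \<zero>) = \<one>"
        using weight[OF f 3(1)] weight[OF f' 3(2)] equivalent_factors_refl[OF f] by simp
      then have "equivalent_factors \<gamma>' u' \<gamma> u" using one_not_zero by (auto split: if_splits)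
      then show ?thesis by (rule equivalent_factors_sym[OF f' f])
    qed
  qed
  then show ?thesis unfolding unique_initial_factorization_def by blast
qed

section \<open>A splitting from projective Hom modules\<close>

text \<open>The analogue of \<open>noniso_pairs\<close> for the action of the automorphisms of the codomain \<open>x\<close> of \<open>u\<close> on
  the morphisms parallel to \<open>u\<close>.\<close>

definition Aut_pairs :: "'m \<Rightarrow> ('m \<times> 'm) set" where
  "Aut_pairs u = Hom C (Cod C u) (Cod C u) \<times> Hom C (Dom C u) (Cod C u)"

lemma finite_Hom: "finite (Hom C x y)"
  using finite_Mor by (simp add: Hom_def)

lemma finite_Aut_pairs: "finite (Aut_pairs u)"
  using finite_Hom by (simp add: Aut_pairs_def)

lemma Hom_left_module_coefficients:
  assumes "projective_left_module (group_algebra k (Aut C x)) (Hom_left_module k C w x)"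
    and x: "x \<in> Ob C"
  obtains W where "\<And>u q. u \<in> Hom C w x \<Longrightarrow> W u q \<in> carrier k"
    "\<And>u F. u \<in> Hom C w x \<Longrightarrow> F \<in> Hom C w x \<rightarrow> carrier k \<Longrightarrow>
      (\<Oplus>q\<in>Hom C x x \<times> Hom C w x. W u q \<otimes> F (fst q \<bullet> snd q)) = F u"
    "\<And>u h F. u \<in> Hom C w x \<Longrightarrow> h \<in> Hom C x x \<Longrightarrow> F \<in> Hom C x x \<times> Hom C w x \<rightarrow> carrier k \<Longrightarrow>
      (\<Oplus>q\<in>Hom C x x \<times> Hom C w x. W (h \<bullet> u) q \<otimes> F q) =
      (\<Oplus>q\<in>Hom C x x \<times> Hom C w x. W u q \<otimes> F (h \<bullet> fst q, snd q))"
proof -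
  let ?A = "group_algebra k (Aut C x)" and ?P = "Hom_left_module k C w x"
  let ?Q = "Hom C x x \<times> Hom C w x"
  let ?act = "\<lambda>q. fst q \<bullet> snd q" and ?e = "\<lambda>u v. if v = u then \<one> else \<zero>"
  have G: "carrier (Aut C x) = Hom C x x" by (rule carrier_Aut[OF x])
  have act: "?act \<in> ?Q \<rightarrow> Hom C w x" using Comp_Hom by auto
  have fQ: "finite ?Q" using finite_Hom by simp
  have A: "a \<in> carrier ?A \<longleftrightarrow> a \<in> carrier (free_module k (Hom C x x))" for a by (simp add: group_algebra_def G)
  have P: "v \<in> carrier ?P \<longleftrightarrow> v \<in> carrier (free_module k (Hom C w x))" for v by (simp add: Hom_left_module_def)
  have cl: "f \<in> carrier (free_module k B) \<Longrightarrow> f b \<in> carrier k" for f b and B :: "'m set" by (simp add: free_module_def)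
  have single: "?e u \<in> carrier (free_module k B)" if "u \<in> B" for u and B :: "'m set"
    using that by (auto simp: free_module_def)
  have sm: "(a \<odot>\<^bsub>?P\<^esub> v) z = (\<Oplus>q\<in>{q \<in> ?Q. ?act q = z}. a (fst q) \<otimes> v (snd q))" for a v z
    by (auto simp: Hom_left_module_def bilinear_extension_def G case_prod_unfold intro!: arg_cong2[where f = "finsum k"])
  obtain W where W: "\<And>u q. u \<in> Hom C w x \<Longrightarrow> W u q \<in> carrier k"
    "\<And>u z. u \<in> Hom C w x \<Longrightarrow> z \<in> Hom C w x \<Longrightarrow>
      (\<Oplus>q\<in>{q \<in> ?Q. ?act q = z}. W u q) = (if u = z then \<one> else \<zero>)"
    "\<And>s u u' n z N. s \<in> carrier ?A \<Longrightarrow> u \<in> Hom C w x \<Longrightarrow> u' \<in> Hom C w x \<Longrightarrow> ?e u' = s \<odot>\<^bsub>?P\<^esub> ?e u \<Longrightarrow> finite N \<Longrightarrow>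
      (\<And>a. a \<in> carrier ?A \<Longrightarrow> (s \<otimes>\<^bsub>?A\<^esub> a) n = (\<Oplus>n'\<in>N. a n')) \<Longrightarrow>
      W u' (n, z) = (\<Oplus>n'\<in>N. W u (n', z))"
  proof (rule projective_coefficients[OF assms(1), of ?Q "Hom C w x" ?e "\<lambda>v. v" ?act])
    show "\<And>a v z. (a \<odot>\<^bsub>?P\<^esub> v) z = (\<Oplus>q\<in>{q \<in> ?Q. ?act q = z}. a (fst q) \<otimes> v (snd q))" by (rule sm)
    show "?e \<in> Hom C w x \<rightarrow> carrier ?P" using single P by auto
    show "\<And>v z. \<zero>\<^bsub>?P\<^esub> z = \<zero>" by (simp add: Hom_left_module_def free_module_def)
    show "\<And>v u z. (v \<oplus>\<^bsub>?P\<^esub> u) z = v z \<oplus> u z" by (simp add: Hom_left_module_def free_module_def)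
  qed (use A P cl fQ finite_Hom in auto)
  show thesis
  proof (rule that[of W])
    fix u F assume u: "u \<in> Hom C w x" and F: "F \<in> Hom C w x \<rightarrow> carrier k"
    show "(\<Oplus>q\<in>?Q. W u q \<otimes> F (?act q)) = F u"
      by (rule finsum_expectation[OF fQ finite_Hom act _ F u]) (use W(1,2) u in auto)
  next
    fix u h F assume u: "u \<in> Hom C w x" and h: "h \<in> Hom C x x" and F: "F \<in> ?Q \<rightarrow> carrier k"
    show "(\<Oplus>q\<in>?Q. W (h \<bullet> u) q \<otimes> F q) = (\<Oplus>q\<in>?Q. W u q \<otimes> F (h \<bullet> fst q, snd q))"
    proof (rule finsum_pushforward[OF fQ fQ _ _ F])
      show "(\<lambda>q. (h \<bullet> fst q, snd q)) \<in> ?Q \<rightarrow> ?Q" using h Comp_Hom by auto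
      show "W u \<in> ?Q \<rightarrow> carrier k" using W(1) u by auto
      fix q assume q: "q \<in> ?Q"
      obtain g z where gz: "q = (g, z)" by force
      let ?N = "{n. (n, z) \<in> ?Q \<and> h \<bullet> n = g}"
      have "W (h \<bullet> u) (g, z) = (\<Oplus>n\<in>?N. W u (n, z))"
      proof (rule W(3))
        show "?e h \<in> carrier ?A" using A single h by simp
        show "finite ?N" by (rule finite_subset[OF _ finite_Hom[of x x]]) auto
        show "?e (h \<bullet> u) = ?e h \<odot>\<^bsub>?P\<^esub> ?e u"
        proof
          fix z
          let ?B = "{y. (h, y) \<in> Hom C x x \<times> Hom C w x \<and> h \<bullet> y = z}"
          have fB: "finite ?B" by (rule finite_subset[OF _ finite_Hom[of w x]]) auto
          have eu: "?e u y \<in> carrier k" for y by simp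
          have "(?e h \<odot>\<^bsub>?P\<^esub> ?e u) z = (\<Oplus>y\<in>?B. ?e u y)"
            using bilinear_extension_single[of ?Q "?e u" "Comp C" h z, OF fQ eu] by (simp add: G Hom_left_module_def)
          also have "\<dots> = ?e (h \<bullet> u) z"
          proof (cases "u \<in> ?B")
            case True
            then show ?thesis using finsum_singleton[OF True fB, of "\<lambda>_. \<one>"] by (simp add: eq_commute)
          next
            case False
            then have "(\<Oplus>y\<in>?B. ?e u y) = (\<Oplus>y\<in>?B. \<zero>)" by (intro finsum_cong') auto
            then show ?thesis using False u h by auto
          qed
          finally show "?e (h \<bullet> u) z = (?e h \<odot>\<^bsub>?P\<^esub> ?e u) z" ..
        qed
        fix a assume "a \<in> carrier ?A"
        then have a: "a y \<in> carrier k" for y using A cl by blast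
        have "?N = {n. (h, n) \<in> Hom C x x \<times> Hom C x x \<and> h \<bullet> n = g}" using q gz h by auto
        moreover have "(?e h \<otimes>\<^bsub>?A\<^esub> a) g = (\<Oplus>n\<in>{n. (h, n) \<in> Hom C x x \<times> Hom C x x \<and> h \<bullet> n = g}. a n)"
          using bilinear_extension_single[of "Hom C x x \<times> Hom C x x" a "Comp C" h g] a finite_Hom
          by (simp add: group_algebra_def G) (simp add: Aut_def)
        ultimately show "(?e h \<otimes>\<^bsub>?A\<^esub> a) g = (\<Oplus>n\<in>?N. a n)" by simp
      qed (use u h Comp_Hom in auto)
      also have "\<dots> = (\<Oplus>q'\<in>{q' \<in> ?Q. (h \<bullet> fst q', snd q') = (g, z)}. W u q')"
        by (rule finsum_fibre_fst) (use W(1) u in auto)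
      finally show "W (h \<bullet> u) q = (\<Oplus>q'\<in>{q' \<in> ?Q. (h \<bullet> fst q', snd q') = q}. W u q')" unfolding gz .
    qed
  qed (rule W(1))
qed

text \<open>The coefficients for all pairs of objects together, indexed by the morphisms.\<close>

lemma Hom_splitting:
  assumes "projective_over k C"
  obtains W where "\<And>u q. u \<in> Mor C \<Longrightarrow> W u q \<in> carrier k"
    "\<And>u F. u \<in> Mor C \<Longrightarrow> F \<in> Hom C (Dom C u) (Cod C u) \<rightarrow> carrier k \<Longrightarrow>
      (\<Oplus>q\<in>Aut_pairs u. W u q \<otimes> F (fst q \<bullet> snd q)) = F u"
    "\<And>u h F. u \<in> Mor C \<Longrightarrow> h \<in> Hom C (Cod C u) (Cod C u) \<Longrightarrow> F \<in> Aut_pairs u \<rightarrow> carrier k \<Longrightarrow>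
      (\<Oplus>q\<in>Aut_pairs u. W (h \<bullet> u) q \<otimes> F q) = (\<Oplus>q\<in>Aut_pairs u. W u q \<otimes> F (h \<bullet> fst q, snd q))"
proof -
  let ?good = "\<lambda>w x W. (\<forall>u\<in>Hom C w x. \<forall>q. W u q \<in> carrier k) \<and>
    (\<forall>u\<in>Hom C w x. \<forall>F\<in>Hom C w x \<rightarrow> carrier k.
      (\<Oplus>q\<in>Hom C x x \<times> Hom C w x. W u q \<otimes> F (fst q \<bullet> snd q)) = F u) \<and>
    (\<forall>u\<in>Hom C w x. \<forall>h\<in>Hom C x x. \<forall>F\<in>Hom C x x \<times> Hom C w x \<rightarrow> carrier k.
      (\<Oplus>q\<in>Hom C x x \<times> Hom C w x. W (h \<bullet> u) q \<otimes> F q) =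
      (\<Oplus>q\<in>Hom C x x \<times> Hom C w x. W u q \<otimes> F (h \<bullet> fst q, snd q)))"
  have ex: "\<exists>W. ?good w x W" if wx: "w \<in> Ob C" "x \<in> Ob C" for w x
  proof -
    have proj: "projective_left_module (group_algebra k (Aut C x)) (Hom_left_module k C w x)"
      using assms wx by (simp add: projective_over_def)
    show ?thesis
    proof (rule Hom_left_module_coefficients[OF proj wx(2)])
      fix W assume W: "\<And>u q. u \<in> Hom C w x \<Longrightarrow> W u q \<in> carrier k"
        "\<And>u F. u \<in> Hom C w x \<Longrightarrow> F \<in> Hom C w x \<rightarrow> carrier k \<Longrightarrow>
          (\<Oplus>q\<in>Hom C x x \<times> Hom C w x. W u q \<otimes> F (fst q \<bullet> snd q)) = F u"
        "\<And>u h F. u \<in> Hom C w x \<Longrightarrow> h \<in> Hom C x x \<Longrightarrow> F \<in> Hom C x x \<times> Hom C w x \<rightarrow> carrier k \<Longrightarrow>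
          (\<Oplus>q\<in>Hom C x x \<times> Hom C w x. W (h \<bullet> u) q \<otimes> F q) =
          (\<Oplus>q\<in>Hom C x x \<times> Hom C w x. W u q \<otimes> F (h \<bullet> fst q, snd q))"
      show ?thesis by (intro exI[of _ W] conjI ballI allI) (simp_all only: W)
    qed
  qed
  define Wf where "Wf w x = (SOME W. ?good w x W)" for w x
  have Wf: "?good w x (Wf w x)" if "w \<in> Ob C" "x \<in> Ob C" for w x
    unfolding Wf_def by (rule someI_ex[OF ex[OF that]])
  have good: "?good (Dom C u) (Cod C u) (Wf (Dom C u) (Cod C u))" "u \<in> Hom C (Dom C u) (Cod C u)" if "u \<in> Mor C" for u
    using Wf Dom_closed Cod_closed that by (simp_all add: Hom_def)
  show thesis
  proof (rule that[of "\<lambda>u. Wf (Dom C u) (Cod C u) u"])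
    fix u h F assume u: "u \<in> Mor C" and h: "h \<in> Hom C (Cod C u) (Cod C u)" and F: "F \<in> Aut_pairs u \<rightarrow> carrier k"
    have "Dom C (h \<bullet> u) = Dom C u" "Cod C (h \<bullet> u) = Cod C u" using Comp_Mor[of h u] u h by (auto simp: Hom_def)
    then show "(\<Oplus>q\<in>Aut_pairs u. Wf (Dom C (h \<bullet> u)) (Cod C (h \<bullet> u)) (h \<bullet> u) q \<otimes> F q) =
        (\<Oplus>q\<in>Aut_pairs u. Wf (Dom C u) (Cod C u) u q \<otimes> F (h \<bullet> fst q, snd q))"
      using good[OF u] h F by (simp add: Aut_pairs_def)
  qed (use good in \<open>auto simp: Aut_pairs_def\<close>)
qed

lemma splitting_if_unique_initial_factorization:
  assumes proj: "projective_over k C" and unique: unique_initial_factorization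
  shows "\<exists>V. splitting V"
proof -
  obtain W where W: "\<And>u q. u \<in> Mor C \<Longrightarrow> W u q \<in> carrier k"
    "\<And>u F. u \<in> Mor C \<Longrightarrow> F \<in> Hom C (Dom C u) (Cod C u) \<rightarrow> carrier k \<Longrightarrow>
      (\<Oplus>q\<in>Aut_pairs u. W u q \<otimes> F (fst q \<bullet> snd q)) = F u"
    "\<And>u h F. u \<in> Mor C \<Longrightarrow> h \<in> Hom C (Cod C u) (Cod C u) \<Longrightarrow> F \<in> Aut_pairs u \<rightarrow> carrier k \<Longrightarrow>
      (\<Oplus>q\<in>Aut_pairs u. W (h \<bullet> u) q \<otimes> F q) = (\<Oplus>q\<in>Aut_pairs u. W u q \<otimes> F (h \<bullet> fst q, snd q))"
    by (rule Hom_splitting[OF proj], rule that, assumption+)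
  obtain G U where GU: "\<And>\<alpha>. \<alpha> \<in> Noniso \<Longrightarrow> initial_factorization \<alpha> (G \<alpha>) (U \<alpha>)"
    using initial_factorization_exists by metis
  define V where "V \<alpha> q = (\<Oplus>p\<in>{p \<in> Aut_pairs (U \<alpha>). (G \<alpha> \<bullet> fst p, snd p) = q}. W (U \<alpha>) p)" for \<alpha> q
  have shift: "(\<gamma> \<bullet> fst p, snd p) \<in> noniso_pairs (Cod C \<alpha>)" "\<gamma> \<bullet> fst p \<bullet> snd p = (\<gamma> \<bullet> fst p) \<bullet> snd p"
    "fst p \<in> Mor C" "Dom C (fst p) = Cod C u" "Cod C (fst p) = Cod C u" "snd p \<in> Mor C" "Cod C (snd p) = Cod C u"
    if f: "initial_factorization \<alpha> \<gamma> u" and p: "p \<in> Aut_pairs u" for \<alpha> \<gamma> u p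
  proof -
    note D = initial_factorizationD[OF f]
    show p': "fst p \<in> Mor C" "Dom C (fst p) = Cod C u" "Cod C (fst p) = Cod C u" "snd p \<in> Mor C" "Cod C (snd p) = Cod C u"
      using p by (auto simp: Aut_pairs_def Hom_def)
    have "snd p \<in> Noniso" using p D(3) by (auto simp: Aut_pairs_def Hom_def Noniso_def)
    then show "(\<gamma> \<bullet> fst p, snd p) \<in> noniso_pairs (Cod C \<alpha>)"
      using Comp_Mor[of \<gamma> "fst p"] p' D by (auto simp: noniso_pairs_def)
    show "\<gamma> \<bullet> fst p \<bullet> snd p = (\<gamma> \<bullet> fst p) \<bullet> snd p"
      by (rule Comp_Mor_assoc[symmetric]) (use p' D in auto)
  qed
  have expand_chosen: "(\<Oplus>q\<in>noniso_pairs (Cod C \<alpha>). V \<alpha> q \<otimes> F q) =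
      (\<Oplus>p\<in>Aut_pairs (U \<alpha>). W (U \<alpha>) p \<otimes> F (G \<alpha> \<bullet> fst p, snd p))"
    if "\<alpha> \<in> Noniso" "F \<in> noniso_pairs (Cod C \<alpha>) \<rightarrow> carrier k" for \<alpha> F
    by (rule finsum_pushforward[OF finite_Aut_pairs finite_noniso_pairs _ _ that(2)])
      (use shift(1)[OF GU[OF that(1)]] W(1) initial_factorizationD(2)[OF GU[OF that(1)]] in \<open>auto simp: V_def\<close>)
  \<comment> \<open>The definition of \<open>V \<alpha>\<close> by the chosen factorization is valid for all factorizations.\<close>
  have expand: "(\<Oplus>q\<in>noniso_pairs (Cod C \<alpha>). V \<alpha> q \<otimes> F q) =
      (\<Oplus>p\<in>Aut_pairs u. W u p \<otimes> F (\<gamma> \<bullet> fst p, snd p))"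
    if f: "initial_factorization \<alpha> \<gamma> u" and F: "F \<in> noniso_pairs (Cod C \<alpha>) \<rightarrow> carrier k" for \<alpha> \<gamma> u F
  proof -
    note D = initial_factorizationD[OF f]
    have f': "initial_factorization \<alpha> (G \<alpha>) (U \<alpha>)" by (rule GU[OF D(7)])
    have "equivalent_factors (G \<alpha>) (U \<alpha>) \<gamma> u"
      using unique f f' unfolding unique_initial_factorization_def by blast
    then obtain h where h: "h \<in> Mor C" "Dom C h = Cod C (U \<alpha>)" "Cod C h = Cod C (U \<alpha>)" "Dom C \<gamma> = Cod C (U \<alpha>)"
      "u = h \<bullet> U \<alpha>" "G \<alpha> = \<gamma> \<bullet> h"
      unfolding equivalent_factors_def by blast
    have UM: "U \<alpha> \<in> Mor C" using initial_factorizationD(2)[OF f'] .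
    have ap: "Aut_pairs u = Aut_pairs (U \<alpha>)"
      using Comp_Mor(2,3)[OF h(1) UM] h(2,3) unfolding Aut_pairs_def h(5) by simp
    have "(\<Oplus>p\<in>Aut_pairs u. W u p \<otimes> F (\<gamma> \<bullet> fst p, snd p)) =
        (\<Oplus>p\<in>Aut_pairs (U \<alpha>). W (h \<bullet> U \<alpha>) p \<otimes> F (\<gamma> \<bullet> fst p, snd p))"
      unfolding ap unfolding h(5) ..
    also have "\<dots> = (\<Oplus>p\<in>Aut_pairs (U \<alpha>). W (U \<alpha>) p \<otimes> F (\<gamma> \<bullet> fst (h \<bullet> fst p, snd p), snd (h \<bullet> fst p, snd p)))"
    proof (rule W(3)[OF UM])
      show "h \<in> Hom C (Cod C (U \<alpha>)) (Cod C (U \<alpha>))" using h by (simp add: Hom_def)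
      show "(\<lambda>p. F (\<gamma> \<bullet> fst p, snd p)) \<in> Aut_pairs (U \<alpha>) \<rightarrow> carrier k"
        using shift(1)[OF f] F unfolding ap by auto
    qed
    also have "\<dots> = (\<Oplus>p\<in>Aut_pairs (U \<alpha>). W (U \<alpha>) p \<otimes> F (G \<alpha> \<bullet> fst p, snd p))"
    proof (rule finsum_cong'[OF refl])
      show "(\<lambda>p. W (U \<alpha>) p \<otimes> F (G \<alpha> \<bullet> fst p, snd p)) \<in> Aut_pairs (U \<alpha>) \<rightarrow> carrier k"
        by (rule Pi_I) (rule m_closed[OF W(1)[OF UM] funcset_mem[OF F shift(1)[OF f']]])
      fix p assume p: "p \<in> Aut_pairs (U \<alpha>)"
      have "\<gamma> \<bullet> h \<bullet> fst p = (\<gamma> \<bullet> h) \<bullet> fst p"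
        by (rule Comp_Mor_assoc[symmetric]) (use D(1) h(1-4) shift(3-5)[OF f' p] in auto)
      then show "W (U \<alpha>) p \<otimes> F (\<gamma> \<bullet> fst (h \<bullet> fst p, snd p), snd (h \<bullet> fst p, snd p)) =
          W (U \<alpha>) p \<otimes> F (G \<alpha> \<bullet> fst p, snd p)"
        unfolding h(6) by simp
    qed
    finally show ?thesis using expand_chosen[OF D(7) F] by simp
  qed
  have "splitting V"
    unfolding splitting_def
  proof (intro conjI ballI allI impI)
    fix \<alpha> q assume "\<alpha> \<in> Noniso"
    then have "U \<alpha> \<in> Mor C" using initial_factorizationD(2)[OF GU] by blast
    then show "V \<alpha> q \<in> carrier k" unfolding V_def using W(1) by (intro finsum_closed) auto
  next
    fix \<alpha> F assume a: "\<alpha> \<in> Noniso" and F: "F \<in> Noniso \<rightarrow> carrier k"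
    note f = GU[OF a]
    note D = initial_factorizationD[OF f]
    have "(\<Oplus>q\<in>noniso_pairs (Cod C \<alpha>). V \<alpha> q \<otimes> F (fst q \<bullet> snd q)) =
        (\<Oplus>p\<in>Aut_pairs (U \<alpha>). W (U \<alpha>) p \<otimes> F (fst (G \<alpha> \<bullet> fst p, snd p) \<bullet> snd (G \<alpha> \<bullet> fst p, snd p)))"
      by (rule expand[OF f]) (use F noniso_pairsD(6) in auto)
    also have "\<dots> = (\<Oplus>p\<in>Aut_pairs (U \<alpha>). W (U \<alpha>) p \<otimes> F (G \<alpha> \<bullet> fst p \<bullet> snd p))"
    proof (rule finsum_cong'[OF refl])
      show "(\<lambda>p. W (U \<alpha>) p \<otimes> F (G \<alpha> \<bullet> fst p \<bullet> snd p)) \<in> Aut_pairs (U \<alpha>) \<rightarrow> carrier k"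
        using W(1)[OF D(2)] funcset_mem[OF F noniso_pairsD(6)[OF shift(1)[OF f]]] shift(2)[OF f] by simp
    qed (use shift(2)[OF f] in simp)
    also have "\<dots> = F (G \<alpha> \<bullet> U \<alpha>)"
    proof (rule W(2)[OF D(2)])
      show "(\<lambda>v. F (G \<alpha> \<bullet> v)) \<in> Hom C (Dom C (U \<alpha>)) (Cod C (U \<alpha>)) \<rightarrow> carrier k"
        using F Comp_Noniso_right[OF D(1)] D(3,5) by (auto simp: Hom_def Noniso_def Pi_def)
    qed
    finally show "(\<Oplus>q\<in>noniso_pairs (Cod C \<alpha>). V \<alpha> q \<otimes> F (fst q \<bullet> snd q)) = F \<alpha>" using D(6) by simp
  next
    fix \<alpha> \<beta> F assume a: "\<alpha> \<in> Noniso" and b: "\<beta> \<in> Mor C" "Dom C \<beta> = Cod C \<alpha>"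
      and F: "F \<in> noniso_pairs (Cod C \<beta>) \<rightarrow> carrier k"
    note f = GU[OF a]
    note D = initial_factorizationD[OF f]
    have fb: "initial_factorization (\<beta> \<bullet> \<alpha>) (\<beta> \<bullet> G \<alpha>) (U \<alpha>)"
      using initial_factorization_Comp[OF f b(1)] b(2) by simp
    have c: "Cod C (\<beta> \<bullet> \<alpha>) = Cod C \<beta>" using Comp_Mor(3)[OF b(1) D(8)] b(2) by simp
    have Fb: "F (\<beta> \<bullet> fst q, snd q) \<in> carrier k" if "q \<in> noniso_pairs (Cod C \<alpha>)" for q
      using noniso_pairs_Comp(1)[OF that b] F by auto
    have "(\<Oplus>q\<in>noniso_pairs (Cod C \<beta>). V (\<beta> \<bullet> \<alpha>) q \<otimes> F q) =
        (\<Oplus>p\<in>Aut_pairs (U \<alpha>). W (U \<alpha>) p \<otimes> F ((\<beta> \<bullet> G \<alpha>) \<bullet> fst p, snd p))"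
      using expand[OF fb, of F] F c by simp
    also have "\<dots> = (\<Oplus>p\<in>Aut_pairs (U \<alpha>). W (U \<alpha>) p \<otimes> F (\<beta> \<bullet> fst (G \<alpha> \<bullet> fst p, snd p), snd (G \<alpha> \<bullet> fst p, snd p)))"
    proof (rule finsum_cong'[OF refl])
      show "(\<lambda>p. W (U \<alpha>) p \<otimes> F (\<beta> \<bullet> fst (G \<alpha> \<bullet> fst p, snd p), snd (G \<alpha> \<bullet> fst p, snd p))) \<in> Aut_pairs (U \<alpha>) \<rightarrow> carrier k"
        using W(1)[OF D(2)] Fb[OF shift(1)[OF f]] by auto
      fix p assume p: "p \<in> Aut_pairs (U \<alpha>)"
      have "(\<beta> \<bullet> G \<alpha>) \<bullet> fst p = \<beta> \<bullet> G \<alpha> \<bullet> fst p"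
        by (rule Comp_Mor_assoc) (use b D(1,5,10) shift(3-5)[OF f p] in auto)
      then show "W (U \<alpha>) p \<otimes> F ((\<beta> \<bullet> G \<alpha>) \<bullet> fst p, snd p) =
          W (U \<alpha>) p \<otimes> F (\<beta> \<bullet> fst (G \<alpha> \<bullet> fst p, snd p), snd (G \<alpha> \<bullet> fst p, snd p))" by simp
    qed
    also have "\<dots> = (\<Oplus>q\<in>noniso_pairs (Cod C \<alpha>). V \<alpha> q \<otimes> F (\<beta> \<bullet> fst q, snd q))"
      by (rule expand[OF f, symmetric]) (use Fb in auto)
    finally show "(\<Oplus>q\<in>noniso_pairs (Cod C \<beta>). V (\<beta> \<bullet> \<alpha>) q \<otimes> F q) =
        (\<Oplus>q\<in>noniso_pairs (Cod C \<alpha>). V \<alpha> q \<otimes> F (\<beta> \<bullet> fst q, snd q))" .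
  qed
  then show ?thesis by blast
qed

section \<open>The functor K as a module\<close>

abbreviation kC :: "('m \<Rightarrow> 'a) ring" where
  "kC \<equiv> category_algebra k C"

abbreviation KM :: "('m \<Rightarrow> 'a, 'o \<Rightarrow> 'm \<Rightarrow> 'a) module" where
  "KM \<equiv> functor_module C (K_functor k C)"

lemma KM_left_module: "left_module kC KM"
  by (rule K_functor_left_module[OF field_axioms finite_EI_category_axioms skeletal])

lemma kC_carrier: "a \<in> carrier kC \<longleftrightarrow> (\<forall>\<alpha>. a \<alpha> \<in> carrier k) \<and> (\<forall>\<alpha>. \<alpha> \<notin> Mor C \<longrightarrow> a \<alpha> = \<zero>)"
  by (simp add: category_algebra_def free_module_carrier_finite finite_Mor)

lemma finite_K_basis: "finite (K_basis C x)"
  using finite_Noniso by (simp add: K_basis_eq)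

lemma KM_carrier:
  "v \<in> carrier KM \<longleftrightarrow> v \<in> extensional (Ob C) \<and>
    (\<forall>x \<in> Ob C. (\<forall>\<alpha>. v x \<alpha> \<in> carrier k) \<and> (\<forall>\<alpha>. \<alpha> \<notin> K_basis C x \<longrightarrow> v x \<alpha> = \<zero>))"
  by (auto simp: functor_module_def K_functor_def PiE_iff free_module_carrier_finite finite_K_basis)

text \<open>An element of \<open>K\<close>, a family of functions on the sets \<open>K_basis C x\<close>, as a single function on the
  disjoint union of these sets, which is the set of all non-isomorphisms.\<close>

definition coord :: "('o \<Rightarrow> 'm \<Rightarrow> 'a) \<Rightarrow> 'm \<Rightarrow> 'a" where
  "coord v \<alpha> = (if \<alpha> \<in> Noniso then v (Cod C \<alpha>) \<alpha> else \<zero>)"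

definition basis_vector :: "'m \<Rightarrow> 'o \<Rightarrow> 'm \<Rightarrow> 'a" where
  "basis_vector \<alpha> = (\<lambda>x \<in> Ob C. \<lambda>\<delta>. if x = Cod C \<alpha> \<and> \<delta> = \<alpha> then \<one> else \<zero>)"

definition composable_pairs :: "('m \<times> 'm) set" where
  "composable_pairs = {(\<eta>, z). \<eta> \<in> Mor C \<and> z \<in> Noniso \<and> Cod C z = Dom C \<eta>}"

lemma finite_composable_pairs: "finite composable_pairs"
  by (rule finite_subset[of _ "Mor C \<times> Noniso"]) (use finite_Mor finite_Noniso in \<open>auto simp: composable_pairs_def\<close>)

lemma composable_pairs_fibre:
  "{q \<in> composable_pairs. fst q \<bullet> snd q = \<delta>} = {q \<in> noniso_pairs (Cod C \<delta>). fst q \<bullet> snd q = \<delta>}"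
  using Comp_Mor(3) NonisoD(1) by (auto simp: composable_pairs_def noniso_pairs_def)

lemma Cod_Noniso_Ob: "\<alpha> \<in> Noniso \<Longrightarrow> Cod C \<alpha> \<in> Ob C"
  using Cod_closed NonisoD(1) by blast

lemma coord_closed: "v \<in> carrier KM \<Longrightarrow> coord v \<alpha> \<in> carrier k"
  using Cod_Noniso_Ob by (auto simp: coord_def KM_carrier)

lemma coord_zero: "coord \<zero>\<^bsub>KM\<^esub> \<alpha> = \<zero>"
  using Cod_Noniso_Ob by (auto simp: coord_def functor_module_def K_functor_def free_module_def)

lemma coord_add:
  assumes "v \<in> carrier KM" "w \<in> carrier KM"
  shows "coord (v \<oplus>\<^bsub>KM\<^esub> w) \<alpha> = coord v \<alpha> \<oplus> coord w \<alpha>"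
  using Cod_Noniso_Ob by (auto simp: coord_def functor_module_def K_functor_def free_module_def)

lemma coord_eqI:
  assumes "v \<in> carrier KM" "w \<in> carrier KM" "\<And>\<alpha>. \<alpha> \<in> Noniso \<Longrightarrow> coord v \<alpha> = coord w \<alpha>"
  shows "v = w"
proof (rule extensionalityI[of _ "Ob C"])
  fix x assume x: "x \<in> Ob C"
  show "v x = w x"
  proof
    fix \<alpha>
    show "v x \<alpha> = w x \<alpha>"
    proof (cases "\<alpha> \<in> K_basis C x")
      case True
      then show ?thesis using assms(3)[of \<alpha>] by (auto simp: coord_def K_basis_eq)
    next
      case False
      then show ?thesis using assms(1,2) x by (simp add: KM_carrier)
    qed
  qed
qed (use assms in \<open>auto simp: KM_carrier\<close>)

lemma basis_vector_carrier: "\<alpha> \<in> Noniso \<Longrightarrow> basis_vector \<alpha> \<in> carrier KM"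
  by (auto simp: KM_carrier basis_vector_def K_basis_eq)

lemma coord_basis_vector:
  "\<alpha> \<in> Noniso \<Longrightarrow> \<delta> \<in> Noniso \<Longrightarrow> coord (basis_vector \<alpha>) \<delta> = (if \<alpha> = \<delta> then \<one> else \<zero>)"
  using Cod_Noniso_Ob by (auto simp: coord_def basis_vector_def)

lemma coord_smult:
  assumes a: "a \<in> carrier kC" and v: "v \<in> carrier KM" and d: "\<delta> \<in> Noniso"
  shows "coord (a \<odot>\<^bsub>KM\<^esub> v) \<delta> = (\<Oplus>q\<in>{q \<in> composable_pairs. fst q \<bullet> snd q = \<delta>}. a (fst q) \<otimes> coord v (snd q))"
proof -
  interpret F: functor_to_kmod k C "K_functor k C"
    by (rule K_functor_functor[OF finite_EI_category_axioms skeletal])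
  let ?y = "Cod C \<delta>"
  let ?M = "free_module k (K_basis C ?y)"
  let ?E = "{\<eta> \<in> Mor C. Cod C \<eta> = ?y}"
  let ?A = "\<lambda>\<eta>. {\<gamma> \<in> K_basis C (Dom C \<eta>). \<eta> \<bullet> \<gamma> = \<delta>}"
  interpret M: left_module k ?M by (rule free_module_left_module)
  have y: "?y \<in> Ob C" using Cod_Noniso_Ob d .
  have ac: "a \<eta> \<in> carrier k" for \<eta> using a by (simp add: kC_carrier)
  have vc: "v (Dom C \<eta>) \<gamma> \<in> carrier k" if "\<eta> \<in> Mor C" for \<eta> \<gamma>
    using v Dom_closed[OF that] by (simp add: KM_carrier)
  have summand: "a \<eta> \<odot>\<^bsub>?M\<^esub> mor_map (K_functor k C) \<eta> (v (Dom C \<eta>)) \<in> carrier ?M" if "\<eta> \<in> ?E" for \<eta>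
  proof (rule M.smult_closed[OF ac])
    have "mor_map (K_functor k C) \<eta> \<in> module_homs k (obj_map (K_functor k C) (Dom C \<eta>)) (obj_map (K_functor k C) ?y)"
      by (rule F.mor_linear) (use that in \<open>auto simp: Hom_def\<close>)
    moreover have "v (Dom C \<eta>) \<in> carrier (obj_map (K_functor k C) (Dom C \<eta>))"
      using v Dom_closed that by (auto simp: functor_module_def)
    ultimately show "mor_map (K_functor k C) \<eta> (v (Dom C \<eta>)) \<in> carrier ?M"
      by (auto simp: module_homs_def K_functor_def)
  qed
  have "coord (a \<odot>\<^bsub>KM\<^esub> v) \<delta> =
      finsum ?M (\<lambda>\<eta>. a \<eta> \<odot>\<^bsub>?M\<^esub> mor_map (K_functor k C) \<eta> (v (Dom C \<eta>))) ?E \<delta>"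
    using d y by (simp add: coord_def functor_module_def) (simp add: K_functor_def)
  also have "\<dots> = (\<Oplus>\<eta>\<in>?E. (a \<eta> \<odot>\<^bsub>?M\<^esub> mor_map (K_functor k C) \<eta> (v (Dom C \<eta>))) \<delta>)"
    by (subst finsum_free_module) (use summand finite_Mor in auto)
  also have "\<dots> = (\<Oplus>\<eta>\<in>?E. a \<eta> \<otimes> (\<Oplus>\<gamma>\<in>?A \<eta>. v (Dom C \<eta>) \<gamma>))"
    by (simp add: free_module_def K_functor_def)
  also have "\<dots> = (\<Oplus>\<eta>\<in>?E. \<Oplus>\<gamma>\<in>?A \<eta>. a (fst (\<eta>, \<gamma>)) \<otimes> v (Dom C (fst (\<eta>, \<gamma>))) (snd (\<eta>, \<gamma>)))"
  proof (rule finsum_cong'[OF refl])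
    fix \<eta> assume "\<eta> \<in> ?E"
    then show "a \<eta> \<otimes> (\<Oplus>\<gamma>\<in>?A \<eta>. v (Dom C \<eta>) \<gamma>) =
        (\<Oplus>\<gamma>\<in>?A \<eta>. a (fst (\<eta>, \<gamma>)) \<otimes> v (Dom C (fst (\<eta>, \<gamma>))) (snd (\<eta>, \<gamma>)))"
      using finsum_rdistr[of "?A \<eta>" "a \<eta>" "v (Dom C \<eta>)"] ac vc finite_K_basis by auto
  qed (use ac vc in \<open>auto intro!: finsum_closed\<close>)
  also have "\<dots> = (\<Oplus>q\<in>Sigma ?E ?A. a (fst q) \<otimes> v (Dom C (fst q)) (snd q))"
    by (rule finsum_fibres[where f = "\<lambda>q. a (fst q) \<otimes> v (Dom C (fst q)) (snd q)"])
      (use ac vc finite_Mor finite_K_basis in auto)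
  also have "Sigma ?E ?A = {q \<in> composable_pairs. fst q \<bullet> snd q = \<delta>}"
    unfolding composable_pairs_fibre by (auto simp: noniso_pairs_def K_basis_eq)
  also have "(\<Oplus>q\<in>{q \<in> composable_pairs. fst q \<bullet> snd q = \<delta>}. a (fst q) \<otimes> v (Dom C (fst q)) (snd q)) =
      (\<Oplus>q\<in>{q \<in> composable_pairs. fst q \<bullet> snd q = \<delta>}. a (fst q) \<otimes> coord v (snd q))"
    by (rule finsum_cong'[OF refl]) (use ac coord_closed[OF v] in \<open>auto simp: composable_pairs_def coord_def\<close>)
  finally show ?thesis .
qed

lemma single_kC: "\<beta> \<in> Mor C \<Longrightarrow> (\<lambda>\<alpha>. if \<alpha> = \<beta> then \<one> else \<zero>) \<in> carrier kC"
  by (auto simp: kC_carrier)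

lemma kC_mult:
  "(a \<otimes>\<^bsub>kC\<^esub> b) \<eta> = (\<Oplus>p\<in>{(\<alpha>, \<beta>). \<alpha> \<in> Mor C \<and> \<beta> \<in> Mor C \<and> Cod C \<beta> = Dom C \<alpha> \<and> \<alpha> \<bullet> \<beta> = \<eta>}. a (fst p) \<otimes> b (snd p))"
  by (auto simp: category_algebra_def bilinear_extension_def case_prod_unfold intro!: arg_cong2[where f = "finsum k"])

lemma kC_mult_single:
  assumes "\<beta> \<in> Mor C" "a \<in> carrier kC"
  shows "((\<lambda>\<alpha>. if \<alpha> = \<beta> then \<one> else \<zero>) \<otimes>\<^bsub>kC\<^esub> a) \<eta> =
    (\<Oplus>\<eta>'\<in>{\<eta>' \<in> Mor C. Cod C \<eta>' = Dom C \<beta> \<and> \<beta> \<bullet> \<eta>' = \<eta>}. a \<eta>')"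
proof -
  let ?P = "{(\<alpha>, \<beta>). \<alpha> \<in> Mor C \<and> \<beta> \<in> Mor C \<and> Cod C \<beta> = Dom C \<alpha>}"
  have "finite ?P" by (rule finite_subset[of _ "Mor C \<times> Mor C"]) (use finite_Mor in auto)
  then show ?thesis
    using bilinear_extension_single[of ?P a "Comp C" \<beta> \<eta>] assms by (simp add: category_algebra_def free_module_def)
qed

lemma single_smult_basis_vector:
  assumes a: "\<alpha> \<in> Noniso" and b: "\<beta> \<in> Mor C" "Dom C \<beta> = Cod C \<alpha>"
  shows "basis_vector (\<beta> \<bullet> \<alpha>) = (\<lambda>\<gamma>. if \<gamma> = \<beta> then \<one> else \<zero>) \<odot>\<^bsub>KM\<^esub> basis_vector \<alpha>"
proof (rule coord_eqI)
  interpret L: left_module kC KM by (rule KM_left_module)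
  have ba: "\<beta> \<bullet> \<alpha> \<in> Noniso" using Comp_Noniso_right a b by simp
  then show "basis_vector (\<beta> \<bullet> \<alpha>) \<in> carrier KM" by (rule basis_vector_carrier)
  show "(\<lambda>\<gamma>. if \<gamma> = \<beta> then \<one> else \<zero>) \<odot>\<^bsub>KM\<^esub> basis_vector \<alpha> \<in> carrier KM"
    by (rule L.smult_closed[OF single_kC[OF b(1)] basis_vector_carrier[OF a]])
  fix \<delta> assume d: "\<delta> \<in> Noniso"
  let ?Q = "{q \<in> composable_pairs. fst q \<bullet> snd q = \<delta>}"
  have fQ: "finite ?Q" using finite_composable_pairs by simp
  have "coord ((\<lambda>\<gamma>. if \<gamma> = \<beta> then \<one> else \<zero>) \<odot>\<^bsub>KM\<^esub> basis_vector \<alpha>) \<delta> =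
      (\<Oplus>q\<in>?Q. (if fst q = \<beta> then \<one> else \<zero>) \<otimes> coord (basis_vector \<alpha>) (snd q))"
    by (rule coord_smult[OF single_kC[OF b(1)] basis_vector_carrier[OF a] d])
  also have "\<dots> = (\<Oplus>q\<in>?Q. if (\<beta>, \<alpha>) = q then \<one> else \<zero>)"
    by (rule finsum_cong'[OF refl]) (auto simp: composable_pairs_def coord_basis_vector[OF a] split: if_splits)
  also have "\<dots> = (if \<beta> \<bullet> \<alpha> = \<delta> then \<one> else \<zero>)"
  proof (cases "\<beta> \<bullet> \<alpha> = \<delta>")
    case True
    then have i: "(\<beta>, \<alpha>) \<in> ?Q" using a b by (simp add: composable_pairs_def)
    show ?thesis using finsum_singleton[OF i fQ, of "\<lambda>_. \<one>"] True by simp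
  next
    case False
    then have "(\<Oplus>q\<in>?Q. if (\<beta>, \<alpha>) = q then \<one> else \<zero>) = (\<Oplus>q\<in>?Q. \<zero>)" by (intro finsum_cong') auto
    then show ?thesis using False by simp
  qed
  finally show "coord (basis_vector (\<beta> \<bullet> \<alpha>)) \<delta> = coord ((\<lambda>\<gamma>. if \<gamma> = \<beta> then \<one> else \<zero>) \<odot>\<^bsub>KM\<^esub> basis_vector \<alpha>) \<delta>"
    unfolding coord_basis_vector[OF ba d] ..
qed

lemma splitting_if_projective:
  assumes "projective_left_module kC KM"
  shows "\<exists>V. splitting V"
proof -
  let ?act = "\<lambda>q. fst q \<bullet> snd q"
  obtain V where V: "\<And>\<alpha> q. \<alpha> \<in> Noniso \<Longrightarrow> V \<alpha> q \<in> carrier k"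
    "\<And>\<alpha> z. \<alpha> \<in> Noniso \<Longrightarrow> z \<in> Noniso \<Longrightarrow>
      (\<Oplus>q\<in>{q \<in> composable_pairs. ?act q = z}. V \<alpha> q) = (if \<alpha> = z then \<one> else \<zero>)"
    "\<And>s \<alpha> \<alpha>' n z N. s \<in> carrier kC \<Longrightarrow> \<alpha> \<in> Noniso \<Longrightarrow> \<alpha>' \<in> Noniso \<Longrightarrow>
      basis_vector \<alpha>' = s \<odot>\<^bsub>KM\<^esub> basis_vector \<alpha> \<Longrightarrow> finite N \<Longrightarrow>
      (\<And>a. a \<in> carrier kC \<Longrightarrow> (s \<otimes>\<^bsub>kC\<^esub> a) n = (\<Oplus>n'\<in>N. a n')) \<Longrightarrow>
      V \<alpha>' (n, z) = (\<Oplus>n'\<in>N. V \<alpha> (n', z))"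
  proof (rule projective_coefficients[OF assms, of composable_pairs Noniso basis_vector coord ?act])
    show "\<And>a v \<delta>. a \<in> carrier kC \<Longrightarrow> v \<in> carrier KM \<Longrightarrow> \<delta> \<in> Noniso \<Longrightarrow>
      coord (a \<odot>\<^bsub>KM\<^esub> v) \<delta> = (\<Oplus>q\<in>{q \<in> composable_pairs. ?act q = \<delta>}. a (fst q) \<otimes> coord v (snd q))"
      by (rule coord_smult)
  qed (use finite_composable_pairs finite_Noniso basis_vector_carrier coord_closed coord_zero coord_add
      coord_basis_vector kC_carrier in auto)
  have "splitting V"
    unfolding splitting_def
  proof (intro conjI ballI allI impI)
    fix \<alpha> F assume a: "\<alpha> \<in> Noniso" and F: "F \<in> Noniso \<rightarrow> carrier k"
    let ?N = "{z \<in> Noniso. Cod C z = Cod C \<alpha>}"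
    show "(\<Oplus>q\<in>noniso_pairs (Cod C \<alpha>). V \<alpha> q \<otimes> F (?act q)) = F \<alpha>"
    proof (rule finsum_expectation[where act = ?act and Y = ?N])
      show "?act \<in> noniso_pairs (Cod C \<alpha>) \<rightarrow> ?N" using noniso_pairsD(6,8) by auto
      show "V \<alpha> \<in> noniso_pairs (Cod C \<alpha>) \<rightarrow> carrier k" using V(1) a by auto
      fix z assume z: "z \<in> ?N"
      then show "(\<Oplus>q\<in>{q \<in> noniso_pairs (Cod C \<alpha>). ?act q = z}. V \<alpha> q) = (if \<alpha> = z then \<one> else \<zero>)"
        using V(2)[OF a, of z] composable_pairs_fibre[of z] by simp
    qed (use a F finite_noniso_pairs finite_Noniso in auto)
  next
    fix \<alpha> \<beta> F assume a: "\<alpha> \<in> Noniso" and b: "\<beta> \<in> Mor C" "Dom C \<beta> = Cod C \<alpha>"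
      and F: "F \<in> noniso_pairs (Cod C \<beta>) \<rightarrow> carrier k"
    show "(\<Oplus>q\<in>noniso_pairs (Cod C \<beta>). V (\<beta> \<bullet> \<alpha>) q \<otimes> F q) =
        (\<Oplus>q\<in>noniso_pairs (Cod C \<alpha>). V \<alpha> q \<otimes> F (\<beta> \<bullet> fst q, snd q))"
    proof (rule finsum_pushforward[OF finite_noniso_pairs finite_noniso_pairs _ _ F])
      show "(\<lambda>q. (\<beta> \<bullet> fst q, snd q)) \<in> noniso_pairs (Cod C \<alpha>) \<rightarrow> noniso_pairs (Cod C \<beta>)"
        using noniso_pairs_Comp(1)[OF _ b] by auto
      show "V \<alpha> \<in> noniso_pairs (Cod C \<alpha>) \<rightarrow> carrier k" using V(1) a by auto
      fix q assume q: "q \<in> noniso_pairs (Cod C \<beta>)"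
      obtain \<eta> z where ez: "q = (\<eta>, z)" by force
      let ?N = "{\<eta>' \<in> Mor C. Cod C \<eta>' = Dom C \<beta> \<and> \<beta> \<bullet> \<eta>' = \<eta>}"
      have N: "?N = {n. (n, z) \<in> noniso_pairs (Cod C \<alpha>) \<and> \<beta> \<bullet> n = \<eta>}"
        using q ez b Comp_Mor(2)[OF b(1)] by (auto simp: noniso_pairs_def)
      have "V (\<beta> \<bullet> \<alpha>) (\<eta>, z) = (\<Oplus>n\<in>?N. V \<alpha> (n, z))"
        by (rule V(3)[OF single_kC[OF b(1)] a _ single_smult_basis_vector[OF a b]])
          (use finite_Mor kC_mult_single[OF b(1)] Comp_Noniso_right a b in auto)
      also have "\<dots> = (\<Oplus>q'\<in>{q' \<in> noniso_pairs (Cod C \<alpha>). (\<beta> \<bullet> fst q', snd q') = (\<eta>, z)}. V \<alpha> q')"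
        unfolding N by (rule finsum_fibre_fst) (use V(1) a in auto)
      finally show "V (\<beta> \<bullet> \<alpha>) q = (\<Oplus>q'\<in>{q' \<in> noniso_pairs (Cod C \<alpha>). (\<beta> \<bullet> fst q', snd q') = q}. V \<alpha> q')"
        unfolding ez .
    qed
  qed (rule V(1))
  then show ?thesis by blast
qed

section \<open>Projectivity of K from a splitting\<close>

text \<open>The component at the basis vector \<open>z\<close> of the \<open>kC\<close>-linear map \<open>\<alpha> \<mapsto> \<Sum> V \<alpha> (\<eta>, z) \<eta>\<close> from \<open>K\<close> to
  the free module with the non-isomorphisms \<open>z\<close> as basis. The case distinction is necessary because
  \<open>V\<close> is unrestricted on pairs that are not composable.\<close>

definition splitting_component :: "('m \<Rightarrow> 'm \<times> 'm \<Rightarrow> 'a) \<Rightarrow> ('o \<Rightarrow> 'm \<Rightarrow> 'a) \<Rightarrow> 'm \<Rightarrow> 'm \<Rightarrow> 'a" where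
  "splitting_component V v z \<eta> = (if \<eta> \<in> Mor C \<and> Dom C \<eta> = Cod C z
    then (\<Oplus>\<alpha>\<in>{\<alpha> \<in> Noniso. Cod C \<alpha> = Cod C \<eta>}. coord v \<alpha> \<otimes> V \<alpha> (\<eta>, z)) else \<zero>)"

lemma splitting_component_closed:
  assumes "splitting V" "v \<in> carrier KM"
  shows "splitting_component V v z \<in> carrier kC"
  using splittingD(1)[OF assms(1)] coord_closed[OF assms(2)]
  by (auto simp: kC_carrier splitting_component_def intro!: finsum_closed)

lemma splitting_component_add:
  assumes V: "splitting V" and v: "v \<in> carrier KM" "w \<in> carrier KM"
  shows "splitting_component V (v \<oplus>\<^bsub>KM\<^esub> w) z = splitting_component V v z \<oplus>\<^bsub>kC\<^esub> splitting_component V w z"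
proof
  fix \<eta>
  note c = splittingD(1)[OF V] coord_closed[OF v(1)] coord_closed[OF v(2)]
  let ?N = "{\<alpha> \<in> Noniso. Cod C \<alpha> = Cod C \<eta>}"
  have "(\<Oplus>\<alpha>\<in>?N. coord (v \<oplus>\<^bsub>KM\<^esub> w) \<alpha> \<otimes> V \<alpha> (\<eta>, z)) =
      (\<Oplus>\<alpha>\<in>?N. coord v \<alpha> \<otimes> V \<alpha> (\<eta>, z) \<oplus> coord w \<alpha> \<otimes> V \<alpha> (\<eta>, z))"
    by (rule finsum_cong'[OF refl]) (use c in \<open>auto simp: coord_add[OF v] l_distr\<close>)
  also have "\<dots> = (\<Oplus>\<alpha>\<in>?N. coord v \<alpha> \<otimes> V \<alpha> (\<eta>, z)) \<oplus> (\<Oplus>\<alpha>\<in>?N. coord w \<alpha> \<otimes> V \<alpha> (\<eta>, z))"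
    by (rule finsum_addf) (use c in auto)
  finally show "splitting_component V (v \<oplus>\<^bsub>KM\<^esub> w) z \<eta> =
      (splitting_component V v z \<oplus>\<^bsub>kC\<^esub> splitting_component V w z) \<eta>"
    by (simp add: splitting_component_def category_algebra_def free_module_def)
qed

text \<open>Naturality of the splitting tested with the indicator function of a single pair.\<close>

lemma splitting_Comp:
  assumes V: "splitting V" and a: "\<alpha> \<in> Noniso" and b: "\<beta> \<in> Mor C" "Dom C \<beta> = Cod C \<alpha>"
    and q: "(\<eta>, z) \<in> noniso_pairs (Cod C \<beta>)"
  shows "V (\<beta> \<bullet> \<alpha>) (\<eta>, z) = (\<Oplus>\<eta>'\<in>{\<eta>' \<in> Mor C. Cod C \<eta>' = Dom C \<beta> \<and> \<beta> \<bullet> \<eta>' = \<eta>}. V \<alpha> (\<eta>', z))"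
proof -
  let ?F = "\<lambda>q. if q = (\<eta>, z) then \<one> else \<zero>"
  note c = splittingD(1)[OF V a]
  note c' = splittingD(1)[OF V Comp_Noniso_right[OF b(1) a b(2)[symmetric]]]
  have single: "{q \<in> noniso_pairs (Cod C \<beta>). q = (\<eta>, z)} = {(\<eta>, z)}" using q by auto
  have "V (\<beta> \<bullet> \<alpha>) (\<eta>, z) = (\<Oplus>q\<in>{q \<in> noniso_pairs (Cod C \<beta>). q = (\<eta>, z)}. V (\<beta> \<bullet> \<alpha>) q)"
    unfolding single using c' by simp
  also have "\<dots> = (\<Oplus>q\<in>noniso_pairs (Cod C \<beta>). V (\<beta> \<bullet> \<alpha>) q \<otimes> ?F q)"
    by (rule finsum_indicator[symmetric]) (use finite_noniso_pairs c' in auto)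
  also have "\<dots> = (\<Oplus>q\<in>noniso_pairs (Cod C \<alpha>). V \<alpha> q \<otimes> ?F (\<beta> \<bullet> fst q, snd q))"
    by (rule splittingD(3)[OF V a b]) auto
  also have "\<dots> = (\<Oplus>q\<in>{q \<in> noniso_pairs (Cod C \<alpha>). (\<beta> \<bullet> fst q, snd q) = (\<eta>, z)}. V \<alpha> q)"
    by (rule finsum_indicator) (use finite_noniso_pairs c in auto)
  also have "\<dots> = (\<Oplus>n\<in>{n. (n, z) \<in> noniso_pairs (Cod C \<alpha>) \<and> \<beta> \<bullet> n = \<eta>}. V \<alpha> (n, z))"
    by (rule finsum_fibre_fst[symmetric]) (use c in auto)
  also have "{n. (n, z) \<in> noniso_pairs (Cod C \<alpha>) \<and> \<beta> \<bullet> n = \<eta>} =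
      {\<eta>' \<in> Mor C. Cod C \<eta>' = Dom C \<beta> \<and> \<beta> \<bullet> \<eta>' = \<eta>}"
    using q b Comp_Mor(2)[OF b(1)] by (auto simp: noniso_pairs_def)
  finally show ?thesis .
qed

text \<open>Both sides are sums over the triples \<open>(\<beta>, \<eta>', \<alpha>)\<close> with \<open>\<beta> \<bullet> \<eta>' = \<eta>\<close> such that \<open>\<alpha>\<close> and
  \<open>\<eta>'\<close> have the same codomain. On the left the product \<open>\<beta> \<bullet> \<alpha>\<close> comes first and is then
  resolved by naturality of \<open>V\<close>.\<close>

lemma splitting_component_smult:
  assumes V: "splitting V" and a: "a \<in> carrier kC" and v: "v \<in> carrier KM" and z: "z \<in> Noniso"
  shows "splitting_component V (a \<odot>\<^bsub>KM\<^esub> v) z = a \<otimes>\<^bsub>kC\<^esub> splitting_component V v z"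
proof
  fix \<eta>
  let ?I = "splitting_component V v z"
  let ?P = "{(\<alpha>, \<beta>). \<alpha> \<in> Mor C \<and> \<beta> \<in> Mor C \<and> Cod C \<beta> = Dom C \<alpha> \<and> \<alpha> \<bullet> \<beta> = \<eta>}"
  have fP: "finite ?P" by (rule finite_subset[of _ "Mor C \<times> Mor C"]) (use finite_Mor in auto)
  have ac: "a \<alpha> \<in> carrier k" for \<alpha> using a by (simp add: kC_carrier)
  note vc = coord_closed[OF v]
  note Vc = splittingD(1)[OF V]
  have Ic: "?I \<alpha> \<in> carrier k" for \<alpha> using splitting_component_closed[OF V v] by (simp add: kC_carrier)
  show "splitting_component V (a \<odot>\<^bsub>KM\<^esub> v) z \<eta> = (a \<otimes>\<^bsub>kC\<^esub> ?I) \<eta>"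
  proof (cases "\<eta> \<in> Mor C \<and> Dom C \<eta> = Cod C z")
    case False
    have "(a \<otimes>\<^bsub>kC\<^esub> ?I) \<eta> = (\<Oplus>p\<in>?P. \<zero>)"
      unfolding kC_mult
    proof (rule finsum_cong'[OF refl])
      fix p assume "p \<in> ?P"
      then have "\<eta> \<in> Mor C" "Dom C \<eta> = Dom C (snd p)" using Comp_Mor by auto
      then show "a (fst p) \<otimes> ?I (snd p) = \<zero>" using False ac by (simp add: splitting_component_def)
    qed simp
    then show ?thesis using False by (auto simp: splitting_component_def)
  next
    case True
    let ?y = "Cod C \<eta>"
    let ?N = "\<lambda>y. {\<alpha> \<in> Noniso. Cod C \<alpha> = y}"
    let ?H = "\<lambda>\<beta>. {\<eta>' \<in> Mor C. Cod C \<eta>' = Dom C \<beta> \<and> \<beta> \<bullet> \<eta>' = \<eta>}"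
    let ?act = "\<lambda>q. fst q \<bullet> snd q"
    have fN: "finite (?N y)" and fH: "finite (?H \<beta>)" for y \<beta> using finite_Noniso finite_Mor by auto
    have ez: "(\<eta>, z) \<in> noniso_pairs ?y" using True z by (simp add: noniso_pairs_def)
    let ?f = "\<lambda>t. a (fst (fst t)) \<otimes> coord v (snd (fst t)) \<otimes> V (snd (fst t)) (snd t, z)"
    let ?g = "\<lambda>t. a (fst (fst t)) \<otimes> (coord v (snd t) \<otimes> V (snd t) (snd (fst t), z))"
    have "splitting_component V (a \<odot>\<^bsub>KM\<^esub> v) z \<eta> = (\<Oplus>\<alpha>\<in>?N ?y. coord (a \<odot>\<^bsub>KM\<^esub> v) \<alpha> \<otimes> V \<alpha> (\<eta>, z))"
      using True by (simp add: splitting_component_def)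
    also have "\<dots> = (\<Oplus>\<alpha>\<in>?N ?y. \<Oplus>q\<in>{q \<in> noniso_pairs ?y. ?act q = \<alpha>}.
        a (fst q) \<otimes> coord v (snd q) \<otimes> V (?act q) (\<eta>, z))"
    proof (rule finsum_cong'[OF refl])
      fix \<alpha> assume \<alpha>: "\<alpha> \<in> ?N ?y"
      then have \<alpha>N: "\<alpha> \<in> Noniso" "Cod C \<alpha> = ?y" by auto
      let ?Q = "{q \<in> noniso_pairs ?y. ?act q = \<alpha>}"
      have "coord (a \<odot>\<^bsub>KM\<^esub> v) \<alpha> = (\<Oplus>q\<in>?Q. a (fst q) \<otimes> coord v (snd q))"
        unfolding coord_smult[OF a v \<alpha>N(1)] composable_pairs_fibre \<alpha>N(2) ..
      then have "coord (a \<odot>\<^bsub>KM\<^esub> v) \<alpha> \<otimes> V \<alpha> (\<eta>, z) = (\<Oplus>q\<in>?Q. a (fst q) \<otimes> coord v (snd q) \<otimes> V \<alpha> (\<eta>, z))"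
        using finsum_ldistr[of ?Q "V \<alpha> (\<eta>, z)" "\<lambda>q. a (fst q) \<otimes> coord v (snd q)"] finite_noniso_pairs ac vc Vc[OF \<alpha>N(1)]
        by auto
      also have "\<dots> = (\<Oplus>q\<in>?Q. a (fst q) \<otimes> coord v (snd q) \<otimes> V (?act q) (\<eta>, z))"
        by (rule finsum_cong'[OF refl]) (use ac vc Vc[OF \<alpha>N(1)] in auto)
      finally show "coord (a \<odot>\<^bsub>KM\<^esub> v) \<alpha> \<otimes> V \<alpha> (\<eta>, z) =
          (\<Oplus>q\<in>?Q. a (fst q) \<otimes> coord v (snd q) \<otimes> V (?act q) (\<eta>, z))" .
    qed (use ac vc Vc noniso_pairsD(6) in \<open>auto intro!: finsum_closed\<close>)
    also have "\<dots> = (\<Oplus>q\<in>noniso_pairs ?y. a (fst q) \<otimes> coord v (snd q) \<otimes> V (?act q) (\<eta>, z))"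
      by (rule finsum_group_by) (use finite_noniso_pairs fN noniso_pairsD(6,8) ac vc Vc in auto)
    also have "\<dots> = (\<Oplus>q\<in>noniso_pairs ?y. \<Oplus>\<eta>'\<in>?H (fst q). ?f (q, \<eta>'))"
    proof (rule finsum_cong'[OF refl])
      fix q assume q: "q \<in> noniso_pairs ?y"
      note q' = noniso_pairsD[OF q]
      have "V (?act q) (\<eta>, z) = (\<Oplus>\<eta>'\<in>?H (fst q). V (snd q) (\<eta>', z))"
        by (rule splitting_Comp[OF V q'(3,1) q'(5)[symmetric]]) (use q' ez in simp)
      then show "a (fst q) \<otimes> coord v (snd q) \<otimes> V (?act q) (\<eta>, z) = (\<Oplus>\<eta>'\<in>?H (fst q). ?f (q, \<eta>'))"
        using finsum_rdistr[OF fH, of "a (fst q) \<otimes> coord v (snd q)" "\<lambda>\<eta>'. V (snd q) (\<eta>', z)" "fst q"] ac vc Vc[OF q'(3)]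
        by auto
    qed (use ac vc Vc noniso_pairsD(3) in \<open>auto intro!: finsum_closed\<close>)
    also have "\<dots> = (\<Oplus>t\<in>(SIGMA q:noniso_pairs ?y. ?H (fst q)). ?f t)"
      by (rule finsum_fibres) (use finite_noniso_pairs fH ac vc Vc noniso_pairsD(3) in auto)
    also have "\<dots> = (\<Oplus>t\<in>(SIGMA p:?P. ?N (Cod C (snd p))). ?g t)"
    proof -
      let ?h = "\<lambda>((\<beta>, \<eta>'), \<alpha>). ((\<beta>, \<alpha>), \<eta>')"
      have im: "(SIGMA q:noniso_pairs ?y. ?H (fst q)) = ?h ` (SIGMA p:?P. ?N (Cod C (snd p)))"
      proof (intro equalityI subsetI)
        fix t assume "t \<in> (SIGMA q:noniso_pairs ?y. ?H (fst q))"
        then obtain \<beta> \<alpha> \<eta>' where "t = ?h ((\<beta>, \<eta>'), \<alpha>)" "((\<beta>, \<eta>'), \<alpha>) \<in> (SIGMA p:?P. ?N (Cod C (snd p)))"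
          by (auto simp: noniso_pairs_def)
        then show "t \<in> ?h ` (SIGMA p:?P. ?N (Cod C (snd p)))" by (rule image_eqI)
      qed (auto simp: noniso_pairs_def Comp_Mor(3))
      show ?thesis
        unfolding im
      proof (subst finsum_reindex)
        show "(\<Oplus>t\<in>(SIGMA p:?P. ?N (Cod C (snd p))). ?f (?h t)) = (\<Oplus>t\<in>(SIGMA p:?P. ?N (Cod C (snd p))). ?g t)"
          by (rule finsum_cong'[OF refl]) (use ac vc Vc in \<open>auto simp: m_assoc\<close>)
      qed (use ac vc Vc in \<open>auto simp: inj_on_def\<close>)
    qed
    also have "\<dots> = (\<Oplus>p\<in>?P. \<Oplus>\<alpha>\<in>?N (Cod C (snd p)). ?g (p, \<alpha>))"
      by (rule finsum_fibres[symmetric]) (use fP fN ac vc Vc in auto)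
    also have "\<dots> = (\<Oplus>p\<in>?P. a (fst p) \<otimes> ?I (snd p))"
    proof (rule finsum_cong'[OF refl])
      fix p assume p: "p \<in> ?P"
      then have "Dom C (snd p) = Dom C \<eta>" "snd p \<in> Mor C" using Comp_Mor by auto
      then have "?I (snd p) = (\<Oplus>\<alpha>\<in>?N (Cod C (snd p)). coord v \<alpha> \<otimes> V \<alpha> (snd p, z))"
        using True by (simp add: splitting_component_def)
      then show "(\<Oplus>\<alpha>\<in>?N (Cod C (snd p)). ?g (p, \<alpha>)) = a (fst p) \<otimes> ?I (snd p)"
        using finsum_rdistr[OF fN, of "a (fst p)" "\<lambda>\<alpha>. coord v \<alpha> \<otimes> V \<alpha> (snd p, z)" "Cod C (snd p)"] ac vc Vc
        by auto
    qed (use ac Ic in auto)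
    finally show ?thesis unfolding kC_mult .
  qed
qed

text \<open>Evaluation \<open>(\<eta>, z) \<mapsto> \<eta> \<bullet> z\<close> undoes the map given by the components, because \<open>V \<alpha>\<close> has the point
  mass at \<open>\<alpha>\<close> as image.\<close>

lemma splitting_component_sum:
  assumes V: "splitting V" and v: "v \<in> carrier KM" and d: "\<delta> \<in> Noniso"
  shows "(\<Oplus>q\<in>{q \<in> composable_pairs. fst q \<bullet> snd q = \<delta>}. splitting_component V v (snd q) (fst q)) = coord v \<delta>"
proof -
  let ?y = "Cod C \<delta>"
  let ?N = "{\<alpha> \<in> Noniso. Cod C \<alpha> = ?y}"
  let ?Q = "{q \<in> noniso_pairs ?y. fst q \<bullet> snd q = \<delta>}"
  note vc = coord_closed[OF v]
  note Vc = splittingD(1)[OF V]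
  have fQ: "finite ?Q" and fN: "finite ?N" using finite_noniso_pairs finite_Noniso by auto
  have "(\<Oplus>q\<in>{q \<in> composable_pairs. fst q \<bullet> snd q = \<delta>}. splitting_component V v (snd q) (fst q)) =
      (\<Oplus>q\<in>?Q. \<Oplus>\<alpha>\<in>?N. coord v \<alpha> \<otimes> V \<alpha> q)"
    unfolding composable_pairs_fibre
    by (rule finsum_cong'[OF refl])
      (use vc Vc in \<open>auto simp: splitting_component_def noniso_pairs_def intro!: finsum_closed\<close>)
  also have "\<dots> = (\<Oplus>\<alpha>\<in>?N. \<Oplus>q\<in>?Q. coord v \<alpha> \<otimes> V \<alpha> q)"
    by (rule finsum_swap) (use fQ fN vc Vc in auto)
  also have "\<dots> = (\<Oplus>\<alpha>\<in>?N. if \<delta> = \<alpha> then coord v \<alpha> else \<zero>)"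
  proof (rule finsum_cong'[OF refl])
    fix \<alpha> assume \<alpha>: "\<alpha> \<in> ?N"
    let ?F = "\<lambda>\<epsilon>. if \<epsilon> = \<delta> then \<one> else \<zero>"
    have "(\<Oplus>q\<in>?Q. V \<alpha> q) = (\<Oplus>q\<in>noniso_pairs (Cod C \<alpha>). V \<alpha> q \<otimes> ?F (fst q \<bullet> snd q))"
      using finsum_indicator[OF finite_noniso_pairs[of ?y], of "V \<alpha>" "\<lambda>q. fst q \<bullet> snd q = \<delta>"] Vc \<alpha> by simp
    also have "\<dots> = ?F \<alpha>" by (rule splittingD(2)[OF V, where F = ?F]) (use \<alpha> in auto)
    finally have V_sum: "(\<Oplus>q\<in>?Q. V \<alpha> q) = ?F \<alpha>" .
    have "(\<Oplus>q\<in>?Q. coord v \<alpha> \<otimes> V \<alpha> q) = coord v \<alpha> \<otimes> (\<Oplus>q\<in>?Q. V \<alpha> q)"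
      by (rule finsum_rdistr[symmetric, OF fQ vc]) (use Vc \<alpha> in auto)
    then show "(\<Oplus>q\<in>?Q. coord v \<alpha> \<otimes> V \<alpha> q) = (if \<delta> = \<alpha> then coord v \<alpha> else \<zero>)"
      unfolding V_sum using vc[of \<alpha>] by simp
  qed (use vc in auto)
  also have "\<dots> = coord v \<delta>"
    by (rule finsum_singleton) (use fN d vc in auto)
  finally show ?thesis .
qed

lemma inj_basis_vector: "inj_on basis_vector Noniso"
proof (rule inj_onI)
  fix \<alpha> \<beta> assume N: "\<alpha> \<in> Noniso" "\<beta> \<in> Noniso" and eq: "basis_vector \<alpha> = basis_vector \<beta>"
  have "(if \<beta> = \<alpha> then \<one> else \<zero>) = \<one>"
    using coord_basis_vector[OF N(1,1)] coord_basis_vector[OF N(2,1)] unfolding eq by simp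
  then show "\<alpha> = \<beta>" using one_not_zero by (simp split: if_splits)
qed

text \<open>The free module has the basis vectors of \<open>K\<close> as its basis: they represent the non-isomorphisms
  inside the type of the elements of \<open>K\<close>.\<close>

lemma projective_if_splitting:
  assumes V: "splitting V"
  shows "projective_left_module kC KM"
proof -
  interpret L: left_module kC KM by (rule KM_left_module)
  let ?B = "basis_vector ` Noniso"
  let ?F = "free_module kC ?B"
  let ?z = "the_inv_into Noniso basis_vector"
  let ?i = "\<lambda>v b. if b \<in> ?B then splitting_component V v (?z b) else \<zero>\<^bsub>kC\<^esub>"
  let ?p = "\<lambda>f. finsum KM (\<lambda>z. f (basis_vector z) \<odot>\<^bsub>KM\<^esub> basis_vector z) Noniso"
  have z: "?z (basis_vector z) = z" if "z \<in> Noniso" for z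
    by (rule the_inv_into_f_f[OF inj_basis_vector that])
  have zB: "?z b \<in> Noniso" if "b \<in> ?B" for b using that z by auto
  have fB: "finite ?B" using finite_Noniso by simp
  have F: "f \<in> carrier ?F \<longleftrightarrow> (\<forall>b. f b \<in> carrier kC) \<and> (\<forall>b. b \<notin> ?B \<longrightarrow> f b = \<zero>\<^bsub>kC\<^esub>)" for f
    by (rule L.free_module_carrier_finite[OF fB])
  have i: "?i \<in> module_homs kC KM ?F"
    unfolding module_homs_def
  proof (intro CollectI conjI ballI)
    show "?i \<in> carrier KM \<rightarrow> carrier ?F"
      using splitting_component_closed[OF V] by (intro Pi_I) (simp add: F)
    show "?i (v \<oplus>\<^bsub>KM\<^esub> w) = ?i v \<oplus>\<^bsub>?F\<^esub> ?i w" if "v \<in> carrier KM" "w \<in> carrier KM" for v w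
      using splitting_component_add[OF V that] by (auto simp: free_module_def)
    show "?i (a \<odot>\<^bsub>KM\<^esub> v) = a \<odot>\<^bsub>?F\<^esub> ?i v" if "a \<in> carrier kC" "v \<in> carrier KM" for a v
      using splitting_component_smult[OF V that zB] that by (auto simp: free_module_def)
  qed
  have fc: "f b \<in> carrier kC" if "f \<in> carrier ?F" for f b using that F by blast
  have summand: "f (basis_vector z) \<odot>\<^bsub>KM\<^esub> basis_vector z \<in> carrier KM" if "f \<in> carrier ?F" "z \<in> Noniso" for f z
    by (rule L.smult_closed[OF fc[OF that(1)] basis_vector_carrier[OF that(2)]])
  have pc: "?p f \<in> carrier KM" if "f \<in> carrier ?F" for f
    by (rule L.M.finsum_closed) (use summand[OF that] in auto)
  have p: "?p \<in> module_homs kC ?F KM"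
    unfolding module_homs_def
  proof (intro CollectI conjI ballI)
    show "?p \<in> carrier ?F \<rightarrow> carrier KM" using pc by auto
    show "?p (f \<oplus>\<^bsub>?F\<^esub> g) = ?p f \<oplus>\<^bsub>KM\<^esub> ?p g" if fg: "f \<in> carrier ?F" "g \<in> carrier ?F" for f g
    proof -
      have "?p (f \<oplus>\<^bsub>?F\<^esub> g) = finsum KM (\<lambda>z. f (basis_vector z) \<odot>\<^bsub>KM\<^esub> basis_vector z \<oplus>\<^bsub>KM\<^esub>
          g (basis_vector z) \<odot>\<^bsub>KM\<^esub> basis_vector z) Noniso"
      proof (rule L.M.finsum_cong'[OF refl])
        fix z assume "z \<in> Noniso"
        then show "(f \<oplus>\<^bsub>?F\<^esub> g) (basis_vector z) \<odot>\<^bsub>KM\<^esub> basis_vector z =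
            f (basis_vector z) \<odot>\<^bsub>KM\<^esub> basis_vector z \<oplus>\<^bsub>KM\<^esub> g (basis_vector z) \<odot>\<^bsub>KM\<^esub> basis_vector z"
          using L.smult_l_distr[OF fc[OF fg(1)] fc[OF fg(2)] basis_vector_carrier] by (simp add: free_module_def)
      qed (use summand fg in auto)
      also have "\<dots> = ?p f \<oplus>\<^bsub>KM\<^esub> ?p g"
        by (rule L.M.finsum_addf) (use summand fg in auto)
      finally show ?thesis .
    qed
    show "?p (a \<odot>\<^bsub>?F\<^esub> f) = a \<odot>\<^bsub>KM\<^esub> ?p f" if a: "a \<in> carrier kC" and f: "f \<in> carrier ?F" for a f
    proof -
      have "?p (a \<odot>\<^bsub>?F\<^esub> f) = finsum KM (\<lambda>z. a \<odot>\<^bsub>KM\<^esub> (f (basis_vector z) \<odot>\<^bsub>KM\<^esub> basis_vector z)) Noniso"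
      proof (rule L.M.finsum_cong'[OF refl])
        fix z assume "z \<in> Noniso"
        then show "(a \<odot>\<^bsub>?F\<^esub> f) (basis_vector z) \<odot>\<^bsub>KM\<^esub> basis_vector z =
            a \<odot>\<^bsub>KM\<^esub> (f (basis_vector z) \<odot>\<^bsub>KM\<^esub> basis_vector z)"
          using L.smult_assoc[OF a fc[OF f] basis_vector_carrier] by (simp add: free_module_def)
      qed (use L.smult_closed[OF a] summand[OF f] in auto)
      also have "\<dots> = a \<odot>\<^bsub>KM\<^esub> ?p f"
        by (rule L.smult_finsum[symmetric, OF a finite_Noniso]) (use summand f in auto)
      finally show ?thesis .
    qed
  qed
  have "?p (?i v) = v" if v: "v \<in> carrier KM" for v
  proof (rule coord_eqI)
    have iv: "?i v \<in> carrier ?F" using i v by (simp add: module_homs_def Pi_iff)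
    show "?p (?i v) \<in> carrier KM" by (rule pc[OF iv])
    fix \<delta> assume d: "\<delta> \<in> Noniso"
    let ?Q = "{q \<in> composable_pairs. fst q \<bullet> snd q = \<delta>}"
    let ?I = "splitting_component V v"
    have fQ: "finite ?Q" using finite_composable_pairs by simp
    have Ic: "?I z \<eta> \<in> carrier k" for z \<eta> using splitting_component_closed[OF V v] by (simp add: kC_carrier)
    have "coord (?p (?i v)) \<delta> = (\<Oplus>z\<in>Noniso. coord (?i v (basis_vector z) \<odot>\<^bsub>KM\<^esub> basis_vector z) \<delta>)"
      by (rule finsum_additive[where h = "\<lambda>w. coord w \<delta>"])
        (use coord_closed coord_zero coord_add finite_Noniso summand[OF iv] L.M.abelian_monoid_axioms
          abelian_monoid_axioms in auto)
    also have "\<dots> = (\<Oplus>z\<in>Noniso. \<Oplus>q\<in>?Q. if snd q = z then ?I z (fst q) else \<zero>)"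
    proof (rule finsum_cong'[OF refl])
      fix w assume w: "w \<in> Noniso"
      have "coord (?i v (basis_vector w) \<odot>\<^bsub>KM\<^esub> basis_vector w) \<delta> =
          (\<Oplus>q\<in>?Q. ?I w (fst q) \<otimes> coord (basis_vector w) (snd q))"
        using coord_smult[OF splitting_component_closed[OF V v, of w] basis_vector_carrier[OF w] d] w z[OF w] by simp
      also have "\<dots> = (\<Oplus>q\<in>?Q. if snd q = w then ?I w (fst q) else \<zero>)"
        by (rule finsum_cong'[OF refl]) (use Ic in \<open>auto simp: composable_pairs_def coord_basis_vector[OF w]\<close>)
      finally show "coord (?i v (basis_vector w) \<odot>\<^bsub>KM\<^esub> basis_vector w) \<delta> =
          (\<Oplus>q\<in>?Q. if snd q = w then ?I w (fst q) else \<zero>)" .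
    qed (use Ic in \<open>auto intro!: finsum_closed\<close>)
    also have "\<dots> = (\<Oplus>q\<in>?Q. \<Oplus>z\<in>Noniso. if snd q = z then ?I z (fst q) else \<zero>)"
      by (rule finsum_swap) (use finite_Noniso fQ Ic in auto)
    also have "\<dots> = (\<Oplus>q\<in>?Q. ?I (snd q) (fst q))"
    proof (rule finsum_cong'[OF refl])
      fix q assume "q \<in> ?Q"
      then have "snd q \<in> Noniso" by (auto simp: composable_pairs_def)
      then show "(\<Oplus>z\<in>Noniso. if snd q = z then ?I z (fst q) else \<zero>) = ?I (snd q) (fst q)"
        using finsum_singleton[of "snd q" Noniso "\<lambda>z. ?I z (fst q)"] finite_Noniso Ic by auto
    qed (use Ic in auto)
    also have "\<dots> = coord v \<delta>" by (rule splitting_component_sum[OF V v d])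
    finally show "coord (?p (?i v)) \<delta> = coord v \<delta>" .
  qed (rule v)
  then show ?thesis
    unfolding projective_left_module_def using i p KM_left_module by blast
qed

end

theorem proposition3p3:
  fixes k :: "('a, 'q) ring_scheme" and C :: "('o, 'm) category"
  assumes "field k"
    and "finite_EI_category C"
    and "skeletal C"
    and "projective_over k C"
  shows "projective_left_module (category_algebra k C) (functor_module C (K_functor k C))
    \<longleftrightarrow> free_EI C"
proof -
  interpret skeletal_EI_category_over_field C k
    using assms(1-3)
    by (intro skeletal_EI_category_over_field.intro skeletal_EI_category.intro skeletal_EI_category_axioms.intro)
  show ?thesis
    unfolding free_EI_iff_unique_initial_factorization
    using splitting_if_projective unique_initial_factorization_if_splitting
      splitting_if_unique_initial_factorization[OF assms(4)] projective_if_splitting by blast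
qed

end
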